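(* Let $A$ be a commutative noetherian ring and $\mathfrak a$ an ideal of $A$. Then $D^0_{\rm cof}(A,\mathfrak a)$ is a thick subcategory of $D(A)$ if and only if $\mathcal{M}^0(A,\mathfrak a)_{\rm cof}$ is an abelian subcategory of $\operatorname{Mod} A$.
   Context: $\mathcal{M}^0(A,\mathfrak a)_{\rm cof}$ is the full subcategory of $\operatorname{Mod}A$ of modules $M$ with $\operatorname{Ext}^i_A(A/\mathfrak a,M)$ finitely generated for all $i\ge 0$. It is an abelian subcategory if it is closed under kernels and cokernels of its morphisms. $D(A)$ is the derived category of $A$-modules; $D^0_{\rm cof}(A,\mathfrak a)$ is the full subcategory of $D(A)$ of complexes $X^{\bullet}$ with $H^i(X^{\bullet})\in\mathcal{M}^0(A,\mathfrak a)_{\rm cof}$ for all integers $i$. A (full) subcategory $\mathcal T$ of $D(A)$ is thick if it is closed under direct summands and, for any exact triangle $X\to Y\to Z\to\Sigma X$ in $D(A)$, if two of $X,Y,Z$ are in $\mathcal T$ then so is the third. *)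

theory Defs
  imports
    "HOL-Algebra.QuotRing"
    "HOL-Algebra.Ring_Divisibility"
    "HOL-Library.Infinite_Typeclass"
    "Jordan_Normal_Form.Missing_VectorSpace"
begin

text \<open>
  The objects of \<open>Mod A\<close> are the \<open>A\<close>-modules whose elements are taken from a fixed type \<open>'m\<close>, which
  plays the role of the set-theoretic universe. It is an arbitrary infinite type: this is what
  makes \<open>Mod A\<close> contain binary direct sums (hence mapping cones), next to submodules and quotients.
  The multiplicative part of a \<^type>\<open>module\<close> record is ignored throughout, and linear maps that
  have to be compared for equality are extensional on the carrier of their domain.
\<close>

section \<open>Modules\<close>

definition hom_set ::
  "('a, 'b) ring_scheme \<Rightarrow> ('a, 'm) module \<Rightarrow> ('a, 'n) module \<Rightarrow> ('m \<Rightarrow> 'n) set" where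
  "hom_set R M N = module_hom R M N \<inter> extensional (carrier M)"

definition hom_module ::
  "('a, 'b) ring_scheme \<Rightarrow> ('a, 'm) module \<Rightarrow> ('a, 'n) module \<Rightarrow> ('a, 'm \<Rightarrow> 'n) module" where
  "hom_module R M N =
    \<lparr>carrier = hom_set R M N, mult = undefined, one = undefined,
     zero = (\<lambda>x\<in>carrier M. \<zero>\<^bsub>N\<^esub>),
     add = (\<lambda>f g. \<lambda>x\<in>carrier M. f x \<oplus>\<^bsub>N\<^esub> g x),
     smult = (\<lambda>r f. \<lambda>x\<in>carrier M. r \<odot>\<^bsub>N\<^esub> f x)\<rparr>"

definition module_iso ::
  "('a, 'b) ring_scheme \<Rightarrow> ('a, 'm) module \<Rightarrow> ('a, 'n) module \<Rightarrow> bool" where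
  "module_iso R M N \<longleftrightarrow> (\<exists>f \<in> module_hom R M N. bij_betw f (carrier M) (carrier N))"

definition quot_module :: "('a, 'm) module \<Rightarrow> 'm set \<Rightarrow> ('a, 'm set) module" where
  "quot_module M N =
    \<lparr>carrier = a_rcosets\<^bsub>M\<^esub> N, mult = undefined, one = undefined,
     zero = N, add = set_add M,
     smult = (\<lambda>r C. \<Union>x\<in>C. N +>\<^bsub>M\<^esub> (r \<odot>\<^bsub>M\<^esub> x))\<rparr>"

definition regular_module :: "('a, 'b) ring_scheme \<Rightarrow> ('a, 'a) module" where
  "regular_module R =
    \<lparr>carrier = carrier R, mult = (\<otimes>\<^bsub>R\<^esub>), one = \<one>\<^bsub>R\<^esub>, zero = \<zero>\<^bsub>R\<^esub>, add = (\<oplus>\<^bsub>R\<^esub>), smult = (\<otimes>\<^bsub>R\<^esub>)\<rparr>"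

definition finitely_generated :: "('a, 'b) ring_scheme \<Rightarrow> ('a, 'm) module \<Rightarrow> bool" where
  "finitely_generated R M \<longleftrightarrow>
    (\<exists>S. finite S \<and> S \<subseteq> carrier M \<and> module.span R M S = carrier M)"

definition free_module :: "('a, 'b) ring_scheme \<Rightarrow> ('a, 'm) module \<Rightarrow> bool" where
  "free_module R M \<longleftrightarrow> module R M \<and>
    (\<exists>B \<subseteq> carrier M. module.span R M B = carrier M \<and> \<not> module.lin_dep R M B)"

text \<open>Renaming the elements of a module along a map that is injective on its carrier.\<close>

definition relabel_module :: "('m \<Rightarrow> 'n) \<Rightarrow> ('a, 'm) module \<Rightarrow> ('a, 'n) module" where
  "relabel_module g M = (let h = inv_into (carrier M) g in
    \<lparr>carrier = g ` carrier M, mult = undefined, one = undefined,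
     zero = g \<zero>\<^bsub>M\<^esub>,
     add = (\<lambda>x y. g (h x \<oplus>\<^bsub>M\<^esub> h y)),
     smult = (\<lambda>r x. g (r \<odot>\<^bsub>M\<^esub> h x))\<rparr>)"


section \<open>Ext\<close>

text \<open>An augmented free resolution \<open>\<dots> \<rightarrow> P 1 \<rightarrow> P 0 \<rightarrow> N \<rightarrow> 0\<close>, with \<open>d i : P (i + 1) \<rightarrow> P i\<close>.\<close>

definition free_resolution ::
  "('a, 'b) ring_scheme \<Rightarrow> ('a, 'n) module \<Rightarrow>
   (nat \<Rightarrow> ('a, 'p) module) \<Rightarrow> (nat \<Rightarrow> 'p \<Rightarrow> 'p) \<Rightarrow> ('p \<Rightarrow> 'n) \<Rightarrow> bool" where
  "free_resolution R N P d e \<longleftrightarrow>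
    (\<forall>i. free_module R (P i)) \<and>
    (\<forall>i. d i \<in> hom_set R (P (Suc i)) (P i)) \<and>
    e \<in> hom_set R (P 0) N \<and>
    e ` carrier (P 0) = carrier N \<and>
    d 0 ` carrier (P 1) = a_kernel (P 0) N e \<and>
    (\<forall>i. d (Suc i) ` carrier (P (Suc (Suc i))) = a_kernel (P (Suc i)) (P i) (d i))"

text \<open>
  A chosen free resolution of \<open>N\<close>. Submodules of free modules on at most \<open>\<kappa>\<close> generators, where
  \<open>\<kappa>\<close> is an infinite cardinal bounding \<open>\<bar>N\<bar>\<close> and \<open>\<bar>R\<bar>\<close>, again have at most \<open>\<kappa>\<close> elements. So all free
  modules needed can be realised inside the functions from the index type \<open>('n + 'a) list\<close> to
  the ring, and a resolution in this type exists for every module \<open>N\<close>.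
\<close>

definition chosen_resolution ::
  "('a, 'b) ring_scheme \<Rightarrow> ('a, 'n) module \<Rightarrow>
   (nat \<Rightarrow> ('a, ('n + 'a) list \<Rightarrow> 'a) module) \<times>
   (nat \<Rightarrow> (('n + 'a) list \<Rightarrow> 'a) \<Rightarrow> (('n + 'a) list \<Rightarrow> 'a))" where
  "chosen_resolution R N = (SOME (P, d). \<exists>e. free_resolution R N P d e)"

text \<open>The \<open>i\<close>-th cohomology module of the complex \<open>Hom(P 0, M) \<rightarrow> Hom(P 1, M) \<rightarrow> \<dots>\<close>.\<close>

definition hom_cohomology ::
  "('a, 'b) ring_scheme \<Rightarrow> (nat \<Rightarrow> ('a, 'p) module) \<Rightarrow> (nat \<Rightarrow> 'p \<Rightarrow> 'p) \<Rightarrow>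
   ('a, 'm) module \<Rightarrow> nat \<Rightarrow> ('a, ('p \<Rightarrow> 'm) set) module" where
  "hom_cohomology R P d M i =
    (let C = (\<lambda>i. hom_module R (P i) M);
         \<delta> = (\<lambda>i f. compose (carrier (P (Suc i))) f (d i));
         Z = a_kernel (C i) (C (Suc i)) (\<delta> i);
         B = (case i of 0 \<Rightarrow> {\<zero>\<^bsub>C 0\<^esub>} | Suc j \<Rightarrow> \<delta> j ` carrier (C j))
     in quot_module ((C i)\<lparr>carrier := Z\<rparr>) B)"

definition Ext ::
  "('a, 'b) ring_scheme \<Rightarrow> nat \<Rightarrow> ('a, 'n) module \<Rightarrow> ('a, 'm) module \<Rightarrow>
   ('a, ((('n + 'a) list \<Rightarrow> 'a) \<Rightarrow> 'm) set) module" where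
  "Ext R i N M = (case chosen_resolution R N of (P, d) \<Rightarrow> hom_cohomology R P d M i)"

definition M0cof :: "('a, 'b) ring_scheme \<Rightarrow> 'a set \<Rightarrow> ('a, 'm) module set" where
  "M0cof A \<aa> = {M. module A M \<and>
    (\<forall>i. finitely_generated A (Ext A i (quot_module (regular_module A) \<aa>) M))}"

text \<open>
  A full subcategory of \<open>Mod A\<close> is given by its set of objects. Every kernel and every cokernel
  is isomorphic to some module over the type \<open>'m\<close>; for the cokernel, whose standard model has
  carrier type \<^typ>\<open>'m set\<close>, choose representatives of the cosets.
\<close>

definition abelian_subcategory ::
  "('a, 'b) ring_scheme \<Rightarrow> ('a, 'm) module set \<Rightarrow> bool" where
  "abelian_subcategory A \<C> \<longleftrightarrow> \<C> \<subseteq> {M. module A M} \<and>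
    (\<forall>M \<in> \<C>. \<forall>N \<in> \<C>. \<forall>f \<in> hom_set A M N.
      (\<forall>K. module A K \<and> module_iso A (M\<lparr>carrier := a_kernel M N f\<rparr>) K \<longrightarrow> K \<in> \<C>) \<and>
      (\<forall>Q. module A Q \<and> module_iso A (quot_module N (f ` carrier M)) Q \<longrightarrow> Q \<in> \<C>))"


section \<open>Cochain complexes\<close>

record ('a, 'm) cochain_complex =
  obj :: "int \<Rightarrow> ('a, 'm) module"
  diff :: "int \<Rightarrow> 'm \<Rightarrow> 'm"

definition is_complex :: "('a, 'b) ring_scheme \<Rightarrow> ('a, 'm) cochain_complex \<Rightarrow> bool" where
  "is_complex R X \<longleftrightarrow>
    (\<forall>n. module R (obj X n)) \<and>
    (\<forall>n. diff X n \<in> module_hom R (obj X n) (obj X (n + 1))) \<and>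
    (\<forall>n. \<forall>x \<in> carrier (obj X n). diff X (n + 1) (diff X n x) = \<zero>\<^bsub>obj X (n + 1 + 1)\<^esub>)"

definition cochain_map ::
  "('a, 'b) ring_scheme \<Rightarrow> ('a, 'm) cochain_complex \<Rightarrow> ('a, 'm) cochain_complex \<Rightarrow>
   (int \<Rightarrow> 'm \<Rightarrow> 'm) \<Rightarrow> bool" where
  "cochain_map R X Y f \<longleftrightarrow> is_complex R X \<and> is_complex R Y \<and>
    (\<forall>n. f n \<in> hom_set R (obj X n) (obj Y n)) \<and>
    (\<forall>n. \<forall>x \<in> carrier (obj X n). diff Y n (f n x) = f (n + 1) (diff X n x))"

definition id_map :: "('a, 'm) cochain_complex \<Rightarrow> int \<Rightarrow> 'm \<Rightarrow> 'm" where
  "id_map X n = (\<lambda>x\<in>carrier (obj X n). x)"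

definition comp_map ::
  "('a, 'm) cochain_complex \<Rightarrow> (int \<Rightarrow> 'm \<Rightarrow> 'm) \<Rightarrow> (int \<Rightarrow> 'm \<Rightarrow> 'm) \<Rightarrow> int \<Rightarrow> 'm \<Rightarrow> 'm" where
  "comp_map X g f n = compose (carrier (obj X n)) (g n) (f n)"

definition cocycles :: "('a, 'm) cochain_complex \<Rightarrow> int \<Rightarrow> 'm set" where
  "cocycles X n = a_kernel (obj X n) (obj X (n + 1)) (diff X n)"

definition coboundaries :: "('a, 'm) cochain_complex \<Rightarrow> int \<Rightarrow> 'm set" where
  "coboundaries X n = diff X (n - 1) ` carrier (obj X (n - 1))"

definition cohomology :: "('a, 'm) cochain_complex \<Rightarrow> int \<Rightarrow> ('a, 'm set) module" where
  "cohomology X n = quot_module ((obj X n)\<lparr>carrier := cocycles X n\<rparr>) (coboundaries X n)"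

text \<open>The map on cohomology induced by \<open>f : X \<rightarrow> Y\<close>.\<close>

definition cohomology_map ::
  "('a, 'm) cochain_complex \<Rightarrow> (int \<Rightarrow> 'm \<Rightarrow> 'm) \<Rightarrow> int \<Rightarrow> 'm set \<Rightarrow> 'm set" where
  "cohomology_map Y f n C = (\<Union>x\<in>C. coboundaries Y n +>\<^bsub>obj Y n\<^esub> f n x)"

definition quasi_iso ::
  "('a, 'b) ring_scheme \<Rightarrow> ('a, 'm) cochain_complex \<Rightarrow> ('a, 'm) cochain_complex \<Rightarrow>
   (int \<Rightarrow> 'm \<Rightarrow> 'm) \<Rightarrow> bool" where
  "quasi_iso R X Y s \<longleftrightarrow> cochain_map R X Y s \<and>
    (\<forall>n. bij_betw (cohomology_map Y s n) (carrier (cohomology X n)) (carrier (cohomology Y n)))"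

definition shift :: "('a, 'm) cochain_complex \<Rightarrow> ('a, 'm) cochain_complex" where
  "shift X = \<lparr>obj = (\<lambda>n. obj X (n + 1)),
              diff = (\<lambda>n x. \<ominus>\<^bsub>obj X (n + 1 + 1)\<^esub> diff X (n + 1) x)\<rparr>"

definition relabel_complex ::
  "('m \<Rightarrow> 'n) \<Rightarrow> ('a, 'm) cochain_complex \<Rightarrow> ('a, 'n) cochain_complex" where
  "relabel_complex g X =
    \<lparr>obj = (\<lambda>n. relabel_module g (obj X n)),
     diff = (\<lambda>n x. g (diff X n (inv_into (carrier (obj X n)) g x)))\<rparr>"

text \<open>An injective pairing on the universe, used to bring direct sums back into it.\<close>

definition upair :: "'m::infinite \<times> 'm \<Rightarrow> 'm" where
  "upair = (SOME g. inj g)"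

lemma inj_upair: "inj (upair :: 'm::infinite \<times> 'm \<Rightarrow> 'm)"
proof -
  have "(card_of (UNIV \<times> UNIV :: ('m \<times> 'm) set), card_of (UNIV :: 'm set)) \<in> ordIso"
    by (rule card_of_Times_same_infinite) (rule infinite_UNIV)
  then obtain g :: "'m \<times> 'm \<Rightarrow> 'm" where "bij_betw g (UNIV \<times> UNIV) UNIV"
    unfolding card_of_ordIso[symmetric] by blast
  then have "\<exists>g :: 'm \<times> 'm \<Rightarrow> 'm. inj g"
    by (auto simp: bij_betw_def)
  then show ?thesis
    unfolding upair_def by (rule someI_ex)
qed

definition sum_complex ::
  "('a, 'm::infinite) cochain_complex \<Rightarrow> ('a, 'm) cochain_complex \<Rightarrow> ('a, 'm) cochain_complex" where
  "sum_complex X Y = relabel_complex upair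
    \<lparr>obj = (\<lambda>n. direct_sum (obj X n) (obj Y n)),
     diff = (\<lambda>n (x, y). (diff X n x, diff Y n y))\<rparr>"

text \<open>The mapping cone of \<open>f : X \<rightarrow> Y\<close>, with the structure maps of \<open>X \<rightarrow> Y \<rightarrow> cone f \<rightarrow> \<Sigma>X\<close>.\<close>

definition cone ::
  "('a, 'm::infinite) cochain_complex \<Rightarrow> ('a, 'm) cochain_complex \<Rightarrow> (int \<Rightarrow> 'm \<Rightarrow> 'm) \<Rightarrow>
   ('a, 'm) cochain_complex" where
  "cone X Y f = relabel_complex upair
    \<lparr>obj = (\<lambda>n. direct_sum (obj X (n + 1)) (obj Y n)),
     diff = (\<lambda>n (x, y). (\<ominus>\<^bsub>obj X (n + 1 + 1)\<^esub> diff X (n + 1) x,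
                         f (n + 1) x \<oplus>\<^bsub>obj Y (n + 1)\<^esub> diff Y n y))\<rparr>"

definition cone_in ::
  "('a, 'm::infinite) cochain_complex \<Rightarrow> ('a, 'm) cochain_complex \<Rightarrow> int \<Rightarrow> 'm \<Rightarrow> 'm" where
  "cone_in X Y n = (\<lambda>y\<in>carrier (obj Y n). upair (\<zero>\<^bsub>obj X (n + 1)\<^esub>, y))"

definition cone_out ::
  "('a, 'm::infinite) cochain_complex \<Rightarrow> ('a, 'm) cochain_complex \<Rightarrow> (int \<Rightarrow> 'm \<Rightarrow> 'm) \<Rightarrow>
   int \<Rightarrow> 'm \<Rightarrow> 'm" where
  "cone_out X Y f n = (\<lambda>z\<in>carrier (obj (cone X Y f) n). fst (inv_into UNIV upair z))"


section \<open>The derived category\<close>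

text \<open>
  \<open>D(A)\<close> is the localization of the category of cochain complexes of \<open>A\<close>-modules at the
  quasi-isomorphisms, in its presentation by generators and relations: a morphism is represented
  by a composite of cochain maps \<open>Fwd\<close> and formal inverses \<open>Bwd\<close> of quasi-isomorphisms, and two
  composites represent the same morphism iff they are related by \<open>deq\<close>. So the hom-set from
  \<open>X\<close> to \<open>Y\<close> is the quotient of \<open>{t. dmor A X Y t}\<close> by the equivalence relation \<open>deq A X Y\<close>.
  The endpoints are part of the generators because a family of functions does not determine them.
\<close>

datatype ('a, 'm) dterm =
    Fwd "('a, 'm) cochain_complex" "('a, 'm) cochain_complex" "int \<Rightarrow> 'm \<Rightarrow> 'm"
  | Bwd "('a, 'm) cochain_complex" "('a, 'm) cochain_complex" "int \<Rightarrow> 'm \<Rightarrow> 'm"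
  | Cmp "('a, 'm) dterm" "('a, 'm) dterm"

inductive dmor ::
  "('a, 'b) ring_scheme \<Rightarrow> ('a, 'm) cochain_complex \<Rightarrow> ('a, 'm) cochain_complex \<Rightarrow>
   ('a, 'm) dterm \<Rightarrow> bool" for R where
  Fwd: "cochain_map R X Y f \<Longrightarrow> dmor R X Y (Fwd X Y f)"
| Bwd: "quasi_iso R X Y s \<Longrightarrow> dmor R Y X (Bwd X Y s)"
| Cmp: "dmor R X Y t \<Longrightarrow> dmor R Y Z u \<Longrightarrow> dmor R X Z (Cmp u t)"

abbreviation did :: "('a, 'm) cochain_complex \<Rightarrow> ('a, 'm) dterm" where
  "did X \<equiv> Fwd X X (id_map X)"

inductive deq ::
  "('a, 'b) ring_scheme \<Rightarrow> ('a, 'm) cochain_complex \<Rightarrow> ('a, 'm) cochain_complex \<Rightarrow>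
   ('a, 'm) dterm \<Rightarrow> ('a, 'm) dterm \<Rightarrow> bool" for R where
  refl: "dmor R X Y t \<Longrightarrow> deq R X Y t t"
| sym: "deq R X Y t u \<Longrightarrow> deq R X Y u t"
| trans: "deq R X Y t u \<Longrightarrow> deq R X Y u v \<Longrightarrow> deq R X Y t v"
| cong: "deq R X Y t t' \<Longrightarrow> deq R Y Z u u' \<Longrightarrow> deq R X Z (Cmp u t) (Cmp u' t')"
| assoc: "dmor R W X t \<Longrightarrow> dmor R X Y u \<Longrightarrow> dmor R Y Z v \<Longrightarrow>
    deq R W Z (Cmp v (Cmp u t)) (Cmp (Cmp v u) t)"
| id_right: "dmor R X Y t \<Longrightarrow> deq R X Y (Cmp t (did X)) t"
| id_left: "dmor R X Y t \<Longrightarrow> deq R X Y (Cmp (did Y) t) t"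
| comp: "cochain_map R X Y f \<Longrightarrow> cochain_map R Y Z g \<Longrightarrow>
    deq R X Z (Cmp (Fwd Y Z g) (Fwd X Y f)) (Fwd X Z (comp_map X g f))"
| inv_left: "quasi_iso R X Y s \<Longrightarrow> deq R X X (Cmp (Bwd X Y s) (Fwd X Y s)) (did X)"
| inv_right: "quasi_iso R X Y s \<Longrightarrow> deq R Y Y (Cmp (Fwd X Y s) (Bwd X Y s)) (did Y)"

definition diso ::
  "('a, 'b) ring_scheme \<Rightarrow> ('a, 'm) cochain_complex \<Rightarrow> ('a, 'm) cochain_complex \<Rightarrow>
   ('a, 'm) dterm \<Rightarrow> bool" where
  "diso R X Y t \<longleftrightarrow> dmor R X Y t \<and>
    (\<exists>u. dmor R Y X u \<and> deq R X X (Cmp u t) (did X) \<and> deq R Y Y (Cmp t u) (did Y))"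

primrec dshift :: "('a, 'm) dterm \<Rightarrow> ('a, 'm) dterm" where
  "dshift (Fwd X Y f) = Fwd (shift X) (shift Y) (\<lambda>n. f (n + 1))"
| "dshift (Bwd X Y s) = Bwd (shift X) (shift Y) (\<lambda>n. s (n + 1))"
| "dshift (Cmp u t) = Cmp (dshift u) (dshift t)"

text \<open>The exact triangles are the triangles isomorphic in \<open>D(A)\<close> to a mapping cone triangle.\<close>

definition exact_triangle ::
  "('a, 'b) ring_scheme \<Rightarrow>
   ('a, 'm::infinite) cochain_complex \<Rightarrow> ('a, 'm) cochain_complex \<Rightarrow> ('a, 'm) cochain_complex \<Rightarrow>
   ('a, 'm) dterm \<Rightarrow> ('a, 'm) dterm \<Rightarrow> ('a, 'm) dterm \<Rightarrow> bool" where
  "exact_triangle R X Y Z u v w \<longleftrightarrow>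
    dmor R X Y u \<and> dmor R Y Z v \<and> dmor R Z (shift X) w \<and>
    (\<exists>X' Y' f a b c. cochain_map R X' Y' f \<and>
      diso R X X' a \<and> diso R Y Y' b \<and> diso R Z (cone X' Y' f) c \<and>
      deq R X Y' (Cmp b u) (Cmp (Fwd X' Y' f) a) \<and>
      deq R Y (cone X' Y' f) (Cmp c v) (Cmp (Fwd Y' (cone X' Y' f) (cone_in X' Y')) b) \<and>
      deq R Z (shift X') (Cmp (dshift a) w)
        (Cmp (Fwd (cone X' Y' f) (shift X') (cone_out X' Y' f)) c))"

text \<open>A full subcategory of \<open>D(A)\<close> is given by its set of objects.\<close>

definition thick_subcategory ::
  "('a, 'b) ring_scheme \<Rightarrow> ('a, 'm::infinite) cochain_complex set \<Rightarrow> bool" where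
  "thick_subcategory A \<T> \<longleftrightarrow> \<T> \<subseteq> {X. is_complex A X} \<and>
    (\<forall>X W Z t. is_complex A X \<and> is_complex A W \<and> Z \<in> \<T> \<and> diso A Z (sum_complex X W) t
      \<longrightarrow> X \<in> \<T>) \<and>
    (\<forall>X Y Z u v w. exact_triangle A X Y Z u v w \<longrightarrow>
      (X \<in> \<T> \<and> Y \<in> \<T> \<longrightarrow> Z \<in> \<T>) \<and>
      (X \<in> \<T> \<and> Z \<in> \<T> \<longrightarrow> Y \<in> \<T>) \<and>
      (Y \<in> \<T> \<and> Z \<in> \<T> \<longrightarrow> X \<in> \<T>))"

definition D0cof :: "('a, 'b) ring_scheme \<Rightarrow> 'a set \<Rightarrow> ('a, 'm) cochain_complex set" where
  "D0cof A \<aa> = {X. is_complex A X \<and> (\<forall>i. cohomology X i \<in> M0cof A \<aa>)}"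

end

theory Submission
  imports Defs
begin

text \<open>
  If \<open>f : M \<rightarrow> N\<close> is a map of cofinite modules, regarded as a map of complexes concentrated in degree 0,
  the cohomology of its cone is \<open>ker f\<close> in degree -1 and \<open>coker f\<close> in degree 0; so thickness gives
  closure under kernels and cokernels.

  Conversely, cofinite modules are always closed under extensions, because \<open>Ext(A/a, -)\<close> is exact in
  the middle and \<open>A\<close> is noetherian. Together with closure under kernels and cokernels this gives a
  five lemma: in an exact sequence \<open>M1 \<rightarrow> M2 \<rightarrow> M3 \<rightarrow> M4 \<rightarrow> M5\<close> with the other four terms cofinite,
  \<open>M3\<close> is cofinite, being an extension of \<open>ker (M4 \<rightarrow> M5)\<close> by \<open>coker (M1 \<rightarrow> M2)\<close>. Apply it to the long
  exact cohomology sequence of a cone. The cohomology of a direct summand \<open>X\<close> of \<open>X \<oplus> W\<close> is the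
  kernel of the endomorphism induced by the projection onto \<open>W\<close>.
\<close>

section \<open>Submodules and quotients\<close>

text \<open>The obstacle is the universe. Closure under kernels and cokernels is assumed only for
  modules with elements in \<open>'m\<close>, whereas cohomology modules have elements in
  \<open>'m set\<close>. Membership in \<open>M0cof\<close> makes sense at every element type,
  because one chosen resolution of A/a computes all the Ext modules, and it passes along
  isomorphisms between types. Representatives of cosets give each cohomology module a copy over
  \<open>'m\<close>, where the hypothesis applies. The chosen resolution is a \<open>SOME\<close>
  term, so a free resolution in exactly its type has to be exhibited. Since A/a is finitely
  generated and A is noetherian, modules of functions on finite index sets suffice. Their freeness
  makes Ext exact in the middle: coboundaries lift along a surjection of coefficients. In the
  sequence of a cone the connecting map is induced by the given map f, so exactness is a computation
  with pairs and no snake argument occurs. Morphisms of D(A) are formal terms; cohomology is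
  evaluated on terms and the generating relations are checked, so that isomorphic objects get
  isomorphic cohomology.\<close>

lemma a_kernel_iff: "x \<in> a_kernel M N f \<longleftrightarrow> x \<in> carrier M \<and> f x = \<zero>\<^bsub>N\<^esub>"
  by (simp add: a_kernel_def')

lemma module_homI:
  assumes "\<And>x. x \<in> carrier M \<Longrightarrow> f x \<in> carrier N"
    and "\<And>x y. x \<in> carrier M \<Longrightarrow> y \<in> carrier M \<Longrightarrow> f (x \<oplus>\<^bsub>M\<^esub> y) = f x \<oplus>\<^bsub>N\<^esub> f y"
    and "\<And>r x. r \<in> carrier R \<Longrightarrow> x \<in> carrier M \<Longrightarrow> f (r \<odot>\<^bsub>M\<^esub> x) = r \<odot>\<^bsub>N\<^esub> f x"
  shows "f \<in> module_hom R M N"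
  using assms by (auto simp: module_hom_def)

lemma mod_homI: "module R M \<Longrightarrow> module R N \<Longrightarrow> f \<in> module_hom R M N \<Longrightarrow> mod_hom R M N f"
  by (simp add: mod_hom_def mod_hom_axioms_def)

lemma module_hom_comp:
  "f \<in> module_hom R M N \<Longrightarrow> g \<in> module_hom R N P \<Longrightarrow> (\<lambda>x. g (f x)) \<in> module_hom R M P"
  by (auto simp: module_hom_def Pi_iff)

lemma module_hom_cong:
  assumes "module R M" "f \<in> module_hom R M N" "\<And>x. x \<in> carrier M \<Longrightarrow> g x = f x"
  shows "g \<in> module_hom R M N"
proof -
  interpret M: module R M by fact
  show ?thesis using assms(2,3) by (auto simp: module_hom_def Pi_iff)
qed

text \<open>A submodule is only required to be closed under addition and scalars; negatives are
  multiples by the scalar -1.\<close>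

lemma submodule_neg_closed:
  assumes "submodule R B M" "x \<in> B" shows "\<ominus>\<^bsub>M\<^esub> x \<in> B"
proof -
  interpret submodule R B M by fact
  interpret module R M by (rule module)
  have "\<ominus>\<^bsub>R\<^esub> \<one>\<^bsub>R\<^esub> \<odot>\<^bsub>M\<^esub> x \<in> B"
    using assms by (intro submodule.smult_closed) auto
  moreover have "\<ominus>\<^bsub>R\<^esub> \<one>\<^bsub>R\<^esub> \<odot>\<^bsub>M\<^esub> x = \<ominus>\<^bsub>M\<^esub> x"
    using assms(2) subset by (intro smult_minus_1) auto
  ultimately show ?thesis by simp
qed

lemma submodule_minus_closed:
  assumes "submodule R B M" "x \<in> B" "y \<in> B" shows "x \<ominus>\<^bsub>M\<^esub> y \<in> B"
  using assms submodule_neg_closed[OF assms(1,3)] submodule.m_closed[OF assms(1)]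
  by (simp add: a_minus_def)

lemma submodule_abelian_subgroup:
  assumes "submodule R B M" shows "abelian_subgroup B M"
proof -
  interpret submodule R B M by fact
  interpret module R M by (rule module)
  show ?thesis
    by (rule abelian_subgroupI3)
       (use assms subset submodule_neg_closed[OF assms] zero_closed in
        \<open>auto intro!: additive_subgroup.intro add.subgroupI is_abelian_group
            simp: abelian_group_axioms a_inv_def dest: submodule.zero_closed\<close>)
qed

text \<open>The module axioms are equations and existence statements, so they pass to the image of
  operation-preserving maps. Here \<open>Q\<close> is just a record, hence the separate condition on
  its zero. This is how quotients and relabelled modules are seen to be modules.\<close>

lemma module_of_surj:
  assumes "module R M" and f: "f \<in> module_hom R M Q" and surj: "f ` carrier M = carrier Q"
    and zero: "f \<zero>\<^bsub>M\<^esub> = \<zero>\<^bsub>Q\<^esub>"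
  shows "module R Q"
proof -
  interpret M: module R M by fact
  note [simp] = module_hom_add[OF f, symmetric] module_hom_smult[OF f, symmetric] zero[symmetric]
  show ?thesis
  proof (rule module_criteria)
    show "cring R" by (rule M.R.is_cring)
    show "\<forall>v\<in>carrier Q. \<exists>n\<in>carrier Q. v \<oplus>\<^bsub>Q\<^esub> n = \<zero>\<^bsub>Q\<^esub>"
      unfolding surj[symmetric] by (auto intro!: bexI[of _ "\<ominus>\<^bsub>M\<^esub> _"] simp: M.M.r_neg)
  qed (auto simp: surj[symmetric] M.M.a_ac M.smult_assoc1 M.smult_l_distr M.smult_r_distr)
qed

lemma zero_submodule: "module R M \<Longrightarrow> submodule R {\<zero>\<^bsub>M\<^esub>} M"
  by (rule submodule.intro)
     (auto simp: module.rmult_0 module_def intro: abelian_monoid.zero_closed abelian_monoid.l_zero abelian_group.axioms)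

lemma ker_submodule: "mod_hom R M N f \<Longrightarrow> submodule R (a_kernel M N f) M"
  using mod_hom.ker_is_submodule[of R M N f] by (simp add: mod_hom.ker_def a_kernel_def')

lemma im_submodule: "mod_hom R M N f \<Longrightarrow> submodule R (f ` carrier M) N"
  using mod_hom.im_is_submodule[of R M N f] by (simp add: mod_hom.im_def)

lemma md_module: "submodule R Z M \<Longrightarrow> module R (M\<lparr>carrier := Z\<rparr>)"
  using module.submodule_is_module submodule.module by blast

text \<open>Additive inverses are defined by a description over the carrier, so shrinking the
  carrier might change them. Both inverses are the multiple by -1, and scalar multiplication does
  not see the carrier.\<close>

lemma md_minus:
  assumes "submodule R Z M" "x \<in> Z" "y \<in> Z"
  shows "x \<ominus>\<^bsub>M\<lparr>carrier := Z\<rparr>\<^esub> y = x \<ominus>\<^bsub>M\<^esub> y"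
proof -
  interpret submodule R Z M by fact
  interpret M: module R M by (rule module)
  interpret Z: module R "M\<lparr>carrier := Z\<rparr>" by (rule md_module) fact
  have "\<ominus>\<^bsub>M\<lparr>carrier := Z\<rparr>\<^esub> y = \<ominus>\<^bsub>M\<^esub> y"
    using Z.smult_minus_1[of y] M.smult_minus_1[of y] assms(3) subset by auto
  then show ?thesis by (simp add: a_minus_def)
qed

lemma submodule_md:
  assumes "submodule R Z M" "submodule R B M" "B \<subseteq> Z"
  shows "submodule R B (M\<lparr>carrier := Z\<rparr>)"
  using assms md_module[OF assms(1)] by (auto simp: submodule_def)

lemma submodule_of_md:
  assumes "submodule R Z M" "submodule R B (M\<lparr>carrier := Z\<rparr>)"
  shows "submodule R B M"
  using assms by (auto simp: submodule_def)

lemma coset_eq_iff: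
  assumes "submodule R B M" "x \<in> carrier M" "y \<in> carrier M"
  shows "B +>\<^bsub>M\<^esub> x = B +>\<^bsub>M\<^esub> y \<longleftrightarrow> x \<ominus>\<^bsub>M\<^esub> y \<in> B"
proof -
  interpret abelian_subgroup B M by (rule submodule_abelian_subgroup) fact
  show ?thesis
    using assms a_rcos_module[of y x] a_repr_independence' a_repr_independenceD
    unfolding a_minus_def by metis
qed

lemma carrier_quot_module: "carrier (quot_module M B) = (\<lambda>x. B +>\<^bsub>M\<^esub> x) ` carrier M"
  by (auto simp: quot_module_def A_RCOSETS_def')

text \<open>Operations and maps on cosets are encoded as unions over all representatives. Such a
  union collapses to one value as soon as the value does not depend on the representative.\<close>

lemma coset_union_const:
  assumes B: "submodule R B M" and x: "x \<in> carrier M"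
    and c: "\<And>y. y \<in> carrier M \<Longrightarrow> y \<ominus>\<^bsub>M\<^esub> x \<in> B \<Longrightarrow> F y = F x"
  shows "(\<Union>y\<in>B +>\<^bsub>M\<^esub> x. F y) = F x"
proof -
  interpret abelian_subgroup B M by (rule submodule_abelian_subgroup) fact
  have "F y = F x" if "y \<in> B +>\<^bsub>M\<^esub> x" for y
  proof -
    have "y \<in> carrier M" using that x a_elemrcos_carrier by blast
    with that c x a_rcos_module[of x y] show ?thesis by (simp add: a_minus_def)
  qed
  moreover have "x \<in> B +>\<^bsub>M\<^esub> x" using x by (rule a_rcos_self)
  ultimately show ?thesis by blast
qed

lemma smult_minus:
  assumes "module R M" "r \<in> carrier R" "x \<in> carrier M" "y \<in> carrier M"
  shows "r \<odot>\<^bsub>M\<^esub> (x \<ominus>\<^bsub>M\<^esub> y) = r \<odot>\<^bsub>M\<^esub> x \<ominus>\<^bsub>M\<^esub> r \<odot>\<^bsub>M\<^esub> y"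
proof -
  interpret module R M by fact
  show ?thesis using assms by (simp add: a_minus_def smult_r_distr smult_r_minus)
qed

lemma quot_proj_hom:
  assumes B: "submodule R B M"
  shows "(\<lambda>x. B +>\<^bsub>M\<^esub> x) \<in> module_hom R M (quot_module M B)"
proof -
  interpret abelian_subgroup B M by (rule submodule_abelian_subgroup) fact
  interpret M: module R M by (rule submodule.module) fact
  show ?thesis
  proof (rule module_homI)
    fix r x assume rx: "r \<in> carrier R" "x \<in> carrier M"
    have "(\<Union>y\<in>B +>\<^bsub>M\<^esub> x. B +>\<^bsub>M\<^esub> (r \<odot>\<^bsub>M\<^esub> y)) = B +>\<^bsub>M\<^esub> (r \<odot>\<^bsub>M\<^esub> x)"
      using rx B by (intro coset_union_const[OF B])
        (auto simp: coset_eq_iff[OF B] smult_minus[symmetric, OF M.module_axioms] intro: submodule.smult_closed)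
    then show "B +>\<^bsub>M\<^esub> r \<odot>\<^bsub>M\<^esub> x = r \<odot>\<^bsub>quot_module M B\<^esub> (B +>\<^bsub>M\<^esub> x)"
      by (simp add: quot_module_def)
  next
    fix x y assume "x \<in> carrier M" "y \<in> carrier M"
    then show "B +>\<^bsub>M\<^esub> (x \<oplus>\<^bsub>M\<^esub> y) = (B +>\<^bsub>M\<^esub> x) \<oplus>\<^bsub>quot_module M B\<^esub> (B +>\<^bsub>M\<^esub> y)"
      by (simp add: quot_module_def a_rcos_sum)
  qed (auto simp: carrier_quot_module)
qed

lemma coset_zero: "submodule R B M \<Longrightarrow> b \<in> B \<Longrightarrow> B +>\<^bsub>M\<^esub> b = B"
  by (rule abelian_subgroup.a_rcos_const[OF submodule_abelian_subgroup])

lemma coset_zero_iff: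
  assumes "submodule R B M" "x \<in> carrier M"
  shows "B +>\<^bsub>M\<^esub> x = B \<longleftrightarrow> x \<in> B"
proof -
  interpret abelian_subgroup B M by (rule submodule_abelian_subgroup) fact
  show ?thesis using coset_zero[OF assms(1)] a_rcos_self[OF assms(2)] by metis
qed

lemma quot_module_module:
  assumes "submodule R B M" shows "module R (quot_module M B)"
proof (rule module_of_surj[OF submodule.module[OF assms] quot_proj_hom[OF assms]])
  show "B +>\<^bsub>M\<^esub> \<zero>\<^bsub>M\<^esub> = \<zero>\<^bsub>quot_module M B\<^esub>"
    using coset_zero[OF assms submodule.zero_closed[OF assms]] by (simp add: quot_module_def)
qed (simp add: carrier_quot_module)

text \<open>The union over representatives repeats the shape of \<open>cohomology_map\<close>, which
  thereby becomes an instance.\<close>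

definition quot_map :: "('a, 'n) module \<Rightarrow> 'n set \<Rightarrow> ('m \<Rightarrow> 'n) \<Rightarrow> 'm set \<Rightarrow> 'n set" where
  "quot_map N C f X = (\<Union>x\<in>X. C +>\<^bsub>N\<^esub> f x)"

lemma quot_map_coset:
  assumes B: "submodule R B M" and C: "submodule R C N" and f: "f \<in> module_hom R M N"
    and fB: "f ` B \<subseteq> C" and x: "x \<in> carrier M"
  shows "quot_map N C f (B +>\<^bsub>M\<^esub> x) = C +>\<^bsub>N\<^esub> f x"
proof -
  interpret f: mod_hom R M N f using B C f by (intro mod_homI) (auto dest: submodule.module)
  show ?thesis unfolding quot_map_def
    by (rule coset_union_const[OF B x]) (use fB x in \<open>auto simp: coset_eq_iff[OF C] simp flip: f.f_minus\<close>)
qed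

lemma quot_map_hom:
  assumes B: "submodule R B M" and C: "submodule R C N" and f: "f \<in> module_hom R M N"
    and fB: "f ` B \<subseteq> C"
  shows "quot_map N C f \<in> module_hom R (quot_module M B) (quot_module N C)"
proof -
  interpret f: mod_hom R M N f using B C f by (intro mod_homI) (auto dest: submodule.module)
  note q = quot_map_coset[OF assms]
  note pM = quot_proj_hom[OF B] and pN = quot_proj_hom[OF C]
  show ?thesis
    by (rule module_homI)
       (auto simp: carrier_quot_module q module_hom_add[OF pM, symmetric] module_hom_smult[OF pM, symmetric]
         module_hom_add[OF pN, symmetric] module_hom_smult[OF pN, symmetric])
qed

lemma quot_map_exact:
  assumes B1: "submodule R B1 M1" and B2: "submodule R B2 M2" and B3: "submodule R B3 M3"
    and f: "f \<in> module_hom R M1 M2" and fB: "f ` B1 \<subseteq> B2"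
    and g: "g \<in> module_hom R M2 M3" and gB: "g ` B2 \<subseteq> B3"
    and 0: "\<And>x. x \<in> carrier M1 \<Longrightarrow> g (f x) \<in> B3"
    and ex: "\<And>y. y \<in> carrier M2 \<Longrightarrow> g y \<in> B3 \<Longrightarrow> \<exists>x\<in>carrier M1. y \<ominus>\<^bsub>M2\<^esub> f x \<in> B2"
  shows "a_kernel (quot_module M2 B2) (quot_module M3 B3) (quot_map M3 B3 g) =
         quot_map M2 B2 f ` carrier (quot_module M1 B1)"
proof -
  interpret f: mod_hom R M1 M2 f using B1 B2 f by (intro mod_homI) (auto dest: submodule.module)
  interpret g: mod_hom R M2 M3 g using B3 B2 g by (intro mod_homI) (auto dest: submodule.module)
  note qf = quot_map_coset[OF B1 B2 f fB] and qg = quot_map_coset[OF B2 B3 g gB]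
  have z: "\<zero>\<^bsub>quot_module M3 B3\<^esub> = B3" by (simp add: quot_module_def)
  show ?thesis
    apply (auto simp: a_kernel_iff carrier_quot_module z qf qg coset_zero_iff[OF B3] 0)
    subgoal for y using ex[of y] by (auto simp: coset_eq_iff[OF B2] qf image_iff)
    done
qed

section \<open>Finitely generated modules\<close>

lemma vimage_submodule:
  assumes "mod_hom R M N f" "submodule R K N"
  shows "submodule R {x \<in> carrier M. f x \<in> K} M"
proof -
  interpret mod_hom R M N f by fact
  show ?thesis
    by (rule submodule.intro)
       (auto simp: M.module_axioms submodule.zero_closed[OF assms(2)]
         intro: submodule.m_closed[OF assms(2)] submodule.smult_closed[OF assms(2)])
qed

lemma mod_hom_md:
  assumes "mod_hom R M N f" "submodule R Z M" "submodule R K N" "f ` Z \<subseteq> K"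
  shows "mod_hom R (M\<lparr>carrier := Z\<rparr>) (N\<lparr>carrier := K\<rparr>) f"
proof -
  interpret mod_hom R M N f by fact
  show ?thesis
    using assms(4) submodule.subset[OF assms(2)]
    by (intro mod_homI md_module assms module_homI) (auto simp: subset_iff)
qed

lemma mod_hom_md_dom:
  assumes "mod_hom R M N f" "submodule R Z M"
  shows "mod_hom R (M\<lparr>carrier := Z\<rparr>) N f"
proof -
  interpret mod_hom R M N f by fact
  show ?thesis
    using submodule.subset[OF assms(2)]
    by (intro mod_homI md_module assms module_homI N.module_axioms) (auto simp: subset_iff)
qed

lemma mod_hom_md_cod:
  assumes "mod_hom R M N f" "submodule R K N" "f ` carrier M \<subseteq> K"
  shows "mod_hom R M (N\<lparr>carrier := K\<rparr>) f"
proof -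
  interpret mod_hom R M N f by fact
  show ?thesis
    using assms(3) by (intro mod_homI md_module assms module_homI M.module_axioms) auto
qed

lemma im_submodule':
  assumes "mod_hom R M N f" "submodule R Z M"
  shows "submodule R (f ` Z) N"
  using im_submodule[OF mod_hom_md_dom[OF assms]] by simp

text \<open>Generation is restated through submodules containing \<open>S\<close>, which spares all
  later arguments the handling of linear combinations.\<close>

lemma finitely_generated_iff:
  assumes "module R M"
  shows "finitely_generated R M \<longleftrightarrow>
    (\<exists>S. finite S \<and> S \<subseteq> carrier M \<and> (\<forall>N. submodule R N M \<and> S \<subseteq> N \<longrightarrow> carrier M \<subseteq> N))"
proof -
  interpret module R M by fact
  have "span S = carrier M \<longleftrightarrow> (\<forall>N. submodule R N M \<and> S \<subseteq> N \<longrightarrow> carrier M \<subseteq> N)"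
    if "S \<subseteq> carrier M" for S
    using in_own_span[OF that] span_is_subset2[OF that] span_is_submodule[OF that] span_is_subset[of S]
    by (metis order_antisym)
  then show ?thesis by (simp add: finitely_generated_def cong: conj_cong)
qed

lemma finitely_generatedE:
  assumes "module R M" "finitely_generated R M"
  obtains S where "finite S" "S \<subseteq> carrier M"
    "\<And>K. submodule R K M \<Longrightarrow> S \<subseteq> K \<Longrightarrow> carrier M \<subseteq> K"
proof -
  obtain S where "finite S \<and> S \<subseteq> carrier M \<and> (\<forall>N. submodule R N M \<and> S \<subseteq> N \<longrightarrow> carrier M \<subseteq> N)"
    using assms(2) finitely_generated_iff[OF assms(1)] by (elim iffD1[THEN exE])
  then show ?thesis by (intro that[of S]) simp_all
qed

lemma finitely_generatedI:
  assumes "module R M" "finite S" "S \<subseteq> carrier M"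
    "\<And>K. submodule R K M \<Longrightarrow> S \<subseteq> K \<Longrightarrow> carrier M \<subseteq> K"
  shows "finitely_generated R M"
  unfolding finitely_generated_iff[OF assms(1)] using assms(2-) by (intro exI[of _ S]) simp

lemma finitely_generated_image:
  assumes "mod_hom R M N f" "f ` carrier M = carrier N" "finitely_generated R M"
  shows "finitely_generated R N"
proof -
  interpret mod_hom R M N f by fact
  obtain S where S: "finite S" "S \<subseteq> carrier M"
    "\<And>K. submodule R K M \<Longrightarrow> S \<subseteq> K \<Longrightarrow> carrier M \<subseteq> K"
    by (rule finitely_generatedE[OF M.module_axioms assms(3)]) (rule that)
  have "carrier N \<subseteq> K" if "submodule R K N" "f ` S \<subseteq> K" for K
  proof -
    have "S \<subseteq> {x \<in> carrier M. f x \<in> K}" using that(2) S(2) by auto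
    from S(3)[OF vimage_submodule[OF assms(1) that(1)] this] show ?thesis
      unfolding assms(2)[symmetric] by auto
  qed
  with S(1,2) show ?thesis
    by (intro finitely_generatedI[OF N.module_axioms, of "f ` S"]) auto
qed

text \<open>Generators of \<open>N\<close> are the images of generators of \<open>M\<close> together
  with lifts of generators of the image of \<open>g\<close>. Only that image, not all of
  \<open>P\<close>, has to be finitely generated.\<close>

lemma finitely_generated_extension:
  assumes f: "mod_hom R M N f" and g: "mod_hom R N P g"
    and ker: "a_kernel N P g \<subseteq> f ` carrier M"
    and M: "finitely_generated R M" and P: "finitely_generated R (P\<lparr>carrier := g ` carrier N\<rparr>)"
  shows "finitely_generated R N"
proof -
  interpret f: mod_hom R M N f by fact
  interpret g: mod_hom R N P g by fact
  have gN: "submodule R (g ` carrier N) P" by (rule im_submodule[OF g])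
  obtain S where S: "finite S" "S \<subseteq> carrier M"
    "\<And>K. submodule R K M \<Longrightarrow> S \<subseteq> K \<Longrightarrow> carrier M \<subseteq> K"
    by (rule finitely_generatedE[OF f.M.module_axioms M]) (rule that)
  obtain T' where T': "finite T'" "T' \<subseteq> g ` carrier N"
    "\<And>K. submodule R K (P\<lparr>carrier := g ` carrier N\<rparr>) \<Longrightarrow> T' \<subseteq> K \<Longrightarrow> g ` carrier N \<subseteq> K"
    by (rule finitely_generatedE[OF md_module[OF gN] P, simplified]) (rule that)
  obtain T where T: "T \<subseteq> carrier N" "finite T" "T' = g ` T"
    using finite_subset_image[OF T'(1,2)] by blast
  have "carrier N \<subseteq> K" if K: "submodule R K N" "f ` S \<union> T \<subseteq> K" for K
  proof
    fix x assume x: "x \<in> carrier N"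
    have "S \<subseteq> {x \<in> carrier M. f x \<in> K}" using K(2) S(2) by auto
    from S(3)[OF vimage_submodule[OF f K(1)] this] have fM: "f ` carrier M \<subseteq> K" by auto
    have "submodule R (g ` K) (P\<lparr>carrier := g ` carrier N\<rparr>)"
      using submodule.subset[OF K(1)] by (intro submodule_md gN im_submodule'[OF g] K image_mono)
    moreover have "T' \<subseteq> g ` K" using K(2) unfolding T(3) by (intro image_mono) simp
    ultimately have "g ` carrier N \<subseteq> g ` K" by (rule T'(3))
    with x have "g x \<in> g ` K" by blast
    then obtain y where y: "y \<in> K" "g x = g y" by blast
    have yN: "y \<in> carrier N" using y(1) submodule.subset[OF K(1)] by blast
    \<comment> \<open>A submodule \<open>K\<close> containing the generators has the same image
      under \<open>g\<close> as \<open>N\<close>. So \<open>x\<close> agrees with some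
      \<open>y\<close> in \<open>K\<close> up to the kernel of \<open>g\<close>, which lies in the
      image of \<open>f\<close> and hence in \<open>K\<close>.\<close>
    have "x \<ominus>\<^bsub>N\<^esub> y \<in> a_kernel N P g"
      using x yN y(2) by (simp add: a_kernel_iff g.N.M.r_neg a_minus_def)
    with ker fM have "x \<ominus>\<^bsub>N\<^esub> y \<in> K" by blast
    from submodule.m_closed[OF K(1) this y(1)] show "x \<in> K"
      using x yN by (simp add: a_minus_def f.N.M.a_assoc f.N.M.l_neg)
  qed
  with S(1,2) T(1,2) show ?thesis
    by (intro finitely_generatedI[OF f.N.module_axioms, of "f ` S \<union> T"]) auto
qed

lemma zero_finitely_generated:
  assumes "module R M" "carrier M = {\<zero>\<^bsub>M\<^esub>}"
  shows "finitely_generated R M"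
  by (rule finitely_generatedI[OF assms(1), of "{}"])
     (simp_all add: assms(2) submodule.zero_closed)

section \<open>Finitely generated modules over a noetherian ring\<close>

lemma regular_module_module: "cring R \<Longrightarrow> module R (regular_module R)"
proof -
  assume "cring R"
  then interpret cring R .
  have "\<forall>x\<in>carrier R. \<exists>y\<in>carrier R. x \<oplus>\<^bsub>R\<^esub> y = \<zero>\<^bsub>R\<^esub>"
    using r_neg a_inv_closed by blast
  then show ?thesis
    by (intro module_criteria)
       (simp_all add: regular_module_def is_cring a_ac m_assoc l_distr r_distr)
qed

text \<open>This translates the noetherian condition, which speaks of ideals, into a condition on
  submodules.\<close>

lemma regular_submodule_iff:
  assumes "cring R" shows "submodule R I (regular_module R) \<longleftrightarrow> ideal I R"
proof
  interpret cring R by fact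
  note M = regular_module_module[OF assms]
  {
    assume I: "submodule R I (regular_module R)"
    have neg: "\<ominus>\<^bsub>R\<^esub> x \<in> I" if "x \<in> I" for x
      using submodule.smult_closed[OF I, of "\<ominus>\<^bsub>R\<^esub> \<one>\<^bsub>R\<^esub>" x] submodule.subset[OF I] that
      by (auto simp: regular_module_def l_minus)
    show "ideal I R"
      using I neg submodule.zero_closed[OF I] submodule.subset[OF I]
        submodule.m_closed[OF I] submodule.smult_closed[OF I]
    proof (intro idealI ring_axioms add.subgroupI)
      fix a x assume ax: "a \<in> I" "x \<in> carrier R"
      with submodule.smult_closed[OF I, of x a] show "x \<otimes>\<^bsub>R\<^esub> a \<in> I"
        by (simp add: regular_module_def)
      with ax submodule.subset[OF I] show "a \<otimes>\<^bsub>R\<^esub> x \<in> I"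
        by (auto simp: regular_module_def m_comm[of a x] subset_iff)
    qed (auto simp: regular_module_def a_inv_def[symmetric])
  next
    assume "ideal I R"
    then interpret ideal I R .
    show "submodule R I (regular_module R)"
      by (rule submodule.intro[OF M]) (use a_subset zero_closed I_l_closed in \<open>simp_all add: regular_module_def\<close>)
  }
qed

lemma noetherian_regular:
  assumes "cring R" "noetherian_ring R" "submodule R I (regular_module R)"
  shows "finitely_generated R ((regular_module R)\<lparr>carrier := I\<rparr>)"
proof -
  interpret cring R by fact
  have "ideal I R" using assms regular_submodule_iff by blast
  with assms(2) obtain S where S: "S \<subseteq> carrier R" "finite S" "I = Idl\<^bsub>R\<^esub> S"
    using noetherian_ring.finetely_gen by blast
  have "I \<subseteq> N" if "submodule R N ((regular_module R)\<lparr>carrier := I\<rparr>)" "S \<subseteq> N" for N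
    using submodule_of_md[OF assms(3) that(1)] that(2) genideal_minimal S(3)
    by (auto simp: regular_submodule_iff[OF assms(1)])
  moreover have "S \<subseteq> I" using genideal_self S by simp
  ultimately show ?thesis
    using S by (intro finitely_generatedI[OF md_module[OF assms(3)], of S]) auto
qed

lemma func_space_simps:
  assumes "cring R"
  shows "carrier (ring.func_space R S) = S \<rightarrow>\<^sub>E carrier R"
    and "\<zero>\<^bsub>ring.func_space R S\<^esub> = (\<lambda>v\<in>S. \<zero>\<^bsub>R\<^esub>)"
    and "f \<oplus>\<^bsub>ring.func_space R S\<^esub> g = (\<lambda>v\<in>S. f v \<oplus>\<^bsub>R\<^esub> g v)"
    and "r \<odot>\<^bsub>ring.func_space R S\<^esub> f = (\<lambda>v\<in>S. r \<otimes>\<^bsub>R\<^esub> f v)"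
proof -
  interpret cring R by fact
  show "carrier (ring.func_space R S) = S \<rightarrow>\<^sub>E carrier R"
    and "\<zero>\<^bsub>ring.func_space R S\<^esub> = (\<lambda>v\<in>S. \<zero>\<^bsub>R\<^esub>)"
    and "f \<oplus>\<^bsub>ring.func_space R S\<^esub> g = (\<lambda>v\<in>S. f v \<oplus>\<^bsub>R\<^esub> g v)"
    and "r \<odot>\<^bsub>ring.func_space R S\<^esub> f = (\<lambda>v\<in>S. r \<otimes>\<^bsub>R\<^esub> f v)"
    by (simp_all add: func_space_def)
qed

lemma eval_mod_hom:
  assumes "cring R" "i \<in> I"
  shows "mod_hom R (ring.func_space R I) (regular_module R) (\<lambda>f. f i)"
  using assms
  by (intro mod_homI cring.func_space_is_module regular_module_module module_homI)
     (auto simp: func_space_simps regular_module_def)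

text \<open>Induction on the set \<open>J\<close> of coordinates that may be nonzero: evaluation at
  a new coordinate \<open>j\<close> maps \<open>N\<close> onto an ideal, and its kernel is supported
  on the smaller set. The ambient index set \<open>I\<close> stays fixed, so that all these
  submodules lie in one module.\<close>

lemma noetherian_func_space_aux:
  assumes R: "cring R" "noetherian_ring R" and I: "finite J" "J \<subseteq> I"
  shows "submodule R N (ring.func_space R I) \<Longrightarrow> (\<And>f i. f \<in> N \<Longrightarrow> i \<in> I - J \<Longrightarrow> f i = \<zero>\<^bsub>R\<^esub>) \<Longrightarrow>
    finitely_generated R ((ring.func_space R I)\<lparr>carrier := N\<rparr>)"
  using I
proof (induction arbitrary: N rule: finite_induct)
  case empty
  have "f = \<zero>\<^bsub>ring.func_space R I\<^esub>" if "f \<in> N" for f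
    using that empty submodule.subset[OF empty(1)]
    by (auto simp: func_space_simps[OF R(1)] PiE_iff intro!: extensionalityI[of f I])
  then have "N = {\<zero>\<^bsub>ring.func_space R I\<^esub>}" using submodule.zero_closed[OF empty(1)] by blast
  then show ?case by (intro zero_finitely_generated md_module empty) simp
next
  case (insert j J)
  let ?F = "ring.func_space R I" and ?g = "\<lambda>f. f j"
  have ev: "mod_hom R (?F\<lparr>carrier := N\<rparr>) (regular_module R) ?g"
    using insert by (intro mod_hom_md_dom eval_mod_hom R) auto
  define K where "K = a_kernel (?F\<lparr>carrier := N\<rparr>) (regular_module R) ?g"
  have K: "submodule R K ?F"
    unfolding K_def by (rule submodule_of_md[OF insert.prems(1) ker_submodule[OF ev]])
  have KN: "K \<subseteq> N" by (auto simp: K_def a_kernel_iff)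
  have "finitely_generated R (?F\<lparr>carrier := K\<rparr>)"
    using K insert by (intro insert.IH) (auto simp: K_def a_kernel_iff regular_module_def)
  moreover have "mod_hom R (?F\<lparr>carrier := K\<rparr>) (?F\<lparr>carrier := N\<rparr>) (\<lambda>x. x)"
    by (intro mod_homI md_module K insert.prems module_homI) (use KN in auto)
  moreover have "finitely_generated R ((regular_module R)\<lparr>carrier := ?g ` N\<rparr>)"
    using im_submodule[OF ev] by (intro noetherian_regular R) simp
  ultimately show ?case
    by (intro finitely_generated_extension[OF _ ev]) (auto simp: K_def)
qed

lemma noetherian_func_space:
  assumes "cring R" "noetherian_ring R" "finite I" "submodule R N (ring.func_space R I)"
  shows "finitely_generated R ((ring.func_space R I)\<lparr>carrier := N\<rparr>)"
  using noetherian_func_space_aux[of R I I N] assms by simp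

text \<open>The generating set itself serves as index set, and the map sends a family of
  coefficients to its linear combination.\<close>

lemma finitely_generated_surj:
  assumes M: "module R M" "finitely_generated R M"
  shows "\<exists>S f. finite S \<and> S \<subseteq> carrier M \<and> mod_hom R (ring.func_space R S) M f \<and>
    f ` carrier (ring.func_space R S) = carrier M"
proof -
  interpret module R M by fact
  obtain S where S: "finite S" "S \<subseteq> carrier M" "span S = carrier M"
    using M(2) by (auto simp: finitely_generated_def)
  \<comment> \<open>Elements of the function space are extensional, so coefficients are cut down to
    \<open>S\<close>; this does not change the linear combination.\<close>
  have "lincomb a S \<in> (\<lambda>a. lincomb a S) ` (S \<rightarrow>\<^sub>E carrier R)" if "a \<in> S \<rightarrow> carrier R" for a
    using that S by (intro image_eqI[of _ _ "restrict a S"] lincomb_cong) auto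
  with lincomb_is_mod_hom[OF S(1,2)] finite_span[OF S(1,2)] S show ?thesis
    by (intro exI[of _ S] exI[of _ "\<lambda>a. lincomb a S"])
       (auto simp: func_space_simps[OF R.is_cring] image_iff)
qed

text \<open>The preimage of \<open>N\<close> in a finite free cover of \<open>M\<close> is finitely
  generated, and it maps onto \<open>N\<close>.\<close>

lemma finitely_generated_submodule:
  assumes R: "noetherian_ring R" and M: "module R M" "finitely_generated R M" and N: "submodule R N M"
  shows "finitely_generated R (M\<lparr>carrier := N\<rparr>)"
proof -
  have cr: "cring R" using M(1) by (simp add: module_def)
  obtain S f where S: "finite S" "S \<subseteq> carrier M" and f: "mod_hom R (ring.func_space R S) M f"
    and surj: "f ` carrier (ring.func_space R S) = carrier M"
    using finitely_generated_surj[OF M] by blast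
  define K where "K = {x \<in> carrier (ring.func_space R S). f x \<in> N}"
  have K: "submodule R K (ring.func_space R S)" unfolding K_def by (rule vimage_submodule[OF f N])
  have "N \<subseteq> f ` carrier (ring.func_space R S)" using submodule.subset[OF N] surj by simp
  then have "f ` K = N" unfolding K_def by blast
  then show ?thesis
    by (intro finitely_generated_image[OF mod_hom_md[OF f K N]] noetherian_func_space K cr R S(1)) auto
qed

text \<open>The noetherian hypothesis makes the image of \<open>g\<close> finitely generated as a
  submodule of \<open>P\<close>.\<close>

lemma finitely_generated_exact:
  assumes "noetherian_ring R" "mod_hom R M N f" "mod_hom R N P g"
    and "a_kernel N P g \<subseteq> f ` carrier M"
    and "finitely_generated R M" "finitely_generated R P"
  shows "finitely_generated R N"
  using assms
  by (intro finitely_generated_extension[of R M N f P g] finitely_generated_submodule im_submodule)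
     (auto simp: mod_hom_def)

section \<open>Free resolutions\<close>

text \<open>A function is built up from the unit vectors by induction on the set \<open>J\<close> to
  which it is cut off.\<close>

lemma func_space_span:
  assumes R: "cring R" and I: "finite I" and N: "submodule R N (ring.func_space R I)"
    and \<delta>: "\<And>i. i \<in> I \<Longrightarrow> (\<lambda>j\<in>I. if j = i then \<one>\<^bsub>R\<^esub> else \<zero>\<^bsub>R\<^esub>) \<in> N"
  shows "carrier (ring.func_space R I) \<subseteq> N"
proof
  interpret cring R by fact
  fix f assume "f \<in> carrier (ring.func_space R I)"
  then have f: "f \<in> I \<rightarrow>\<^sub>E carrier R" by (simp add: func_space_simps[OF R])
  have "(\<lambda>j\<in>I. if j \<in> J then f j else \<zero>\<^bsub>R\<^esub>) \<in> N" if "finite J" "J \<subseteq> I" for J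
    using that
  proof (induction rule: finite_induct)
    case empty
    then show ?case using submodule.zero_closed[OF N] by (simp add: func_space_simps[OF R] restrict_def)
  next
    case (insert i J)
    let ?\<delta> = "\<lambda>j\<in>I. if j = i then \<one>\<^bsub>R\<^esub> else \<zero>\<^bsub>R\<^esub>" and ?F = "ring.func_space R I"
    let ?g = "\<lambda>J. \<lambda>j\<in>I. if j \<in> J then f j else \<zero>\<^bsub>R\<^esub>"
    have fi: "f i \<in> carrier R" using f insert.prems by auto
    then have "f i \<odot>\<^bsub>?F\<^esub> ?\<delta> \<in> N"
      using insert.prems by (intro submodule.smult_closed[OF N] \<delta>) auto
    moreover have "?g J \<in> N" by (rule insert.IH) (use insert.prems in simp)
    ultimately have N': "?g J \<oplus>\<^bsub>?F\<^esub> f i \<odot>\<^bsub>?F\<^esub> ?\<delta> \<in> N"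
      by (intro submodule.m_closed[OF N])
    have eq: "?g J \<oplus>\<^bsub>?F\<^esub> f i \<odot>\<^bsub>?F\<^esub> ?\<delta> = ?g (insert i J)"
    proof
      fix j
      have "f j \<in> carrier R" if "j \<in> I" using f that by auto
      then show "(?g J \<oplus>\<^bsub>?F\<^esub> f i \<odot>\<^bsub>?F\<^esub> ?\<delta>) j = ?g (insert i J) j"
        using insert.hyps fi by (cases "j \<in> I") (auto simp: func_space_simps[OF R])
    qed
    show ?case using N' unfolding eq .
  qed
  from this[OF I order_refl] have "(\<lambda>j\<in>I. if j \<in> I then f j else \<zero>\<^bsub>R\<^esub>) \<in> N" .
  also have "(\<lambda>j\<in>I. if j \<in> I then f j else \<zero>\<^bsub>R\<^esub>) = f"
    by (rule ext) (use PiE_arb[OF f] in simp)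
  finally show "f \<in> N" .
qed

text \<open>The unit vectors form a basis: evaluating a linear relation at \<open>i\<close> leaves
  only the coefficient of the unit vector of \<open>i\<close>.\<close>

lemma free_module_func_space:
  assumes R: "cring R" and I: "finite I"
  shows "free_module R (ring.func_space R I)"
proof -
  interpret cring R by fact
  let ?F = "ring.func_space R I"
  interpret F: module R ?F by (rule func_space_is_module)
  interpret reg: module R "regular_module R" by (rule regular_module_module) fact
  define \<delta> where "\<delta> i = (\<lambda>j\<in>I. if j = i then \<one>\<^bsub>R\<^esub> else \<zero>\<^bsub>R\<^esub>)" for i
  have \<delta>I: "\<delta> ` I \<subseteq> carrier ?F" by (auto simp: \<delta>_def func_space_simps[OF R])
  have "carrier ?F \<subseteq> F.span (\<delta> ` I)"
    using F.in_own_span[OF \<delta>I]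
    by (intro func_space_span R I F.span_is_submodule \<delta>I) (auto simp: \<delta>_def)
  with F.span_is_subset2[OF \<delta>I] have "F.span (\<delta> ` I) = carrier ?F" by blast
  moreover have "\<not> F.lin_dep (\<delta> ` I)"
  proof
    assume "F.lin_dep (\<delta> ` I)"
    then obtain A a v where A: "finite A" "A \<subseteq> \<delta> ` I" "a \<in> A \<rightarrow> carrier R"
      "F.lincomb a A = \<zero>\<^bsub>?F\<^esub>" "v \<in> A" "a v \<noteq> \<zero>\<^bsub>R\<^esub>"
      unfolding F.lin_dep_def by blast
    obtain i where i: "i \<in> I" "v = \<delta> i" using A by blast
    interpret ev: mod_hom R ?F "regular_module R" "\<lambda>f. f i" using R i(1) by (rule eval_mod_hom)
    have AF: "A \<subseteq> carrier ?F" using A(2) \<delta>I by blast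
    have "\<zero>\<^bsub>R\<^esub> = F.lincomb a A i"
      using A(4) i(1) by (simp add: func_space_simps[OF R])
    also have "\<dots> = (\<Oplus>\<^bsub>regular_module R\<^esub>w\<in>A. (a w \<odot>\<^bsub>?F\<^esub> w) i)"
      unfolding F.lincomb_def using A(3) AF by (intro ev.hom_sum) auto
    also have "\<dots> = (\<Oplus>\<^bsub>regular_module R\<^esub>w\<in>A. if v = w then a w else \<zero>\<^bsub>regular_module R\<^esub>)"
    proof (rule reg.M.finsum_cong')
      fix w assume w: "w \<in> A"
      obtain k where k: "k \<in> I" "w = \<delta> k" using A(2) w by blast
      have aw: "a w \<in> carrier R" using A(3) w by auto
      have wi: "w i = (if v = w then \<one>\<^bsub>R\<^esub> else \<zero>\<^bsub>R\<^esub>)"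
      proof (cases "v = w")
        case True
        have "v i = \<one>\<^bsub>R\<^esub>" using i by (simp add: \<delta>_def)
        with True show ?thesis by simp
      next
        case False
        then have "i \<noteq> k" using i k by auto
        with False show ?thesis using i(1) k(2) by (simp add: \<delta>_def)
      qed
      have "(a w \<odot>\<^bsub>?F\<^esub> w) i = a w \<otimes>\<^bsub>R\<^esub> w i"
        using i(1) by (simp add: func_space_simps[OF R])
      with aw show "(a w \<odot>\<^bsub>?F\<^esub> w) i = (if v = w then a w else \<zero>\<^bsub>regular_module R\<^esub>)"
        by (simp add: wi regular_module_def)
    qed (use A(3) in \<open>auto simp: regular_module_def\<close>)
    also have "\<dots> = a v"
      using A by (intro reg.M.finsum_singleton) (auto simp: regular_module_def)
    finally show False using A(6) by simp
  qed
  ultimately show ?thesis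
    unfolding free_module_def using \<delta>I F.module_axioms by blast
qed

lemma func_space_reindex:
  assumes R: "cring R" and h: "h \<in> S \<rightarrow> I"
  shows "mod_hom R (ring.func_space R I) (ring.func_space R S) (\<lambda>f. \<lambda>v\<in>S. f (h v))"
  using h by (intro mod_homI cring.func_space_is_module R module_homI)
    (auto simp: func_space_simps[OF R] Pi_iff intro!: restrict_ext)

text \<open>The natural index set is a set of elements of \<open>M\<close>, whose type would change
  at each step of a resolution. A bijection with a finite subset of a fixed infinite type
  \<open>'i\<close> lets all terms of a resolution share one element type.\<close>

lemma finitely_generated_cover:
  assumes M: "module R M" "finitely_generated R M" and inf: "infinite (UNIV :: 'i set)"
  shows "\<exists>(I :: 'i set) f. finite I \<and> f \<in> hom_set R (ring.func_space R I) M \<and>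
    f ` carrier (ring.func_space R I) = carrier M"
proof -
  have R: "cring R" using M(1) by (simp add: module_def)
  obtain S f where S: "finite S" "S \<subseteq> carrier M" and f: "mod_hom R (ring.func_space R S) M f"
    and surj: "f ` carrier (ring.func_space R S) = carrier M"
    using finitely_generated_surj[OF M] by blast
  interpret f: mod_hom R "ring.func_space R S" M f by fact
  obtain I :: "'i set" where I: "finite I" "card I = card S"
    using infinite_arbitrarily_large[OF inf] by blast
  then obtain h where h: "bij_betw h S I"
    using finite_same_card_bij[OF S(1)] by metis
  then have hI: "h \<in> S \<rightarrow> I" by (auto simp: bij_betw_def)
  let ?r = "\<lambda>f. \<lambda>v\<in>S. f (h v)"
  interpret r: mod_hom R "ring.func_space R I" "ring.func_space R S" ?r
    by (rule func_space_reindex[OF R hI])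
  have r: "?r ` carrier (ring.func_space R I) = carrier (ring.func_space R S)"
  proof
    show "carrier (ring.func_space R S) \<subseteq> ?r ` carrier (ring.func_space R I)"
    proof
      fix g assume g: "g \<in> carrier (ring.func_space R S)"
      let ?g = "\<lambda>i\<in>I. g (inv_into S h i)"
      have "?g \<in> carrier (ring.func_space R I)"
        using g h by (auto simp: func_space_simps[OF R] bij_betw_def PiE_iff inv_into_into)
      moreover have "g = ?r ?g"
        using g h hI by (auto simp: func_space_simps[OF R] bij_betw_def PiE_iff
            intro!: extensionalityI[of g S])
      ultimately show "g \<in> ?r ` carrier (ring.func_space R I)" by blast
    qed
  qed (use r.f_im in auto)
  define e where "e = (\<lambda>x\<in>carrier (ring.func_space R I). f (?r x))"
  have "e \<in> module_hom R (ring.func_space R I) M"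
    by (rule module_hom_cong[OF r.M.module_axioms module_hom_comp[OF r.f_hom f.f_hom]])
       (simp add: e_def)
  moreover have "e ` carrier (ring.func_space R I) = f ` (?r ` carrier (ring.func_space R I))"
    unfolding image_image by (rule image_cong) (simp_all add: e_def)
  ultimately show ?thesis
    using I(1) unfolding r surj by (intro exI[of _ I] exI[of _ e]) (auto simp: hom_set_def e_def)
qed

text \<open>Dependent choice: each kernel is a submodule of a finite free module, hence finitely
  generated, hence again the image of a finite free module.\<close>

lemma ex_free_resolution:
  fixes N :: "('a, 'n) module"
  assumes R: "cring R" "noetherian_ring R" and N: "module R N" "finitely_generated R N"
    and inf: "infinite (UNIV :: 'i set)"
  shows "\<exists>(P :: nat \<Rightarrow> ('a, 'i \<Rightarrow> 'a) module) d e. free_resolution R N P d e"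
proof -
  let ?F = "\<lambda>I :: 'i set. ring.func_space R I"
  \<comment> \<open>A state \<open>(I, K)\<close> consists of the index set of the current free
    module and the kernel to be covered next. The clause for \<open>n = 0\<close> keeps the
    augmentation, which has no predecessor state to be recovered from.\<close>
  let ?S = "\<lambda>(n :: nat) (I, K). finite I \<and> submodule R K (?F I) \<and>
    (n = 0 \<longrightarrow> (\<exists>e \<in> hom_set R (?F I) N. e ` carrier (?F I) = carrier N \<and> K = a_kernel (?F I) N e))"
  let ?T = "\<lambda>(I, K) (J, L). \<exists>d \<in> hom_set R (?F J) (?F I). d ` carrier (?F J) = K \<and> L = a_kernel (?F J) (?F I) d"
  have "\<exists>x. \<forall>n::nat. ?S n (x n) \<and> ?T (x n) (x (Suc n))"
  proof (rule dependent_nat_choice)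
    obtain I :: "'i set" and e where "finite I" "e \<in> hom_set R (?F I) N" "e ` carrier (?F I) = carrier N"
      using finitely_generated_cover[OF N inf] by blast
    moreover from this have "submodule R (a_kernel (?F I) N e) (?F I)"
      by (intro ker_submodule mod_homI cring.func_space_is_module R N) (auto simp: hom_set_def)
    ultimately show "\<exists>x. ?S 0 x" by (intro exI[of _ "(I, a_kernel (?F I) N e)"]) auto
  next
    fix x n assume "?S n x"
    then obtain I K where x: "x = (I, K)" "finite I" "submodule R K (?F I)" by auto
    have K: "carrier ((?F I)\<lparr>carrier := K\<rparr>) = K" by simp
    obtain J :: "'i set" and d where d: "finite J" "d \<in> hom_set R (?F J) ((?F I)\<lparr>carrier := K\<rparr>)"
      "d ` carrier (?F J) = K"
      using finitely_generated_cover[OF md_module[OF x(3)] noetherian_func_space[OF R x(2,3)] inf]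
      unfolding K by blast
    have d': "d \<in> hom_set R (?F J) (?F I)"
      using d(2) submodule.subset[OF x(3)] by (auto simp: hom_set_def module_hom_def)
    then have "submodule R (a_kernel (?F J) (?F I) d) (?F J)"
      by (intro ker_submodule mod_homI cring.func_space_is_module R) (auto simp: hom_set_def)
    with d d' x show "\<exists>y. ?S (Suc n) y \<and> ?T x y"
      by (intro exI[of _ "(J, a_kernel (?F J) (?F I) d)"]) auto
  qed
  then obtain x where x': "\<forall>n::nat. ?S n (x n) \<and> ?T (x n) (x (Suc n))" by (rule exE)
  note x = x'[THEN spec, THEN conjunct1] x'[THEN spec, THEN conjunct2]
  define P where "P n = ?F (fst (x n))" for n
  have "\<forall>n. \<exists>d. d \<in> hom_set R (P (Suc n)) (P n) \<and> d ` carrier (P (Suc n)) = snd (x n) \<and>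
      snd (x (Suc n)) = a_kernel (P (Suc n)) (P n) d"
    using x(2) by (fastforce simp: P_def split_beta)
  then obtain d where d: "\<And>n. d n \<in> hom_set R (P (Suc n)) (P n)"
    "\<And>n. d n ` carrier (P (Suc n)) = snd (x n)"
    "\<And>n. snd (x (Suc n)) = a_kernel (P (Suc n)) (P n) (d n)"
    by metis
  obtain e where e: "e \<in> hom_set R (P 0) N" "e ` carrier (P 0) = carrier N" "snd (x 0) = a_kernel (P 0) N e"
    using x(1)[of 0] by (auto simp: P_def split_beta)
  have "free_module R (P n)" for n
    using x(1)[of n] by (auto simp: P_def split_beta intro: free_module_func_space R)
  with d e have "free_resolution R N P d e"
    unfolding free_resolution_def by simp
  then show ?thesis by blast
qed

section \<open>Lifting along surjections\<close>

text \<open>The lift is the submodule of \<open>P \<oplus> M\<close> spanned by the pairs (b, s b), where b runs through a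
  basis and g (s b) = f b; linear independence makes it the graph of a function.\<close>

lemma free_module_lift:
  assumes P: "free_module R P" and f: "mod_hom R P N f" and g: "mod_hom R M N g"
    and surj: "g ` carrier M = carrier N"
  shows "\<exists>h \<in> module_hom R P M. \<forall>x \<in> carrier P. g (h x) = f x"
proof -
  interpret f: mod_hom R P N f by fact
  interpret g: mod_hom R M N g by fact
  obtain B where B: "B \<subseteq> carrier P" "f.M.span B = carrier P" "\<not> f.M.lin_dep B"
    using P by (auto simp: free_module_def)
  have "\<forall>b\<in>B. \<exists>m\<in>carrier M. g m = f b"
  proof
    fix b assume "b \<in> B"
    then have "f b \<in> g ` carrier M" using B(1) surj f.f_im by auto
    then show "\<exists>m\<in>carrier M. g m = f b" by auto
  qed
  then obtain s where s: "\<And>b. b \<in> B \<Longrightarrow> s b \<in> carrier M" "\<And>b. b \<in> B \<Longrightarrow> g (s b) = f b"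
    by metis
  let ?D = "direct_sum P M"
  interpret D: module R ?D by (intro direct_sum_is_module f.M.module_axioms g.M.module_axioms)
  interpret fst: mod_hom R ?D P fst
    by (intro mod_homI D.module_axioms f.M.module_axioms module_homI) (auto simp: direct_sum_def)
  define E where "E = (\<lambda>b. (b, s b)) ` B"
  have E: "E \<subseteq> carrier ?D" using B(1) s(1) by (auto simp: E_def direct_sum_def)
  define G where "G = D.span E"
  have G: "submodule R G ?D" unfolding G_def by (rule D.span_is_submodule[OF E])
  have EG: "E \<subseteq> G" unfolding G_def by (rule D.in_own_span[OF E])
  \<comment> \<open>The first components of the pairs are distinct basis elements, so projecting a
    linear combination with first component zero gives a relation in \<open>P\<close>. Its
    coefficients vanish, and with them the second component.\<close>
  have G0: "m = \<zero>\<^bsub>M\<^esub>" if "(\<zero>\<^bsub>P\<^esub>, m) \<in> G" for m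
  proof -
    from that obtain A a where A: "finite A" "A \<subseteq> E" "a \<in> A \<rightarrow> carrier R" "D.lincomb a A = (\<zero>\<^bsub>P\<^esub>, m)"
      unfolding G_def D.span_def by auto
    have sfst: "v = (fst v, s (fst v))" if "v \<in> A" for v using that A(2) by (auto simp: E_def)
    have inj: "inj_on fst A" using sfst by (metis inj_onI)
    have fA: "fst ` A \<subseteq> B" using A(2) by (auto simp: E_def)
    have AD: "A \<subseteq> carrier ?D" using A(2) E by blast
    let ?a = "\<lambda>b. a (b, s b)"
    have aa: "?a (fst v) = a v" if "v \<in> A" for v using sfst[OF that] by metis
    have c: "?a (fst v) \<in> carrier R" "fst v \<in> carrier P" if "v \<in> A" for v
      using that A(3) AD aa[OF that] by (auto simp: direct_sum_def)
    have "\<zero>\<^bsub>P\<^esub> = fst (D.lincomb a A)" using A(4) by simp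
    also have "\<dots> = (\<Oplus>\<^bsub>P\<^esub>v\<in>A. fst (a v \<odot>\<^bsub>?D\<^esub> v))"
      unfolding D.lincomb_def using A(3) AD by (intro fst.hom_sum) auto
    also have "\<dots> = (\<Oplus>\<^bsub>P\<^esub>v\<in>A. ?a (fst v) \<odot>\<^bsub>P\<^esub> fst v)"
      using c by (intro f.M.M.finsum_cong') (simp_all add: direct_sum_def aa)
    also have "\<dots> = f.M.lincomb ?a (fst ` A)"
      unfolding f.M.lincomb_def
      using c by (intro f.M.M.finsum_reindex[symmetric] inj) auto
    finally have l0: "f.M.lincomb ?a (fst ` A) = \<zero>\<^bsub>P\<^esub>" by simp
    have "a v = \<zero>\<^bsub>R\<^esub>" if "v \<in> A" for v
    proof (rule ccontr)
      assume "a v \<noteq> \<zero>\<^bsub>R\<^esub>"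
      then have "f.M.lin_dep B"
        using that A(1,3) fA l0 aa
        by (intro f.M.lin_dep_crit[of "fst ` A" B ?a "fst v"]) auto
      with B(3) show False by simp
    qed
    then have "D.lincomb a A = \<zero>\<^bsub>?D\<^esub>"
      unfolding D.lincomb_def using AD by (intro D.M.finsum_all0) (auto simp: subset_iff)
    with A(4) show ?thesis by (simp add: direct_sum_def)
  qed
  have Gg: "x \<in> carrier P \<and> m \<in> carrier M \<and> g m = f x" if "(x, m) \<in> G" for x m
  proof -
    let ?K = "{z \<in> carrier ?D. g (snd z) = f (fst z)}"
    have "submodule R ?K ?D"
      by (rule submodule.intro) (auto simp: direct_sum_def D.module_axioms[unfolded direct_sum_def])
    moreover have "E \<subseteq> ?K" using E s(2) by (auto simp: E_def)
    ultimately have "G \<subseteq> ?K" unfolding G_def by (rule D.span_is_subset[rotated])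
    with that show ?thesis by (auto simp: direct_sum_def)
  qed
  have Gtot: "\<exists>m. (x, m) \<in> G" if "x \<in> carrier P" for x
  proof -
    have "submodule R (fst ` G) P" by (rule im_submodule'[OF fst.mod_hom_axioms G])
    moreover have "B \<subseteq> fst ` G" using EG by (force simp: E_def)
    ultimately have "f.M.span B \<subseteq> fst ` G" by (rule f.M.span_is_subset[rotated])
    with that B(2) show ?thesis by force
  qed
  have Guniq: "m = m'" if "(x, m) \<in> G" "(x, m') \<in> G" for x m m'
  proof -
    from that have c: "x \<in> carrier P" "m \<in> carrier M" "m' \<in> carrier M" using Gg by auto
    \<comment> \<open>The difference of two pairs over the same \<open>x\<close> has first component
      zero, which is the case just settled.\<close>
    have "(x, m) \<oplus>\<^bsub>?D\<^esub> (\<ominus>\<^bsub>R\<^esub> \<one>\<^bsub>R\<^esub>) \<odot>\<^bsub>?D\<^esub> (x, m') \<in> G"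
      using that by (intro submodule.m_closed[OF G] submodule.smult_closed[OF G]) auto
    also have "(x, m) \<oplus>\<^bsub>?D\<^esub> (\<ominus>\<^bsub>R\<^esub> \<one>\<^bsub>R\<^esub>) \<odot>\<^bsub>?D\<^esub> (x, m') = (\<zero>\<^bsub>P\<^esub>, m \<ominus>\<^bsub>M\<^esub> m')"
      using c by (simp add: direct_sum_def f.M.smult_minus_1 g.M.smult_minus_1 f.M.M.r_neg a_minus_def)
    finally have "m \<ominus>\<^bsub>M\<^esub> m' = \<zero>\<^bsub>M\<^esub>" by (rule G0)
    then show ?thesis using c by simp
  qed
  define h where "h x = (SOME m. (x, m) \<in> G)" for x
  have h: "(x, h x) \<in> G" if "x \<in> carrier P" for x
    unfolding h_def using someI_ex[OF Gtot[OF that]] .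
  have "h \<in> module_hom R P M"
  proof (rule module_homI)
    fix x y assume xy: "x \<in> carrier P" "y \<in> carrier P"
    have "(x \<oplus>\<^bsub>P\<^esub> y, h x \<oplus>\<^bsub>M\<^esub> h y) \<in> G"
      using submodule.m_closed[OF G h[OF xy(1)] h[OF xy(2)]] by (simp add: direct_sum_def)
    then show "h (x \<oplus>\<^bsub>P\<^esub> y) = h x \<oplus>\<^bsub>M\<^esub> h y"
      using xy by (intro Guniq[OF h]) auto
  next
    fix r x assume rx: "r \<in> carrier R" "x \<in> carrier P"
    have "(r \<odot>\<^bsub>P\<^esub> x, r \<odot>\<^bsub>M\<^esub> h x) \<in> G"
      using submodule.smult_closed[OF G rx(1) h[OF rx(2)]] by (simp add: direct_sum_def)
    then show "h (r \<odot>\<^bsub>P\<^esub> x) = r \<odot>\<^bsub>M\<^esub> h x"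
      using rx by (intro Guniq[OF h]) auto
  qed (use h Gg in blast)
  then show ?thesis using h Gg by blast
qed

section \<open>Cohomology of Hom complexes\<close>

lemma hom_module_simps:
  "carrier (hom_module R M N) = hom_set R M N"
  "\<zero>\<^bsub>hom_module R M N\<^esub> = (\<lambda>x\<in>carrier M. \<zero>\<^bsub>N\<^esub>)"
  "f \<oplus>\<^bsub>hom_module R M N\<^esub> g = (\<lambda>x\<in>carrier M. f x \<oplus>\<^bsub>N\<^esub> g x)"
  "r \<odot>\<^bsub>hom_module R M N\<^esub> f = (\<lambda>x\<in>carrier M. r \<odot>\<^bsub>N\<^esub> f x)"
  by (simp_all add: hom_module_def)

lemma hom_set_closed: "f \<in> hom_set R M N \<Longrightarrow> x \<in> carrier M \<Longrightarrow> f x \<in> carrier N"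
  by (auto simp: hom_set_def module_hom_def)

lemma hom_set_restrict:
  assumes "module R M" "\<And>x. x \<in> carrier M \<Longrightarrow> f x \<in> carrier N"
    and "\<And>x y. x \<in> carrier M \<Longrightarrow> y \<in> carrier M \<Longrightarrow> f (x \<oplus>\<^bsub>M\<^esub> y) = f x \<oplus>\<^bsub>N\<^esub> f y"
    and "\<And>r x. r \<in> carrier R \<Longrightarrow> x \<in> carrier M \<Longrightarrow> f (r \<odot>\<^bsub>M\<^esub> x) = r \<odot>\<^bsub>N\<^esub> f x"
  shows "(\<lambda>x\<in>carrier M. f x) \<in> hom_set R M N"
proof -
  interpret module R M by fact
  show ?thesis
    unfolding hom_set_def by (intro IntI module_homI) (simp_all add: assms(2-))
qed

lemma restrict_eq_hom:
  "f \<in> hom_set R M N \<Longrightarrow> (\<And>x. x \<in> carrier M \<Longrightarrow> g x = f x) \<Longrightarrow> (\<lambda>x\<in>carrier M. g x) = f"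
  by (auto simp: hom_set_def fun_eq_iff restrict_def extensional_def)

lemma hom_set_mod_hom: "module R M \<Longrightarrow> module R N \<Longrightarrow> f \<in> hom_set R M N \<Longrightarrow> mod_hom R M N f"
  by (simp add: hom_set_def mod_homI)

lemma hom_module_module:
  assumes "module R M" "module R N"
  shows "module R (hom_module R M N)"
proof -
  interpret M: module R M by fact
  interpret N: module R N by fact
  note hom_mod_hom = hom_set_mod_hom[OF assms]
  have zero: "(\<lambda>x\<in>carrier M. \<zero>\<^bsub>N\<^esub>) \<in> hom_set R M N"
    by (rule hom_set_restrict) (simp_all add: M.module_axioms)
  have add: "(\<lambda>x\<in>carrier M. f x \<oplus>\<^bsub>N\<^esub> g x) \<in> hom_set R M N"
    if "f \<in> hom_set R M N" "g \<in> hom_set R M N" for f g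
  proof -
    interpret f: mod_hom R M N f by (rule hom_mod_hom) fact
    interpret g: mod_hom R M N g by (rule hom_mod_hom) fact
    show ?thesis
      by (rule hom_set_restrict) (simp_all add: M.module_axioms N.M.a_ac N.smult_r_distr)
  qed
  have smult: "(\<lambda>x\<in>carrier M. r \<odot>\<^bsub>N\<^esub> f x) \<in> hom_set R M N"
    if "r \<in> carrier R" "f \<in> hom_set R M N" for r f
  proof -
    interpret f: mod_hom R M N f by (rule hom_mod_hom) fact
    show ?thesis
      using that(1)
      by (intro hom_set_restrict)
         (simp_all add: M.module_axioms N.smult_r_distr N.smult_assoc1[symmetric] M.R.m_comm)
  qed
  have neg: "\<exists>g\<in>hom_set R M N. (\<lambda>x\<in>carrier M. f x \<oplus>\<^bsub>N\<^esub> g x) = (\<lambda>x\<in>carrier M. \<zero>\<^bsub>N\<^esub>)"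
    if f: "f \<in> hom_set R M N" for f
  proof -
    interpret f: mod_hom R M N f by (rule hom_mod_hom) fact
    show ?thesis
      using smult[OF _ f, of "\<ominus>\<^bsub>R\<^esub> \<one>\<^bsub>R\<^esub>"]
      by (intro bexI[of _ "\<lambda>x\<in>carrier M. (\<ominus>\<^bsub>R\<^esub> \<one>\<^bsub>R\<^esub>) \<odot>\<^bsub>N\<^esub> f x"])
         (auto intro!: restrict_ext simp: N.smult_minus_1 N.M.r_neg)
  qed
  note cl = hom_set_closed[of _ R M N]
  show ?thesis
    by (rule module_criteria)
       (auto simp: hom_module_simps M.R.is_cring zero add smult neg cl N.M.a_ac N.smult_assoc1
          N.smult_l_distr N.smult_r_distr intro!: restrict_ext restrict_eq_hom)
qed

lemma hom_module_postcomp: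
  assumes P: "module R P" and f: "mod_hom R M N f"
  shows "mod_hom R (hom_module R P M) (hom_module R P N) (compose (carrier P) f)"
proof -
  interpret P: module R P by fact
  interpret f: mod_hom R M N f by fact
  have "compose (carrier P) f h \<in> hom_set R P N" if h: "h \<in> hom_set R P M" for h
  proof -
    interpret h: mod_hom R P M h by (rule hom_set_mod_hom[OF P f.M.module_axioms h])
    show ?thesis unfolding compose_def by (rule hom_set_restrict) (simp_all add: P)
  qed
  then show ?thesis
    using hom_set_closed[of _ R P M]
    by (intro mod_homI hom_module_module module_homI P f.M.module_axioms f.N.module_axioms)
       (auto simp: hom_module_simps compose_def intro!: restrict_ext)
qed

lemma hom_module_precomp:
  assumes M: "module R M" and d: "mod_hom R P' P d"
  shows "mod_hom R (hom_module R P M) (hom_module R P' M) (\<lambda>f. compose (carrier P') f d)"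
proof -
  interpret M: module R M by fact
  interpret d: mod_hom R P' P d by fact
  have "compose (carrier P') h d \<in> hom_set R P' M" if h: "h \<in> hom_set R P M" for h
  proof -
    interpret h: mod_hom R P M h by (rule hom_set_mod_hom[OF d.N.module_axioms M h])
    show ?thesis unfolding compose_def by (rule hom_set_restrict) (simp_all add: d.M.module_axioms)
  qed
  then show ?thesis
    by (intro mod_homI hom_module_module module_homI M d.M.module_axioms d.N.module_axioms)
       (auto simp: hom_module_simps compose_def intro!: restrict_ext)
qed

abbreviation hom_diff :: "(nat \<Rightarrow> ('a, 'p) module) \<Rightarrow> (nat \<Rightarrow> 'p \<Rightarrow> 'p) \<Rightarrow> nat \<Rightarrow> ('p \<Rightarrow> 'm) \<Rightarrow> 'p \<Rightarrow> 'm" where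
  "hom_diff P d i \<equiv> \<lambda>f. compose (carrier (P (Suc i))) f (d i)"

definition hom_cocycles where
  "hom_cocycles R P d M i =
    a_kernel (hom_module R (P i) M) (hom_module R (P (Suc i)) M) (hom_diff P d i)"

definition hom_coboundaries where
  "hom_coboundaries R P d M i = (case i of 0 \<Rightarrow> {\<zero>\<^bsub>hom_module R (P 0) M\<^esub>}
    | Suc j \<Rightarrow> hom_diff P d j ` carrier (hom_module R (P j) M))"

lemma hom_cohomology_alt:
  "hom_cohomology R P d M i =
    quot_module ((hom_module R (P i) M)\<lparr>carrier := hom_cocycles R P d M i\<rparr>) (hom_coboundaries R P d M i)"
  unfolding hom_cohomology_def hom_cocycles_def hom_coboundaries_def Let_def ..

section \<open>Cohomology of Hom from a complex of free modules\<close>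

locale free_complex =
  fixes R and P :: "nat \<Rightarrow> ('a, 'p) module" and d
  assumes free: "\<And>i. free_module R (P i)"
    and diff_hom: "\<And>i. mod_hom R (P (Suc i)) (P i) (d i)"
    and diff_diff: "\<And>i x. x \<in> carrier (P (Suc (Suc i))) \<Longrightarrow> d i (d (Suc i) x) = \<zero>\<^bsub>P i\<^esub>"
begin

lemma P_module: "module R (P i)"
  using free[of i] by (simp add: free_module_def)

lemma diff_closed: "x \<in> carrier (P (Suc i)) \<Longrightarrow> d i x \<in> carrier (P i)"
  using diff_hom[of i] by (rule mod_hom.f_im)

lemma cocycles_iff:
  assumes "module R M"
  shows "f \<in> hom_cocycles R P d M i \<longleftrightarrow>
    f \<in> hom_set R (P i) M \<and> (\<forall>x\<in>carrier (P (Suc i)). f (d i x) = \<zero>\<^bsub>M\<^esub>)"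
  by (auto simp: hom_cocycles_def a_kernel_iff hom_module_simps compose_def fun_eq_iff restrict_def)

lemma cocycles_submodule:
  "module R M \<Longrightarrow> submodule R (hom_cocycles R P d M i) (hom_module R (P i) M)"
  unfolding hom_cocycles_def by (intro ker_submodule hom_module_precomp diff_hom)

lemma coboundaries_subset:
  assumes M: "module R M"
  shows "hom_coboundaries R P d M i \<subseteq> hom_cocycles R P d M i"
proof (cases i)
  case 0
  then show ?thesis
    using submodule.zero_closed[OF cocycles_submodule[OF M]] by (simp add: hom_coboundaries_def)
next
  case (Suc j)
  interpret h: mod_hom R "hom_module R (P j) M" "hom_module R (P i) M" "hom_diff P d j"
    unfolding Suc by (intro hom_module_precomp diff_hom M)
  have "hom_diff P d j f \<in> hom_cocycles R P d M i" if f: "f \<in> hom_set R (P j) M" for f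
  proof -
    interpret f: mod_hom R "P j" M f by (rule hom_set_mod_hom[OF P_module M f])
    show ?thesis
      using h.f_im[of f] f unfolding cocycles_iff[OF M]
      by (auto simp: hom_module_simps compose_def Suc diff_closed diff_diff)
  qed
  then show ?thesis by (auto simp: Suc hom_coboundaries_def hom_module_simps)
qed

lemma coboundaries_submodule:
  assumes M: "module R M"
  shows "submodule R (hom_coboundaries R P d M i) (hom_module R (P i) M)"
proof (cases i)
  case 0
  then show ?thesis by (simp add: hom_coboundaries_def zero_submodule hom_module_module P_module M)
next
  case (Suc j)
  then show ?thesis
    by (simp add: hom_coboundaries_def) (intro im_submodule hom_module_precomp diff_hom M)
qed

lemma hom_cohomology_module:
  "module R M \<Longrightarrow> module R (hom_cohomology R P d M i)"
  unfolding hom_cohomology_alt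
  by (intro quot_module_module submodule_md cocycles_submodule coboundaries_submodule coboundaries_subset)

lemma hom_cohomology_zero:
  assumes M: "module R M" and 0: "carrier M = {\<zero>\<^bsub>M\<^esub>}"
  shows "finitely_generated R (hom_cohomology R P d M i)"
proof (rule zero_finitely_generated[OF hom_cohomology_module[OF M]])
  let ?C = "(hom_module R (P i) M)\<lparr>carrier := hom_cocycles R P d M i\<rparr>" and ?B = "hom_coboundaries R P d M i"
  have B: "submodule R ?B ?C"
    by (intro submodule_md cocycles_submodule coboundaries_submodule coboundaries_subset M)
  have "f = \<zero>\<^bsub>?C\<^esub>" if "f \<in> carrier ?C" for f
    using that hom_set_closed[of f R "P i" M] 0
    by (auto simp: cocycles_iff[OF M] hom_module_simps hom_set_def intro!: extensionalityI[of f "carrier (P i)"])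
  then have "carrier ?C \<subseteq> ?B" using submodule.zero_closed[OF B] by auto
  then have "carrier (quot_module ?C ?B) \<subseteq> {?B}"
    using coset_zero[OF B] unfolding carrier_quot_module by blast
  moreover have "?B \<in> carrier (quot_module ?C ?B)"
    using module.axioms(2)[OF quot_module_module[OF B]]
    by (auto simp: quot_module_def dest!: abelian_group.axioms(1) abelian_monoid.zero_closed)
  ultimately show "carrier (hom_cohomology R P d M i) = {\<zero>\<^bsub>hom_cohomology R P d M i\<^esub>}"
    unfolding hom_cohomology_alt by (auto simp: quot_module_def)
qed

text \<open>For a short exact sequence of coefficients, the cohomology of \<open>M\<close> sits in
  the middle of an exact sequence between finitely generated modules. Exactness there needs one
  correction by a coboundary, found by lifting along \<open>g\<close> from a free module.\<close>

lemma hom_cohomology_extension: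
  assumes R: "noetherian_ring R"
    and f: "mod_hom R L M f" and g: "mod_hom R M N g"
    and inj: "inj_on f (carrier L)" and surj: "g ` carrier M = carrier N"
    and exact: "a_kernel M N g = f ` carrier L"
    and L: "finitely_generated R (hom_cohomology R P d L i)"
    and N: "finitely_generated R (hom_cohomology R P d N i)"
  shows "finitely_generated R (hom_cohomology R P d M i)"
proof -
  interpret f: mod_hom R L M f by fact
  interpret g: mod_hom R M N g by fact
  note mL = f.M.module_axioms and mM = f.N.module_axioms and mN = g.N.module_axioms
  let ?f = "compose (carrier (P i)) f" and ?g = "compose (carrier (P i)) g"
  let ?CL = "(hom_module R (P i) L)\<lparr>carrier := hom_cocycles R P d L i\<rparr>"
  let ?CM = "(hom_module R (P i) M)\<lparr>carrier := hom_cocycles R P d M i\<rparr>"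
  let ?CN = "(hom_module R (P i) N)\<lparr>carrier := hom_cocycles R P d N i\<rparr>"
  let ?BL = "hom_coboundaries R P d L i" and ?BM = "hom_coboundaries R P d M i"
    and ?BN = "hom_coboundaries R P d N i"
  have ker: "x \<in> f ` carrier L \<longleftrightarrow> x \<in> carrier M \<and> g x = \<zero>\<^bsub>N\<^esub>" for x
    unfolding exact[symmetric] by (simp add: a_kernel_iff)
  have gf: "g (f x) = \<zero>\<^bsub>N\<^esub>" if "x \<in> carrier L" for x
    using ker[of "f x"] that by blast
  note F = hom_module_postcomp[OF P_module[of i] f] and G = hom_module_postcomp[OF P_module[of i] g]
  interpret F: mod_hom R "hom_module R (P i) L" "hom_module R (P i) M" ?f by (rule F)
  interpret G: mod_hom R "hom_module R (P i) M" "hom_module R (P i) N" ?g by (rule G)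
  have FZ: "?f ` hom_cocycles R P d L i \<subseteq> hom_cocycles R P d M i"
    using F.f_im by (auto simp: cocycles_iff mL mM hom_module_simps compose_def diff_closed)
  have GZ: "?g ` hom_cocycles R P d M i \<subseteq> hom_cocycles R P d N i"
    using G.f_im by (auto simp: cocycles_iff mN mM hom_module_simps compose_def diff_closed)
  have FB: "?f ` ?BL \<subseteq> ?BM"
  proof (cases i)
    case (Suc j)
    interpret F': mod_hom R "hom_module R (P j) L" "hom_module R (P j) M" "compose (carrier (P j)) f"
      by (rule hom_module_postcomp[OF P_module f])
    have "?f (hom_diff P d j h) = hom_diff P d j (compose (carrier (P j)) f h)" for h
      by (auto simp: compose_def Suc diff_closed fun_eq_iff restrict_def)
    then show ?thesis using F'.f_im by (auto simp: hom_coboundaries_def Suc)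
  qed (use F.f0_is_0 in \<open>simp add: hom_coboundaries_def\<close>)
  have GB: "?g ` ?BM \<subseteq> ?BN"
  proof (cases i)
    case (Suc j)
    interpret G': mod_hom R "hom_module R (P j) M" "hom_module R (P j) N" "compose (carrier (P j)) g"
      by (rule hom_module_postcomp[OF P_module g])
    have "?g (hom_diff P d j h) = hom_diff P d j (compose (carrier (P j)) g h)" for h
      by (auto simp: compose_def Suc diff_closed fun_eq_iff restrict_def)
    then show ?thesis using G'.f_im by (auto simp: hom_coboundaries_def Suc)
  qed (use G.f0_is_0 in \<open>simp add: hom_coboundaries_def\<close>)
  \<comment> \<open>A cocycle killed by \<open>g\<close> takes its values in the image of
    \<open>f\<close>, so it can be composed with the inverse of \<open>f\<close> there. Injectivity
    of \<open>f\<close> makes the result linear and again a cocycle.\<close>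
  have lift0: "\<exists>h\<in>hom_cocycles R P d L i. ?f h = y"
    if y: "y \<in> hom_cocycles R P d M i" and 0: "?g y = \<zero>\<^bsub>hom_module R (P i) N\<^esub>" for y
  proof -
    interpret y: mod_hom R "P i" M y
      using y by (intro hom_set_mod_hom P_module mM) (simp add: cocycles_iff mM)
    let ?h = "\<lambda>x\<in>carrier (P i). inv_into (carrier L) f (y x)"
    have im: "y x \<in> f ` carrier L" if "x \<in> carrier (P i)" for x
      using fun_cong[OF 0, of x] that by (simp add: ker hom_module_simps compose_def)
    have hf: "inv_into (carrier L) f z = l" if "z = f l" "l \<in> carrier L" for z l
      using that inj by (simp add: inv_into_f_f)
    have cl: "inv_into (carrier L) f (y x) \<in> carrier L" if "x \<in> carrier (P i)" for x
      using inv_into_into[OF im[OF that]] .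
    have fh: "f (inv_into (carrier L) f (y x)) = y x" if "x \<in> carrier (P i)" for x
      using f_inv_into_f[OF im[OF that]] .
    have h: "?h \<in> hom_set R (P i) L"
      by (rule hom_set_restrict[OF P_module]) (auto intro!: hf simp: cl fh)
    moreover have "?h (d i x) = \<zero>\<^bsub>L\<^esub>" if "x \<in> carrier (P (Suc i))" for x
      using that y by (auto simp: cocycles_iff mM diff_closed intro!: hf)
    ultimately have "?h \<in> hom_cocycles R P d L i" by (simp add: cocycles_iff mL)
    moreover have "?f ?h = y"
      using y by (auto simp: compose_def fh cocycles_iff mM hom_set_def
          intro!: extensionalityI[of _ "carrier (P i)"])
    ultimately show ?thesis by blast
  qed
  have ex: "\<exists>h\<in>carrier ?CL. y \<ominus>\<^bsub>?CM\<^esub> ?f h \<in> ?BM" if y: "y \<in> carrier ?CM" and gy: "?g y \<in> ?BN" for y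
  proof -
    have yZ: "y \<in> hom_cocycles R P d M i" using y by simp
    note ZM = cocycles_submodule[OF mM, of i]
    have yc: "y \<in> carrier (hom_module R (P i) M)" using yZ submodule.subset[OF ZM] by blast
    \<comment> \<open>In positive degree the image of \<open>y\<close> is the coboundary of some
      \<open>w\<close> into \<open>N\<close>. Freeness of \<open>P j\<close> lifts \<open>w\<close>
      to \<open>M\<close>, and the coboundary of the lift has the same image as \<open>y\<close>. In
      degree 0 the only coboundary is zero.\<close>
    have "\<exists>b\<in>?BM. ?g b = ?g y"
    proof (cases i)
      case 0
      then show ?thesis using gy G.f0_is_0 by (simp add: hom_coboundaries_def)
    next
      case (Suc j)
      then obtain w where w: "w \<in> hom_set R (P j) N" "?g y = hom_diff P d j w"
        using gy by (auto simp: hom_coboundaries_def hom_module_simps)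
      obtain h where h: "h \<in> module_hom R (P j) M" "\<And>x. x \<in> carrier (P j) \<Longrightarrow> g (h x) = w x"
        using free_module_lift[OF free hom_set_mod_hom[OF P_module mN w(1)] g surj] by blast
      interpret h: mod_hom R "P j" M h by (intro mod_homI h P_module mM)
      let ?h = "\<lambda>x\<in>carrier (P j). h x"
      have "?h \<in> hom_set R (P j) M" by (rule hom_set_restrict[OF P_module]) simp_all
      then have "hom_diff P d j ?h \<in> ?BM" by (simp add: hom_coboundaries_def Suc hom_module_simps)
      moreover have "?g (hom_diff P d j ?h) = ?g y"
        unfolding w(2) by (auto simp: compose_def Suc diff_closed h(2) fun_eq_iff restrict_def)
      ultimately show ?thesis by blast
    qed
    then obtain b where b: "b \<in> ?BM" "?g b = ?g y" by blast
    have bZ: "b \<in> hom_cocycles R P d M i" using b(1) coboundaries_subset[OF mM] by blast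
    have bc: "b \<in> carrier (hom_module R (P i) M)" using bZ submodule.subset[OF ZM] by blast
    have "y \<ominus>\<^bsub>hom_module R (P i) M\<^esub> b \<in> hom_cocycles R P d M i"
      by (rule submodule_minus_closed[OF ZM yZ bZ])
    moreover have "?g (y \<ominus>\<^bsub>hom_module R (P i) M\<^esub> b) = \<zero>\<^bsub>hom_module R (P i) N\<^esub>"
      using yc bc by (simp add: b(2) G.N.M.r_neg a_minus_def)
    ultimately obtain h where h: "h \<in> hom_cocycles R P d L i" "?f h = y \<ominus>\<^bsub>hom_module R (P i) M\<^esub> b"
      using lift0 by blast
    \<comment> \<open>Since \<open>h\<close> was chosen over \<open>y - b\<close>, what remains is
      exactly the coboundary \<open>b\<close>.\<close>
    have "y \<ominus>\<^bsub>?CM\<^esub> ?f h = y \<ominus>\<^bsub>hom_module R (P i) M\<^esub> ?f h"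
      using h FZ by (intro md_minus[OF ZM yZ]) blast
    also have "\<dots> = b"
      using yc bc unfolding h(2)
      by (simp add: a_minus_def F.N.M.minus_add F.N.M.a_assoc[symmetric] F.N.M.r_neg)
    finally show ?thesis using h(1) b(1) by (intro bexI[of _ h]) simp_all
  qed
  have BL: "submodule R ?BL ?CL" and BM: "submodule R ?BM ?CM" and BN: "submodule R ?BN ?CN"
    by (intro submodule_md cocycles_submodule coboundaries_submodule coboundaries_subset mL mM mN)+
  note F' = mod_hom_md[OF F cocycles_submodule[OF mL] cocycles_submodule[OF mM] FZ]
  note G' = mod_hom_md[OF G cocycles_submodule[OF mM] cocycles_submodule[OF mN] GZ]
  have 0: "?g (?f x) \<in> ?BN" if "x \<in> carrier ?CL" for x
  proof -
    have "?g (?f x) = \<zero>\<^bsub>hom_module R (P i) N\<^esub>"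
      using that hom_set_closed[of x R "P i" L]
      by (auto simp: compose_def hom_module_simps cocycles_iff mL gf intro!: restrict_ext)
    then show ?thesis using submodule.zero_closed[OF BN] by simp
  qed
  note hF = mod_hom.f_hom[OF F'] and hG = mod_hom.f_hom[OF G']
  show ?thesis
    unfolding hom_cohomology_alt
  proof (rule finitely_generated_exact[OF R])
    show "mod_hom R (quot_module ?CL ?BL) (quot_module ?CM ?BM) (quot_map ?CM ?BM ?f)"
      by (intro mod_homI quot_module_module quot_map_hom BL BM hF FB)
    show "mod_hom R (quot_module ?CM ?BM) (quot_module ?CN ?BN) (quot_map ?CN ?BN ?g)"
      by (intro mod_homI quot_module_module quot_map_hom BN BM hG GB)
    show "a_kernel (quot_module ?CM ?BM) (quot_module ?CN ?BN) (quot_map ?CN ?BN ?g) \<subseteq>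
        quot_map ?CM ?BM ?f ` carrier (quot_module ?CL ?BL)"
      using quot_map_exact[OF BL BM BN hF FB hG GB 0 ex] by blast
  qed (use L N in \<open>simp_all add: hom_cohomology_alt\<close>)
qed

end

section \<open>Cofinite modules\<close>

lemma mod_hom_inverse:
  assumes "mod_hom R M N f" "bij_betw f (carrier M) (carrier N)"
  shows "mod_hom R N M (inv_into (carrier M) f)"
proof -
  interpret f: mod_hom R M N f by fact
  let ?h = "inv_into (carrier M) f"
  have c: "?h x \<in> carrier M" "f (?h x) = x" if "x \<in> carrier N" for x
    using that bij_betwE[OF bij_betw_inv_into[OF assms(2)]] bij_betw_inv_into_right[OF assms(2)] by auto
  have u: "?h y = x" if "x \<in> carrier M" "f x = y" for x y
    using that assms(2) by (auto simp: bij_betw_def)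
  show ?thesis
    by (intro mod_homI f.M.module_axioms f.N.module_axioms module_homI) (auto intro!: u simp: c)
qed

lemma module_iso_sym:
  assumes M: "module R M" and N: "module R N" and iso: "module_iso R M N"
  shows "module_iso R N M"
proof -
  obtain f where f: "f \<in> module_hom R M N" "bij_betw f (carrier M) (carrier N)"
    using iso by (auto simp: module_iso_def)
  from mod_hom.f_hom[OF mod_hom_inverse[OF mod_homI[OF M N f(1)] f(2)]] bij_betw_inv_into[OF f(2)]
  show ?thesis by (auto simp: module_iso_def)
qed

lemma module_iso_trans:
  assumes "module_iso R M N" "module_iso R N P"
  shows "module_iso R M P"
proof -
  obtain f g where "f \<in> module_hom R M N" "bij_betw f (carrier M) (carrier N)"
    "g \<in> module_hom R N P" "bij_betw g (carrier N) (carrier P)"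
    using assms by (auto simp: module_iso_def)
  then have "(\<lambda>x. g (f x)) \<in> module_hom R M P" "bij_betw (g \<circ> f) (carrier M) (carrier P)"
    by (auto intro: module_hom_comp bij_betw_trans)
  then show ?thesis by (auto simp: module_iso_def comp_def)
qed

lemma first_isomorphism:
  assumes p: "mod_hom R M Q p" and surj: "p ` carrier M = carrier Q"
  shows "module_iso R (quot_module M (a_kernel M Q p)) Q"
proof -
  interpret p: mod_hom R M Q p by fact
  let ?B = "a_kernel M Q p"
  have B: "submodule R ?B M" by (rule ker_submodule[OF p])
  \<comment> \<open>The common value of \<open>p\<close> on a coset is extracted from a union of
    singletons, the form to which \<open>coset_union_const\<close> applies.\<close>
  define h where "h X = the_elem (\<Union>y\<in>X. {p y})" for X
  have peq: "p y = p x" if "x \<in> carrier M" "y \<in> carrier M" "y \<ominus>\<^bsub>M\<^esub> x \<in> ?B" for x y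
    using that by (simp add: a_kernel_iff)
  have h: "h (?B +>\<^bsub>M\<^esub> x) = p x" if "x \<in> carrier M" for x
  proof -
    have "(\<Union>y\<in>?B +>\<^bsub>M\<^esub> x. {p y}) = {p x}"
      using peq that by (intro coset_union_const[OF B]) auto
    then show ?thesis by (simp add: h_def)
  qed
  note q = quot_proj_hom[OF B]
  have "h \<in> module_hom R (quot_module M ?B) Q"
    by (rule module_homI)
       (auto simp: carrier_quot_module h module_hom_add[OF q, symmetric] module_hom_smult[OF q, symmetric])
  moreover have "bij_betw h (carrier (quot_module M ?B)) (carrier Q)"
  proof (rule bij_betwI')
    fix X Y assume "X \<in> carrier (quot_module M ?B)" "Y \<in> carrier (quot_module M ?B)"
    then obtain x y where "x \<in> carrier M" "X = ?B +>\<^bsub>M\<^esub> x" "y \<in> carrier M" "Y = ?B +>\<^bsub>M\<^esub> y"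
      by (auto simp: carrier_quot_module)
    then show "(h X = h Y) = (X = Y)"
      by (simp add: h coset_eq_iff[OF B] a_kernel_iff)
  next
    fix y assume "y \<in> carrier Q"
    then obtain x where "x \<in> carrier M" "y = p x" using surj by auto
    then show "\<exists>X\<in>carrier (quot_module M ?B). y = h X"
      by (auto simp: carrier_quot_module h)
  qed (auto simp: carrier_quot_module h)
  ultimately show ?thesis by (auto simp: module_iso_def)
qed

lemma relabel_module_hom:
  assumes "module R M" "inj_on g (carrier M)"
  shows "g \<in> module_hom R M (relabel_module g M)"
proof -
  interpret module R M by fact
  show ?thesis
    by (rule module_homI) (simp_all add: relabel_module_def Let_def inv_into_f_f[OF assms(2)])
qed

lemma carrier_relabel_module: "carrier (relabel_module g M) = g ` carrier M"
  by (simp add: relabel_module_def Let_def)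

lemma relabel_module_module:
  assumes "module R M" "inj_on g (carrier M)"
  shows "module R (relabel_module g M)"
  by (rule module_of_surj[OF assms(1) relabel_module_hom[OF assms]])
     (simp_all add: relabel_module_def Let_def)

lemma relabel_module_iso:
  assumes "module R M" "inj_on g (carrier M)"
  shows "module_iso R M (relabel_module g M)"
  using relabel_module_hom[OF assms] assms(2)
  by (auto simp: module_iso_def carrier_relabel_module bij_betw_def)

text \<open>Picking an element from every coset is injective, since the element determines its
  coset. This brings a quotient from \<open>'m set\<close> back to the type
  \<open>'m\<close>.\<close>

lemma quot_module_representatives:
  fixes M :: "('a, 'm) module"
  assumes B: "submodule R B M"
  shows "\<exists>K :: ('a, 'm) module. module R K \<and> module_iso R (quot_module M B) K"
proof -
  interpret abelian_subgroup B M by (rule submodule_abelian_subgroup) fact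
  let ?g = "\<lambda>X. SOME x. x \<in> X"
  have "B +>\<^bsub>M\<^esub> ?g X = X" if X: "X \<in> carrier (quot_module M B)" for X
  proof -
    obtain x where x: "x \<in> carrier M" "X = B +>\<^bsub>M\<^esub> x" using X by (auto simp: carrier_quot_module)
    have "?g X \<in> X" using a_rcos_self[OF x(1)] x(2) by (intro someI[of "\<lambda>y. y \<in> X" x]) simp
    with x show ?thesis using a_repr_independence'[of "?g X" x] by simp
  qed
  then have "inj_on ?g (carrier (quot_module M B))" by (intro inj_on_inverseI)
  with quot_module_module[OF B] show ?thesis
    by (intro exI[of _ "relabel_module ?g (quot_module M B)"] conjI relabel_module_module relabel_module_iso)
qed

lemma free_complex_free_resolution:
  assumes N: "module R N" and res: "free_resolution R N P d e"
  shows "free_complex R P d"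
proof (rule free_complex.intro)
  note r = res[unfolded free_resolution_def]
  have m: "module R (P i)" for i using r by (simp add: free_module_def)
  show "free_module R (P i)" for i using r by simp
  show "mod_hom R (P (Suc i)) (P i) (d i)" for i using r m by (simp add: hom_set_mod_hom)
  show "d i (d (Suc i) x) = \<zero>\<^bsub>P i\<^esub>" if "x \<in> carrier (P (Suc (Suc i)))" for i x
  proof -
    have "d (Suc i) x \<in> a_kernel (P (Suc i)) (P i) (d i)" using r that by blast
    then show ?thesis by (simp add: a_kernel_iff)
  qed
qed

locale noetherian_ideal =
  fixes A :: "('a, 'b) ring_scheme" and \<aa> :: "'a set"
  assumes cring: "cring A" and noetherian: "noetherian_ring A" and ideal: "ideal \<aa> A"
begin

lemma quotient_module: "module A (quot_module (regular_module A) \<aa>)"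
  using ideal by (intro quot_module_module) (simp add: regular_submodule_iff[OF cring])

lemma quotient_finitely_generated: "finitely_generated A (quot_module (regular_module A) \<aa>)"
proof -
  have sub: "submodule A \<aa> (regular_module A)" using ideal by (simp add: regular_submodule_iff[OF cring])
  have "ideal (carrier A) A" using cring by (intro ring.oneideal) (simp add: cring_def)
  then have "submodule A (carrier (regular_module A)) (regular_module A)"
    by (simp add: regular_submodule_iff[OF cring]) (simp add: regular_module_def)
  from noetherian_regular[OF cring noetherian this] have fg: "finitely_generated A (regular_module A)" by simp
  have hom: "mod_hom A (regular_module A) (quot_module (regular_module A) \<aa>) (\<lambda>x. \<aa> +>\<^bsub>regular_module A\<^esub> x)"
    by (intro mod_homI regular_module_module cring quotient_module quot_proj_hom sub)
  show ?thesis
    by (rule finitely_generated_image[OF hom _ fg]) (simp add: carrier_quot_module)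
qed

definition res_obj where "res_obj = fst (chosen_resolution A (quot_module (regular_module A) \<aa>))"
definition res_diff where "res_diff = snd (chosen_resolution A (quot_module (regular_module A) \<aa>))"

text \<open>The defining \<open>SOME\<close> picks a genuine resolution because one exists in its
  type: the elements of A/a are cosets, so the index type is lists over \<open>'a set + 'a\<close>,
  which is infinite.\<close>

lemma res_free_complex: "free_complex A res_obj res_diff"
proof -
  let ?N = "quot_module (regular_module A) \<aa>"
  have "infinite (UNIV :: ('a set + 'a) list set)" by (rule infinite_UNIV_listI)
  from ex_free_resolution[OF cring noetherian quotient_module quotient_finitely_generated this]
  have "\<exists>x :: (nat \<Rightarrow> ('a, ('a set + 'a) list \<Rightarrow> 'a) module) \<times> _. case x of (P, d) \<Rightarrow> \<exists>e. free_resolution A ?N P d e"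
    by auto
  from someI_ex[OF this]
  have "case chosen_resolution A ?N of (P, d) \<Rightarrow> \<exists>e. free_resolution A ?N P d e"
    unfolding chosen_resolution_def .
  then have "\<exists>e. free_resolution A ?N res_obj res_diff e"
    by (simp add: res_obj_def res_diff_def split_beta)
  then show ?thesis using free_complex_free_resolution[OF quotient_module] by blast
qed

sublocale res: free_complex A res_obj res_diff by (rule res_free_complex)

text \<open>The resolution does not depend on \<open>M\<close> or on the type of its elements, so
  modules over \<open>'m\<close> and over \<open>'m set\<close> are tested with the same
  complex.\<close>

lemma M0cof_iff:
  "M \<in> M0cof A \<aa> \<longleftrightarrow> module A M \<and> (\<forall>i. finitely_generated A (hom_cohomology A res_obj res_diff M i))"
  by (simp add: M0cof_def Ext_def res_obj_def res_diff_def split_beta)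

lemma M0cof_module: "M \<in> M0cof A \<aa> \<Longrightarrow> module A M"
  by (simp add: M0cof_iff)

lemma M0cof_zero: "module A M \<Longrightarrow> carrier M = {\<zero>\<^bsub>M\<^esub>} \<Longrightarrow> M \<in> M0cof A \<aa>"
  by (simp add: M0cof_iff res.hom_cohomology_zero)

lemma M0cof_extension:
  assumes L: "L \<in> M0cof A \<aa>" and N: "N \<in> M0cof A \<aa>"
    and f: "mod_hom A L M f" and g: "mod_hom A M N g"
    and inj: "inj_on f (carrier L)" and surj: "g ` carrier M = carrier N"
    and exact: "a_kernel M N g = f ` carrier L"
  shows "M \<in> M0cof A \<aa>"
  using L N mod_hom.axioms(1)[OF g] res.hom_cohomology_extension[OF noetherian f g inj surj exact]
  by (simp add: M0cof_iff)

text \<open>An isomorphism presents \<open>N\<close> as an extension of the zero module by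
  \<open>M\<close>, so closure under extensions suffices, even when the element types
  differ.\<close>

lemma M0cof_iso:
  assumes M: "M \<in> M0cof A \<aa>" and N: "module A N" and iso: "module_iso A M N"
  shows "N \<in> M0cof A \<aa>"
proof -
  obtain f where f: "f \<in> module_hom A M N" "bij_betw f (carrier M) (carrier N)"
    using iso by (auto simp: module_iso_def)
  interpret f: mod_hom A M N f by (intro mod_homI M0cof_module M N f)
  \<comment> \<open>The zero submodule of \<open>N\<close> plays the part of the quotient.\<close>
  let ?Z = "N\<lparr>carrier := {\<zero>\<^bsub>N\<^esub>}\<rparr>"
  have Z: "module A ?Z" by (rule md_module[OF zero_submodule[OF N]])
  have "mod_hom A N ?Z (\<lambda>x. \<zero>\<^bsub>N\<^esub>)"
    by (intro mod_homI N Z module_homI) simp_all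
  then show ?thesis
    using f.f0_is_0 f(2)
    by (intro M0cof_extension[OF M M0cof_zero[OF Z] f.mod_hom_axioms])
       (auto simp: bij_betw_def a_kernel_iff)
qed

end

section \<open>Kernels, cokernels and the five lemma across element types\<close>

text \<open>The parameter \<open>universe\<close> carries no data; it makes the type
  \<open>'m\<close>, which occurs only in the assumption, a parameter of the locale.\<close>

locale abelian_cofinite = noetherian_ideal A \<aa> for A :: "('a, 'b) ring_scheme" and \<aa> +
  fixes universe :: "'m::infinite itself"
  assumes abelian: "abelian_subcategory A (M0cof A \<aa> :: ('a, 'm) module set)"
begin

lemma abelianD:
  fixes M N K :: "('a, 'm) module"
  assumes "M \<in> M0cof A \<aa>" "N \<in> M0cof A \<aa>" "f \<in> hom_set A M N" "module A K"
  shows "module_iso A (M\<lparr>carrier := a_kernel M N f\<rparr>) K \<Longrightarrow> K \<in> M0cof A \<aa>"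
    and "module_iso A (quot_module N (f ` carrier M)) K \<Longrightarrow> K \<in> M0cof A \<aa>"
proof -
  note * = bspec[OF bspec[OF bspec[OF conjunct2[OF abelian[unfolded abelian_subcategory_def]]
    assms(1)] assms(2)] assms(3)]
  show "module_iso A (M\<lparr>carrier := a_kernel M N f\<rparr>) K \<Longrightarrow> K \<in> M0cof A \<aa>"
    by (rule conjunct1[OF *, rule_format]) (simp add: assms(4))
  show "module_iso A (quot_module N (f ` carrier M)) K \<Longrightarrow> K \<in> M0cof A \<aa>"
    by (rule conjunct2[OF *, rule_format]) (simp add: assms(4))
qed

text \<open>The hypothesis on kernels and cokernels only concerns modules over the universe \<open>'m\<close>, whereas
  cohomology modules have elements of type \<open>'m set\<close>; they are small in the following sense.\<close>

definition small :: "('a, 's) module \<Rightarrow> bool" where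
  "small M \<longleftrightarrow> (\<exists>K :: ('a, 'm) module. module A K \<and> module_iso A M K)"

lemma small_iso_M0cof:
  assumes "small M" "M \<in> M0cof A \<aa>"
  obtains K :: "('a, 'm) module" and u where "K \<in> M0cof A \<aa>" "mod_hom A M K u"
    "bij_betw u (carrier M) (carrier K)"
proof -
  obtain K :: "('a, 'm) module" where K: "module A K" "module_iso A M K"
    using assms(1) by (auto simp: small_def)
  then obtain u where u: "u \<in> module_hom A M K" "bij_betw u (carrier M) (carrier K)"
    by (auto simp: module_iso_def)
  show ?thesis
    by (rule that[OF M0cof_iso[OF assms(2) K] mod_homI[OF M0cof_module[OF assms(2)] K(1) u(1)] u(2)])
qed

text \<open>Conjugating \<open>f\<close> with isomorphisms onto copies over \<open>'m\<close> gives
  a map to which the hypothesis applies. The maps \<open>u\<close> and \<open>v\<close> point back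
  to the original modules, where kernels and cokernels are compared.\<close>

lemma transport:
  assumes M: "small M" "M \<in> M0cof A \<aa>" and N: "small N" "N \<in> M0cof A \<aa>"
    and f: "mod_hom A M N f"
  obtains M' N' :: "('a, 'm) module" and u v f' where
    "M' \<in> M0cof A \<aa>" "N' \<in> M0cof A \<aa>" "f' \<in> hom_set A M' N'"
    "mod_hom A M' M u" "bij_betw u (carrier M') (carrier M)"
    "mod_hom A N' N v" "bij_betw v (carrier N') (carrier N)"
    "\<And>x. x \<in> carrier M' \<Longrightarrow> v (f' x) = f (u x)"
proof -
  obtain M' :: "('a, 'm) module" and u' where M': "M' \<in> M0cof A \<aa>" and u': "mod_hom A M M' u'"
    "bij_betw u' (carrier M) (carrier M')"
    by (rule small_iso_M0cof[OF M]) (rule that)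
  obtain N' :: "('a, 'm) module" and v' where N': "N' \<in> M0cof A \<aa>" and v': "mod_hom A N N' v'"
    "bij_betw v' (carrier N) (carrier N')"
    by (rule small_iso_M0cof[OF N]) (rule that)
  define u where "u = inv_into (carrier M) u'"
  define v where "v = inv_into (carrier N) v'"
  have u: "mod_hom A M' M u" "bij_betw u (carrier M') (carrier M)"
    unfolding u_def by (rule mod_hom_inverse[OF u'] bij_betw_inv_into[OF u'(2)])+
  have v: "mod_hom A N' N v" "bij_betw v (carrier N') (carrier N)"
    unfolding v_def by (rule mod_hom_inverse[OF v'] bij_betw_inv_into[OF v'(2)])+
  define f' where "f' = (\<lambda>x\<in>carrier M'. v' (f (u x)))"
  have "(\<lambda>x. v' (f (u x))) \<in> module_hom A M' N'"
    by (rule module_hom_comp[OF mod_hom.f_hom[OF u(1)] module_hom_comp[OF mod_hom.f_hom[OF f] mod_hom.f_hom[OF v'(1)]]])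
  then have "f' \<in> module_hom A M' N'"
    by (rule module_hom_cong[OF M0cof_module[OF M']]) (simp add: f'_def)
  then have "f' \<in> hom_set A M' N'" by (simp add: hom_set_def f'_def)
  moreover have "v (f' x) = f (u x)" if "x \<in> carrier M'" for x
  proof -
    have "f (u x) \<in> carrier N" using mod_hom.f_im[OF f mod_hom.f_im[OF u(1) that]] .
    with that v'(2) show ?thesis by (simp add: f'_def v_def bij_betw_def)
  qed
  ultimately show ?thesis by (rule that[OF M' N' _ u v])
qed

text \<open>The kernel of the transported map is isomorphic to \<open>L\<close> through
  \<open>u\<close> followed by the inverse of \<open>j\<close> on its image. The elements of
  \<open>L\<close> may be of any type.\<close>

lemma M0cof_kernel:
  assumes M: "small M" "M \<in> M0cof A \<aa>" and N: "small N" "N \<in> M0cof A \<aa>"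
    and f: "mod_hom A M N f" and j: "mod_hom A L M j" and inj: "inj_on j (carrier L)"
    and exact: "a_kernel M N f = j ` carrier L"
  shows "L \<in> M0cof A \<aa>"
proof -
  obtain M' N' :: "('a, 'm) module" and u v f' where
    M': "M' \<in> M0cof A \<aa>" and N': "N' \<in> M0cof A \<aa>" and f': "f' \<in> hom_set A M' N'"
    and u: "mod_hom A M' M u" "bij_betw u (carrier M') (carrier M)"
    and v: "mod_hom A N' N v" "bij_betw v (carrier N') (carrier N)"
    and sq: "\<And>x. x \<in> carrier M' \<Longrightarrow> v (f' x) = f (u x)"
    by (rule transport[OF M N f]) (rule that)
  interpret u: mod_hom A M' M u by fact
  interpret v: mod_hom A N' N v by fact
  interpret f: mod_hom A M N f by fact
  interpret j: mod_hom A L M j by fact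
  let ?K = "M'\<lparr>carrier := a_kernel M' N' f'\<rparr>"
  have sK: "submodule A (a_kernel M' N' f') M'"
    by (intro ker_submodule hom_set_mod_hom M0cof_module M' N' f')
  have K: "module A ?K" by (rule md_module[OF sK])
  have "module_iso A ?K ?K"
    unfolding module_iso_def by (rule bexI[of _ "\<lambda>x. x"]) (auto intro!: module_homI simp: bij_betw_def)
  then have KC: "?K \<in> M0cof A \<aa>" by (rule abelianD(1)[OF M' N' f' K])
  have v0: "v z = \<zero>\<^bsub>N\<^esub> \<longleftrightarrow> z = \<zero>\<^bsub>N'\<^esub>" if "z \<in> carrier N'" for z
    using inj_on_eq_iff[OF bij_betw_imp_inj_on[OF v(2)] that v.M.M.zero_closed] by simp
  have ker: "x \<in> a_kernel M' N' f' \<longleftrightarrow> x \<in> carrier M' \<and> u x \<in> j ` carrier L" for x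
    unfolding exact[symmetric] a_kernel_iff
    using v0[of "f' x"] sq[of x] hom_set_closed[OF f', of x] by auto
  let ?h = "\<lambda>x. inv_into (carrier L) j (u x)"
  have c: "?h x \<in> carrier L" "j (?h x) = u x" if "x \<in> a_kernel M' N' f'" for x
    using that unfolding ker by (auto intro: inv_into_into f_inv_into_f)
  have e: "inv_into (carrier L) j y = x" if "x \<in> carrier L" "j x = y" for x y
    using that inj by auto
  have kc: "x \<in> carrier M'" if "x \<in> a_kernel M' N' f'" for x using that by (simp add: ker)
  have "?h \<in> module_hom A ?K L"
    by (rule module_homI) (auto intro!: e simp: c kc)
  moreover have "bij_betw ?h (carrier ?K) (carrier L)"
  proof (rule bij_betwI')
    fix x y assume "x \<in> carrier ?K" "y \<in> carrier ?K"
    then have xy: "x \<in> a_kernel M' N' f'" "y \<in> a_kernel M' N' f'" by simp_all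
    have "x = y" if "?h x = ?h y"
    proof -
      have "u x = u y" using arg_cong[OF that, of j] unfolding c(2)[OF xy(1)] c(2)[OF xy(2)] .
      then show ?thesis
        using inj_on_eq_iff[OF bij_betw_imp_inj_on[OF u(2)] kc[OF xy(1)] kc[OF xy(2)]] by simp
    qed
    then show "(?h x = ?h y) = (x = y)" by auto
  next
    fix l assume l: "l \<in> carrier L"
    then have "j l \<in> u ` carrier M'" using bij_betw_imp_surj_on[OF u(2)] j.f_im by simp
    then obtain x where x: "x \<in> carrier M'" "j l = u x" by blast
    have "x \<in> a_kernel M' N' f'" using x l unfolding ker by (auto simp flip: x(2))
    moreover have "?h x = l" using x l by (intro e) auto
    ultimately show "\<exists>x\<in>carrier ?K. l = ?h x" by auto
  qed (use c in auto)
  ultimately have "module_iso A ?K L" by (auto simp: module_iso_def)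
  then show ?thesis by (rule M0cof_iso[OF KC j.M.module_axioms])
qed

text \<open>The composite of \<open>v\<close> and \<open>p\<close> has the image of the transported
  map as its kernel, so the first isomorphism theorem identifies the cokernel with \<open>Q\<close>.
  The cokernel itself is reached through a copy \<open>K\<close> over \<open>'m\<close>.\<close>

lemma M0cof_cokernel:
  assumes M: "small M" "M \<in> M0cof A \<aa>" and N: "small N" "N \<in> M0cof A \<aa>"
    and f: "mod_hom A M N f" and p: "mod_hom A N Q p" and surj: "p ` carrier N = carrier Q"
    and exact: "a_kernel N Q p = f ` carrier M"
  shows "Q \<in> M0cof A \<aa>"
proof -
  obtain M' N' :: "('a, 'm) module" and u v f' where
    M': "M' \<in> M0cof A \<aa>" and N': "N' \<in> M0cof A \<aa>" and f': "f' \<in> hom_set A M' N'"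
    and u: "mod_hom A M' M u" "bij_betw u (carrier M') (carrier M)"
    and v: "mod_hom A N' N v" "bij_betw v (carrier N') (carrier N)"
    and sq: "\<And>x. x \<in> carrier M' \<Longrightarrow> v (f' x) = f (u x)"
    by (rule transport[OF M N f]) (rule that)
  interpret u: mod_hom A M' M u by fact
  interpret v: mod_hom A N' N v by fact
  interpret f': mod_hom A M' N' f' by (intro hom_set_mod_hom u.M.module_axioms v.M.module_axioms f')
  interpret p: mod_hom A N Q p by fact
  let ?B = "f' ` carrier M'"
  have B: "submodule A ?B N'" by (rule im_submodule[OF f'.mod_hom_axioms])
  obtain K :: "('a, 'm) module" where K: "module A K" "module_iso A (quot_module N' ?B) K"
    using quot_module_representatives[OF B] by blast
  have "K \<in> M0cof A \<aa>" by (rule abelianD(2)[OF M' N' f' K])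
  then have qC: "quot_module N' ?B \<in> M0cof A \<aa>"
    by (rule M0cof_iso[OF _ quot_module_module[OF B] module_iso_sym[OF quot_module_module[OF B] K]])
  have "mod_hom A N' Q (\<lambda>x. p (v x))"
    by (intro mod_homI v.M.module_axioms p.N.module_axioms module_hom_comp[OF v.f_hom p.f_hom])
  moreover have "(\<lambda>x. p (v x)) ` carrier N' = carrier Q"
    using v(2) surj by (metis bij_betw_imp_surj_on image_image)
  moreover have "a_kernel N' Q (\<lambda>x. p (v x)) = ?B"
  proof -
    have "p (v x) = \<zero>\<^bsub>Q\<^esub> \<longleftrightarrow> x \<in> ?B" if x: "x \<in> carrier N'" for x
    proof -
      have "p (v x) = \<zero>\<^bsub>Q\<^esub> \<longleftrightarrow> v x \<in> a_kernel N Q p" using x by (simp add: a_kernel_iff)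
      also have "a_kernel N Q p = (\<lambda>y. f (u y)) ` carrier M'"
        by (simp add: exact bij_betw_imp_surj_on[OF u(2)] flip: image_image[of f u])
      also have "(\<lambda>y. f (u y)) ` carrier M' = (\<lambda>y. v (f' y)) ` carrier M'"
        by (rule image_cong) (simp_all add: sq)
      also have "v x \<in> (\<lambda>y. v (f' y)) ` carrier M' \<longleftrightarrow> x \<in> ?B"
        using inj_on_eq_iff[OF bij_betw_imp_inj_on[OF v(2)] x f'.f_im] by (auto simp: image_iff)
      finally show ?thesis .
    qed
    then show ?thesis using f'.f_im by (auto simp: a_kernel_iff)
  qed
  ultimately have "module_iso A (quot_module N' ?B) Q"
    using first_isomorphism[of A N' Q "\<lambda>x. p (v x)"] by simp
  then show ?thesis by (rule M0cof_iso[OF qC p.N.module_axioms])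
qed

lemma M0cof_five:
  assumes M1: "small M1" "M1 \<in> M0cof A \<aa>" and M2: "small M2" "M2 \<in> M0cof A \<aa>"
    and M4: "small M4" "M4 \<in> M0cof A \<aa>" and M5: "small M5" "M5 \<in> M0cof A \<aa>"
    and f1: "mod_hom A M1 M2 f1" and f2: "mod_hom A M2 M3 f2"
    and f3: "mod_hom A M3 M4 f3" and f4: "mod_hom A M4 M5 f4"
    and ex2: "a_kernel M2 M3 f2 = f1 ` carrier M1"
    and ex3: "a_kernel M3 M4 f3 = f2 ` carrier M2"
    and ex4: "a_kernel M4 M5 f4 = f3 ` carrier M3"
  shows "M3 \<in> M0cof A \<aa>"
proof -
  \<comment> \<open>By exactness at \<open>M2\<close> the image of \<open>f2\<close> is a cokernel
    of \<open>f1\<close>; by exactness at \<open>M4\<close> the image of \<open>f3\<close> is a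
    kernel of \<open>f4\<close>.\<close>
  let ?I = "M3\<lparr>carrier := f2 ` carrier M2\<rparr>" and ?K = "M4\<lparr>carrier := f3 ` carrier M3\<rparr>"
  have I: "submodule A (f2 ` carrier M2) M3" by (rule im_submodule[OF f2])
  have K: "submodule A (f3 ` carrier M3) M4" by (rule im_submodule[OF f3])
  have id: "mod_hom A (M\<lparr>carrier := S\<rparr>) M (\<lambda>x. x)" if "submodule A S M" for M :: "('a, 'x) module" and S
    using submodule.subset[OF that] submodule.module[OF that]
    by (intro mod_homI md_module that module_homI) auto
  have "?I \<in> M0cof A \<aa>"
    using ex2 by (intro M0cof_cokernel[OF M1 M2 f1 mod_hom_md_cod[OF f2 I]]) (auto simp: a_kernel_iff)
  moreover have "?K \<in> M0cof A \<aa>"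
    using ex4 by (intro M0cof_kernel[OF M4 M5 f4 id[OF K]]) auto
  ultimately show ?thesis
    using ex3 by (intro M0cof_extension[OF _ _ id[OF I] mod_hom_md_cod[OF f3 K]]) (auto simp: a_kernel_iff)
qed

end

section \<open>Cohomology as a functor on the derived category\<close>

text \<open>Cosets are formed with addition alone, so they do not change when the carrier is
  restricted.\<close>

lemma quot_map_md [simp]: "quot_map (N\<lparr>carrier := Z\<rparr>) C f = quot_map N C f"
  by (simp add: quot_map_def a_r_coset_def r_coset_def fun_eq_iff)

lemma coset_md [simp]: "B +>\<^bsub>N\<lparr>carrier := Z\<rparr>\<^esub> x = B +>\<^bsub>N\<^esub> x"
  by (simp add: a_r_coset_def r_coset_def)

lemma cohomology_map_alt: "cohomology_map Y f n = quot_map (obj Y n) (coboundaries Y n) (f n)"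
  by (simp add: cohomology_map_def quot_map_def fun_eq_iff)

section \<open>Subquotients Z/B, the common form of all cohomology modules\<close>

definition subquotient :: "('a, 'b) ring_scheme \<Rightarrow> ('a, 'm) module \<Rightarrow> 'm set \<Rightarrow> 'm set \<Rightarrow> bool" where
  "subquotient R M Z B \<longleftrightarrow> submodule R Z M \<and> submodule R B M \<and> B \<subseteq> Z"

definition subquotient_hom ::
  "('a, 'b) ring_scheme \<Rightarrow> ('a, 'm) module \<Rightarrow> 'm set \<Rightarrow> 'm set \<Rightarrow> ('a, 'n) module \<Rightarrow> 'n set \<Rightarrow> 'n set \<Rightarrow> ('m \<Rightarrow> 'n) \<Rightarrow> bool" where
  "subquotient_hom R M Z B N Z' B' f \<longleftrightarrow> subquotient R M Z B \<and> subquotient R N Z' B' \<and>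
    mod_hom R M N f \<and> f ` Z \<subseteq> Z' \<and> f ` B \<subseteq> B'"

lemma subquotientD:
  assumes "subquotient R M Z B"
  shows "submodule R Z M" "submodule R B M" "B \<subseteq> Z" "submodule R B (M\<lparr>carrier := Z\<rparr>)"
  using assms by (auto simp: subquotient_def intro: submodule_md)

lemma subquotient_module: "subquotient R M Z B \<Longrightarrow> module R (quot_module (M\<lparr>carrier := Z\<rparr>) B)"
  by (rule quot_module_module[OF subquotientD(4)])

lemma subquotient_homD:
  assumes "subquotient_hom R M Z B N Z' B' f"
  shows "f \<in> module_hom R (M\<lparr>carrier := Z\<rparr>) (N\<lparr>carrier := Z'\<rparr>)" "f ` B \<subseteq> B'"
    "submodule R B (M\<lparr>carrier := Z\<rparr>)" "submodule R B' (N\<lparr>carrier := Z'\<rparr>)"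
proof -
  show "f \<in> module_hom R (M\<lparr>carrier := Z\<rparr>) (N\<lparr>carrier := Z'\<rparr>)"
    using assms by (intro mod_hom.f_hom mod_hom_md) (auto simp: subquotient_hom_def subquotient_def)
qed (use assms in \<open>auto simp: subquotient_hom_def dest: subquotientD\<close>)

lemma subquotient_map_hom:
  assumes "subquotient_hom R M Z B N Z' B' f"
  shows "mod_hom R (quot_module (M\<lparr>carrier := Z\<rparr>) B) (quot_module (N\<lparr>carrier := Z'\<rparr>) B') (quot_map N B' f)"
  using quot_map_hom[OF subquotient_homD(3,4,1,2)[OF assms]] subquotient_homD(3,4)[OF assms]
  by (intro mod_homI quot_module_module) simp_all

lemma subquotient_map_coset:
  assumes "subquotient_hom R M Z B N Z' B' f" "x \<in> Z"
  shows "quot_map N B' f (B +>\<^bsub>M\<^esub> x) = B' +>\<^bsub>N\<^esub> f x"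
  using quot_map_coset[OF subquotient_homD(3,4,1,2)[OF assms(1)], of x] assms(2) by simp

lemma subquotient_carrier: "carrier (quot_module (M\<lparr>carrier := Z\<rparr>) B) = (\<lambda>x. B +>\<^bsub>M\<^esub> x) ` Z"
  by (simp add: carrier_quot_module)

lemma subquotient_coset_eq:
  assumes "subquotient R M Z B" "x \<in> Z" "y \<in> Z"
  shows "B +>\<^bsub>M\<^esub> x = B +>\<^bsub>M\<^esub> y \<longleftrightarrow> x \<ominus>\<^bsub>M\<^esub> y \<in> B"
proof -
  have "Z \<subseteq> carrier M" using submodule.subset[OF subquotientD(1)[OF assms(1)]] .
  with assms(2,3) show ?thesis by (intro coset_eq_iff[OF subquotientD(2)[OF assms(1)]]) auto
qed

text \<open>The lifting condition is an additive equation in \<open>M2\<close>, which is easier to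
  supply for concrete pairs than a difference; the proof turns it into a difference in the
  restricted module.\<close>

lemma subquotient_exact:
  assumes f: "subquotient_hom R M1 Z1 B1 M2 Z2 B2 f" and g: "subquotient_hom R M2 Z2 B2 M3 Z3 B3 g"
    and 0: "\<And>x. x \<in> Z1 \<Longrightarrow> g (f x) \<in> B3"
    and ex: "\<And>y. y \<in> Z2 \<Longrightarrow> g y \<in> B3 \<Longrightarrow> \<exists>x\<in>Z1. \<exists>b\<in>B2. y = f x \<oplus>\<^bsub>M2\<^esub> b"
  shows "a_kernel (quot_module (M2\<lparr>carrier := Z2\<rparr>) B2) (quot_module (M3\<lparr>carrier := Z3\<rparr>) B3) (quot_map M3 B3 g) =
    quot_map M2 B2 f ` carrier (quot_module (M1\<lparr>carrier := Z1\<rparr>) B1)"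
proof -
  have sq: "subquotient R M2 Z2 B2" using f by (simp add: subquotient_hom_def)
  note Z2 = subquotientD(1)[OF sq]
  interpret M2: module R M2 by (rule submodule.module[OF Z2])
  have ex': "\<exists>x\<in>Z1. y \<ominus>\<^bsub>M2\<lparr>carrier := Z2\<rparr>\<^esub> f x \<in> B2" if y: "y \<in> Z2" "g y \<in> B3" for y
  proof -
    obtain x b where xb: "x \<in> Z1" "b \<in> B2" "y = f x \<oplus>\<^bsub>M2\<^esub> b" using ex[OF y] by blast
    have c: "f x \<in> Z2" using f xb(1) by (auto simp: subquotient_hom_def)
    have "f x \<in> carrier M2" "b \<in> carrier M2"
      using c xb(2) submodule.subset[OF Z2] subquotientD(3)[OF sq] by auto
    then have "y \<ominus>\<^bsub>M2\<^esub> f x = b"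
      by (simp add: xb(3) a_minus_def M2.M.a_ac M2.M.r_neg)
    then show ?thesis using xb md_minus[OF Z2 y(1) c] by (intro bexI[of _ x]) simp_all
  qed
  show ?thesis
    using quot_map_exact[OF subquotient_homD(3)[OF f] subquotient_homD(4)[OF f] subquotient_homD(4)[OF g]
        subquotient_homD(1,2)[OF f] subquotient_homD(1,2)[OF g]] 0 ex' by simp
qed

lemma subquotient_map_inj:
  assumes f: "subquotient_hom R M Z B N Z' B' f" and inj: "\<And>x. x \<in> Z \<Longrightarrow> f x \<in> B' \<Longrightarrow> x \<in> B"
  shows "inj_on (quot_map N B' f) (carrier (quot_module (M\<lparr>carrier := Z\<rparr>) B))"
proof (rule inj_onI)
  fix X Y assume "X \<in> carrier (quot_module (M\<lparr>carrier := Z\<rparr>) B)" "Y \<in> carrier (quot_module (M\<lparr>carrier := Z\<rparr>) B)"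
    and eq: "quot_map N B' f X = quot_map N B' f Y"
  then obtain x y where xy: "x \<in> Z" "X = B +>\<^bsub>M\<^esub> x" "y \<in> Z" "Y = B +>\<^bsub>M\<^esub> y"
    by (auto simp: subquotient_carrier)
  have sq: "subquotient R M Z B" "subquotient R N Z' B'" and hom: "mod_hom R M N f"
    and fZ: "f x \<in> Z'" "f y \<in> Z'"
    using f xy by (auto simp: subquotient_hom_def)
  have c: "x \<in> carrier M" "y \<in> carrier M" using xy submodule.subset[OF subquotientD(1)[OF sq(1)]] by auto
  have "f x \<ominus>\<^bsub>N\<^esub> f y \<in> B'"
    using eq xy by (simp add: subquotient_map_coset[OF f] subquotient_coset_eq[OF sq(2) fZ])
  then have "f (x \<ominus>\<^bsub>M\<^esub> y) \<in> B'" using mod_hom.f_minus[OF hom c] by simp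
  then have "x \<ominus>\<^bsub>M\<^esub> y \<in> B"
    by (intro inj submodule_minus_closed[OF subquotientD(1)[OF sq(1)]] xy)
  then show "X = Y" using xy by (simp add: subquotient_coset_eq[OF sq(1)])
qed

lemma subquotient_iso:
  assumes sq: "subquotient R M Z B" and p: "mod_hom R (M\<lparr>carrier := Z\<rparr>) Q p"
    and surj: "p ` Z = carrier Q" and ker: "\<And>x. x \<in> Z \<Longrightarrow> p x = \<zero>\<^bsub>Q\<^esub> \<longleftrightarrow> x \<in> B"
  shows "module_iso R (quot_module (M\<lparr>carrier := Z\<rparr>) B) Q"
proof -
  have "a_kernel (M\<lparr>carrier := Z\<rparr>) Q p = B"
    using ker subquotientD(3)[OF sq] by (auto simp: a_kernel_iff)
  then show ?thesis using first_isomorphism[OF p] surj by simp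
qed

section \<open>Cohomology of complexes and of cochain maps\<close>

lemma complex_module: "is_complex R X \<Longrightarrow> module R (obj X n)"
  by (simp add: is_complex_def)

lemma complex_diff: "is_complex R X \<Longrightarrow> mod_hom R (obj X n) (obj X (n + 1)) (diff X n)"
  by (intro mod_homI) (simp_all add: is_complex_def)

lemma complex_diff': "is_complex R X \<Longrightarrow> mod_hom R (obj X (n - 1)) (obj X n) (diff X (n - 1))"
  using complex_diff[of R X "n - 1"] by simp

lemma cocycles_iff: "x \<in> cocycles X n \<longleftrightarrow> x \<in> carrier (obj X n) \<and> diff X n x = \<zero>\<^bsub>obj X (n + 1)\<^esub>"
  by (simp add: cocycles_def a_kernel_iff)

lemma complex_subquotient:
  assumes X: "is_complex R X"
  shows "subquotient R (obj X n) (cocycles X n) (coboundaries X n)"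
proof -
  \<comment> \<open>The identity d d = 0 is taken at \<open>n - 1\<close> with degrees left
    unsimplified, so that it matches \<open>is_complex\<close> literally.\<close>
  have "diff X (n - 1 + 1) (diff X (n - 1) x) = \<zero>\<^bsub>obj X (n - 1 + 1 + 1)\<^esub>"
    if "x \<in> carrier (obj X (n - 1))" for x
    using X that unfolding is_complex_def by blast
  then have "coboundaries X n \<subseteq> cocycles X n"
    using mod_hom.f_im[OF complex_diff'[OF X]] by (auto simp: cocycles_iff coboundaries_def)
  moreover have "submodule R (cocycles X n) (obj X n)"
    unfolding cocycles_def by (rule ker_submodule[OF complex_diff[OF X]])
  moreover have "submodule R (coboundaries X n) (obj X n)"
    unfolding coboundaries_def by (rule im_submodule[OF complex_diff'[OF X]])
  ultimately show ?thesis by (simp add: subquotient_def)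
qed

lemma cohomology_module: "is_complex R X \<Longrightarrow> module R (cohomology X n)"
  unfolding cohomology_def by (rule subquotient_module[OF complex_subquotient])

lemma cochain_map_complex: "cochain_map R X Y f \<Longrightarrow> is_complex R X" "cochain_map R X Y f \<Longrightarrow> is_complex R Y"
  by (simp_all add: cochain_map_def)

lemma cochain_map_mod_hom: "cochain_map R X Y f \<Longrightarrow> mod_hom R (obj X n) (obj Y n) (f n)"
  by (intro mod_homI complex_module) (simp_all add: cochain_map_def hom_set_def)

lemma cochain_map_commute:
  "cochain_map R X Y f \<Longrightarrow> x \<in> carrier (obj X n) \<Longrightarrow> diff Y n (f n x) = f (n + 1) (diff X n x)"
  by (simp add: cochain_map_def)

lemma cochain_map_subquotient:
  assumes f: "cochain_map R X Y f"
  shows "subquotient_hom R (obj X n) (cocycles X n) (coboundaries X n)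
    (obj Y n) (cocycles Y n) (coboundaries Y n) (f n)"
proof -
  note X = cochain_map_complex(1)[OF f] and Y = cochain_map_complex(2)[OF f]
  note fc = mod_hom.f_im[OF cochain_map_mod_hom[OF f]] and f0 = mod_hom.f0_is_0[OF cochain_map_mod_hom[OF f]]
  have "f n ` cocycles X n \<subseteq> cocycles Y n"
    using fc f0 by (auto simp: cocycles_iff cochain_map_commute[OF f])
  moreover have "f n (diff X (n - 1) x) \<in> coboundaries Y n" if "x \<in> carrier (obj X (n - 1))" for x
    using cochain_map_commute[OF f that] fc[OF that]
    unfolding coboundaries_def by (intro image_eqI[of _ _ "f (n - 1) x"]) simp_all
  ultimately show ?thesis
    using complex_subquotient[OF X] complex_subquotient[OF Y] cochain_map_mod_hom[OF f]
    by (auto simp: subquotient_hom_def coboundaries_def)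
qed

lemma cohomology_map_hom:
  "cochain_map R X Y f \<Longrightarrow> mod_hom R (cohomology X n) (cohomology Y n) (cohomology_map Y f n)"
  unfolding cohomology_def cohomology_map_alt by (rule subquotient_map_hom[OF cochain_map_subquotient])

lemma carrier_cohomology:
  "carrier (cohomology X n) = (\<lambda>x. coboundaries X n +>\<^bsub>obj X n\<^esub> x) ` cocycles X n"
  by (simp add: cohomology_def subquotient_carrier)

lemma cohomology_map_coset:
  assumes "cochain_map R X Y f" "x \<in> cocycles X n"
  shows "cohomology_map Y f n (coboundaries X n +>\<^bsub>obj X n\<^esub> x) = coboundaries Y n +>\<^bsub>obj Y n\<^esub> f n x"
  using subquotient_map_coset[OF cochain_map_subquotient[OF assms(1)] assms(2)]
  by (simp add: cohomology_map_alt)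

lemma cochain_map_cocycles:
  "cochain_map R X Y f \<Longrightarrow> x \<in> cocycles X n \<Longrightarrow> f n x \<in> cocycles Y n"
  using cochain_map_subquotient[of R X Y f n] by (auto simp: subquotient_hom_def)

lemma id_map_cochain:
  assumes X: "is_complex R X" shows "cochain_map R X X (id_map X)"
proof -
  have "id_map X n \<in> hom_set R (obj X n) (obj X n)" for n
    unfolding id_map_def by (rule hom_set_restrict[OF complex_module[OF X]]) simp_all
  then show ?thesis
    using X mod_hom.f_im[OF complex_diff[OF X]] by (simp add: cochain_map_def id_map_def)
qed

lemma comp_map_cochain:
  assumes f: "cochain_map R X Y f" and g: "cochain_map R Y Z g"
  shows "cochain_map R X Z (comp_map X g f)"
proof -
  note X = cochain_map_complex(1)[OF f]
  have "comp_map X g f n \<in> hom_set R (obj X n) (obj Z n)" for n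
  proof -
    interpret f: mod_hom R "obj X n" "obj Y n" "f n" by (rule cochain_map_mod_hom[OF f])
    interpret g: mod_hom R "obj Y n" "obj Z n" "g n" by (rule cochain_map_mod_hom[OF g])
    show ?thesis unfolding comp_map_def compose_def by (rule hom_set_restrict[OF complex_module[OF X]]) simp_all
  qed
  moreover note mod_hom.f_im[OF complex_diff[OF X]] mod_hom.f_im[OF cochain_map_mod_hom[OF f]]
  ultimately show ?thesis
    using X cochain_map_complex(2)[OF g]
    by (simp add: cochain_map_def comp_map_def compose_def cochain_map_commute[OF f] cochain_map_commute[OF g])
qed

lemma cohomology_map_id:
  assumes X: "is_complex R X" and c: "c \<in> carrier (cohomology X n)"
  shows "cohomology_map X (id_map X) n c = c"
proof -
  obtain x where x: "x \<in> cocycles X n" "c = coboundaries X n +>\<^bsub>obj X n\<^esub> x"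
    using c by (auto simp: carrier_cohomology)
  have "x \<in> carrier (obj X n)" using x(1) by (simp add: cocycles_iff)
  with x show ?thesis by (simp add: cohomology_map_coset[OF id_map_cochain[OF X]] id_map_def)
qed

lemma cohomology_map_comp:
  assumes f: "cochain_map R X Y f" and g: "cochain_map R Y Z g" and c: "c \<in> carrier (cohomology X n)"
  shows "cohomology_map Z (comp_map X g f) n c = cohomology_map Z g n (cohomology_map Y f n c)"
proof -
  obtain x where x: "x \<in> cocycles X n" "c = coboundaries X n +>\<^bsub>obj X n\<^esub> x"
    using c by (auto simp: carrier_cohomology)
  have "x \<in> carrier (obj X n)" using x(1) by (simp add: cocycles_iff)
  with x cochain_map_cocycles[OF f x(1)] show ?thesis
    by (simp add: cohomology_map_coset[OF comp_map_cochain[OF f g]] cohomology_map_coset[OF f]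
        cohomology_map_coset[OF g] comp_map_def compose_def)
qed

section \<open>Evaluating cohomology on formal morphisms of D(A)\<close>

primrec dcohomology :: "('a, 'm) dterm \<Rightarrow> int \<Rightarrow> 'm set \<Rightarrow> 'm set" where
  "dcohomology (Fwd X Y f) n = cohomology_map Y f n"
| "dcohomology (Bwd X Y s) n = inv_into (carrier (cohomology X n)) (cohomology_map Y s n)"
| "dcohomology (Cmp u t) n = (\<lambda>c. dcohomology u n (dcohomology t n c))"

lemma dmor_cohomology:
  "dmor R X Y t \<Longrightarrow> is_complex R X \<and> is_complex R Y \<and>
    mod_hom R (cohomology X n) (cohomology Y n) (dcohomology t n)"
proof (induction rule: dmor.induct)
  case (Fwd X Y f)
  from cochain_map_complex[OF Fwd] cohomology_map_hom[OF Fwd] show ?case by simp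
next
  case (Bwd X Y s)
  then have s: "cochain_map R X Y s"
    and bij: "bij_betw (cohomology_map Y s n) (carrier (cohomology X n)) (carrier (cohomology Y n))"
    by (simp_all add: quasi_iso_def)
  from cochain_map_complex[OF s] mod_hom_inverse[OF cohomology_map_hom[OF s] bij] show ?case by simp
next
  case (Cmp X Y t Z u)
  from Cmp.IH have t: "mod_hom R (cohomology X n) (cohomology Y n) (dcohomology t n)"
    and u: "mod_hom R (cohomology Y n) (cohomology Z n) (dcohomology u n)" by simp_all
  from Cmp.IH mod_homI[OF mod_hom.axioms(1)[OF t] mod_hom.axioms(2)[OF u]
      module_hom_comp[OF mod_hom.f_hom[OF t] mod_hom.f_hom[OF u]]]
  show ?case by simp
qed

lemma dmor_did: "is_complex R X \<Longrightarrow> dmor R X X (did X)"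
  by (intro dmor.Fwd id_map_cochain)

text \<open>Each generating relation holds for the maps on cohomology. Both terms are shown at the
  same time to be morphisms with the stated endpoints: for congruence one needs that the first map
  lands in the module on which the second maps agree.\<close>

lemma deq_cohomology:
  "deq R X Y t u \<Longrightarrow> dmor R X Y t \<and> dmor R X Y u \<and>
    (\<forall>c\<in>carrier (cohomology X n). dcohomology t n c = dcohomology u n c)"
proof (induction rule: deq.induct)
  case (cong X Y t t' Z u u')
  then have "dcohomology t n c \<in> carrier (cohomology Y n)" if "c \<in> carrier (cohomology X n)" for c
    using dmor_cohomology[of R X Y t n] mod_hom.f_im[OF _ that] by blast
  with cong show ?case by (auto intro: dmor.Cmp)
next
  case (id_right X Y t)
  then show ?case
    using dmor_cohomology[of R X Y t n] dmor_did[of R X] by (auto simp: cohomology_map_id intro: dmor.Cmp)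
next
  case (id_left X Y t)
  then have "dcohomology t n c \<in> carrier (cohomology Y n)" if "c \<in> carrier (cohomology X n)" for c
    using dmor_cohomology[of R X Y t n] mod_hom.f_im[OF _ that] by blast
  with id_left show ?case
    using dmor_cohomology[of R X Y t n] dmor_did[of R Y] by (auto simp: cohomology_map_id intro: dmor.Cmp)
next
  case (comp X Y f Z g)
  then show ?case
    using comp_map_cochain[of R X Y f Z g] by (auto simp: cohomology_map_comp intro: dmor.intros)
next
  case (inv_left X Y s)
  then have "is_complex R X" by (auto simp: quasi_iso_def dest: cochain_map_complex)
  moreover have "inj_on (cohomology_map Y s n) (carrier (cohomology X n))"
    using inv_left by (auto simp: quasi_iso_def bij_betw_def)
  moreover have "dmor R X X (Cmp (Bwd X Y s) (Fwd X Y s))"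
    using inv_left by (auto simp: quasi_iso_def intro!: dmor.intros)
  ultimately show ?case using dmor_did[of R X] by (simp add: cohomology_map_id)
next
  case (inv_right X Y s)
  then have "is_complex R Y" by (auto simp: quasi_iso_def dest: cochain_map_complex)
  moreover have "bij_betw (cohomology_map Y s n) (carrier (cohomology X n)) (carrier (cohomology Y n))"
    using inv_right by (auto simp: quasi_iso_def)
  moreover have "dmor R Y Y (Cmp (Fwd X Y s) (Bwd X Y s))"
    using inv_right by (auto simp: quasi_iso_def intro!: dmor.intros)
  ultimately show ?case using dmor_did[of R Y] by (simp add: cohomology_map_id bij_betw_inv_into_right)
qed (auto intro: dmor.Cmp)

text \<open>An inverse in D(A) evaluates to a two-sided inverse on cohomology, because related terms
  have equal values there.\<close>

lemma diso_cohomology: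
  assumes "diso R X Y t"
  shows "is_complex R X" "is_complex R Y" "module_iso R (cohomology X n) (cohomology Y n)"
proof -
  obtain u where t: "dmor R X Y t" and u: "dmor R Y X u"
    and ut: "deq R X X (Cmp u t) (did X)" and tu: "deq R Y Y (Cmp t u) (did Y)"
    using assms by (auto simp: diso_def)
  show X: "is_complex R X" and Y: "is_complex R Y" using dmor_cohomology[OF t] by auto
  have ht: "mod_hom R (cohomology X n) (cohomology Y n) (dcohomology t n)"
    and hu: "mod_hom R (cohomology Y n) (cohomology X n) (dcohomology u n)"
    using dmor_cohomology[OF t] dmor_cohomology[OF u] by auto
  have "bij_betw (dcohomology t n) (carrier (cohomology X n)) (carrier (cohomology Y n))"
  proof (rule bij_betw_byWitness[where f' = "dcohomology u n"])
    show "\<forall>c\<in>carrier (cohomology X n). dcohomology u n (dcohomology t n c) = c"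
      using deq_cohomology[OF ut, of n] by (simp add: cohomology_map_id[OF X])
    show "\<forall>c\<in>carrier (cohomology Y n). dcohomology t n (dcohomology u n c) = c"
      using deq_cohomology[OF tu, of n] by (simp add: cohomology_map_id[OF Y])
  qed (use mod_hom.f_im[OF ht] mod_hom.f_im[OF hu] in auto)
  then show "module_iso R (cohomology X n) (cohomology Y n)"
    using mod_hom.f_hom[OF ht] by (auto simp: module_iso_def)
qed

lemma diso_sym:
  "diso R X Y t \<Longrightarrow> \<exists>u. diso R Y X u"
  by (auto simp: diso_def)

lemma (in noetherian_ideal) D0cof_diso:
  assumes "diso A X Y t" "X \<in> D0cof A \<aa>"
  shows "Y \<in> D0cof A \<aa>"
  using assms(2) M0cof_iso[OF _ cohomology_module diso_cohomology(3)[OF assms(1)]] diso_cohomology(2)[OF assms(1)]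
  by (auto simp: D0cof_def)

lemma (in noetherian_ideal) D0cof_diso':
  assumes "diso A X Y t" "Y \<in> D0cof A \<aa>"
  shows "X \<in> D0cof A \<aa>"
  using diso_sym[OF assms(1)] D0cof_diso[OF _ assms(2)] by blast

section \<open>Shifts, cones and direct sums of complexes\<close>

text \<open>Without this, \<open>n + 1 + 1\<close> is rewritten and no longer matches the degrees in the definitions.\<close>

declare [[simproc del: int_combine_numerals]]

abbreviation pair_module :: "('a, 'm::infinite) module \<Rightarrow> ('a, 'm) module \<Rightarrow> ('a, 'm) module" where
  "pair_module M N \<equiv> relabel_module upair (direct_sum M N)"

lemma upair_eq [simp]: "upair p = upair q \<longleftrightarrow> p = q"
  using inj_upair by (auto dest: injD)

lemma inv_upair: "p \<in> S \<Longrightarrow> inv_into S upair (upair p) = p"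
  by (rule inv_into_f_f) (auto simp: inj_on_def)

lemma inj_on_upair: "inj_on upair S"
  by (auto simp: inj_on_def)

lemma carrier_pair_module: "carrier (pair_module M N) = upair ` (carrier M \<times> carrier N)"
  by (simp add: carrier_relabel_module direct_sum_def)

lemma upair_in_pair_module [simp]:
  "upair (x, y) \<in> carrier (pair_module M N) \<longleftrightarrow> x \<in> carrier M \<and> y \<in> carrier N"
  by (auto simp: carrier_pair_module)

lemma pair_module_zero [simp]: "\<zero>\<^bsub>pair_module M N\<^esub> = upair (\<zero>\<^bsub>M\<^esub>, \<zero>\<^bsub>N\<^esub>)"
  by (simp add: relabel_module_def direct_sum_def Let_def)

lemma pair_module_add [simp]:
  "x \<in> carrier M \<Longrightarrow> y \<in> carrier N \<Longrightarrow> x' \<in> carrier M \<Longrightarrow> y' \<in> carrier N \<Longrightarrow>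
    upair (x, y) \<oplus>\<^bsub>pair_module M N\<^esub> upair (x', y') = upair (x \<oplus>\<^bsub>M\<^esub> x', y \<oplus>\<^bsub>N\<^esub> y')"
  by (simp add: relabel_module_def direct_sum_def Let_def inv_upair)

lemma pair_module_smult [simp]:
  "x \<in> carrier M \<Longrightarrow> y \<in> carrier N \<Longrightarrow>
    r \<odot>\<^bsub>pair_module M N\<^esub> upair (x, y) = upair (r \<odot>\<^bsub>M\<^esub> x, r \<odot>\<^bsub>N\<^esub> y)"
  by (simp add: relabel_module_def direct_sum_def Let_def inv_upair)

lemma pair_module_module: "module R M \<Longrightarrow> module R N \<Longrightarrow> module R (pair_module M N)"
  by (intro relabel_module_module direct_sum_is_module inj_on_upair)

lemma pair_moduleE:
  assumes "z \<in> carrier (pair_module M N)"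
  obtains x y where "z = upair (x, y)" "x \<in> carrier M" "y \<in> carrier N"
  using assms by (auto simp: carrier_pair_module)

lemma neg_eq_zero_iff:
  assumes "module R M" "x \<in> carrier M"
  shows "\<ominus>\<^bsub>M\<^esub> x = \<zero>\<^bsub>M\<^esub> \<longleftrightarrow> x = \<zero>\<^bsub>M\<^esub>"
proof -
  interpret module R M by fact
  show ?thesis using assms(2) M.r_neg[of x] M.r_neg[of "\<zero>\<^bsub>M\<^esub>"] by auto
qed

lemma (in module) neg_zero [simp]: "\<ominus>\<^bsub>M\<^esub> \<zero>\<^bsub>M\<^esub> = \<zero>\<^bsub>M\<^esub>"
  using M.r_neg[of "\<zero>\<^bsub>M\<^esub>"] by simp

lemma shift_complex:
  assumes X: "is_complex R X" shows "is_complex R (shift X)"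
proof -
  have "(\<lambda>x. \<ominus>\<^bsub>obj X (n + 1 + 1)\<^esub> diff X (n + 1) x) \<in> module_hom R (obj X (n + 1)) (obj X (n + 1 + 1))" for n
  proof -
    interpret d: mod_hom R "obj X (n + 1)" "obj X (n + 1 + 1)" "diff X (n + 1)" by (rule complex_diff[OF X])
    show ?thesis by (rule module_homI) (simp_all add: d.N.M.minus_add d.N.smult_r_minus)
  qed
  moreover have "\<ominus>\<^bsub>obj X (n + 1 + 1 + 1)\<^esub> diff X (n + 1 + 1) (\<ominus>\<^bsub>obj X (n + 1 + 1)\<^esub> diff X (n + 1) x) = \<zero>\<^bsub>obj X (n + 1 + 1 + 1)\<^esub>"
    if "x \<in> carrier (obj X (n + 1))" for n x
  proof -
    interpret d: mod_hom R "obj X (n + 1)" "obj X (n + 1 + 1)" "diff X (n + 1)" by (rule complex_diff[OF X])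
    interpret e: mod_hom R "obj X (n + 1 + 1)" "obj X (n + 1 + 1 + 1)" "diff X (n + 1 + 1)" by (rule complex_diff[OF X])
    have "diff X (n + 1 + 1) (diff X (n + 1) x) = \<zero>\<^bsub>obj X (n + 1 + 1 + 1)\<^esub>"
      using X that unfolding is_complex_def by blast
    then show ?thesis using that by simp
  qed
  ultimately show ?thesis
    using complex_module[OF X] unfolding is_complex_def shift_def by simp
qed

text \<open>The sign in the shifted differential affects neither its kernel nor its image, so the
  modules are equal and not merely isomorphic.\<close>

lemma cohomology_shift:
  assumes X: "is_complex R X"
  shows "cocycles (shift X) n = cocycles X (n + 1)"
    and "coboundaries (shift X) n = coboundaries X (n + 1)"
    and "cohomology (shift X) n = cohomology X (n + 1)"
proof -
  interpret d: mod_hom R "obj X (n + 1)" "obj X (n + 1 + 1)" "diff X (n + 1)" by (rule complex_diff[OF X])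
  interpret e: mod_hom R "obj X n" "obj X (n + 1)" "diff X n" by (rule complex_diff[OF X])
  have "\<ominus>\<^bsub>obj X (n + 1 + 1)\<^esub> diff X (n + 1) x = \<zero>\<^bsub>obj X (n + 1 + 1)\<^esub> \<longleftrightarrow>
      diff X (n + 1) x = \<zero>\<^bsub>obj X (n + 1 + 1)\<^esub>" if "x \<in> carrier (obj X (n + 1))" for x
    by (rule neg_eq_zero_iff[OF d.N.module_axioms d.f_im[OF that]])
  then show 1: "cocycles (shift X) n = cocycles X (n + 1)"
    by (auto simp: cocycles_iff shift_def)
  have "(\<lambda>x. \<ominus>\<^bsub>obj X (n + 1)\<^esub> diff X n x) ` carrier (obj X n) = diff X n ` carrier (obj X n)"
    (is "?L = ?R")
  proof
    show "?L \<subseteq> ?R" by (auto intro!: image_eqI[of _ _ "\<ominus>\<^bsub>obj X n\<^esub> _"])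
    show "?R \<subseteq> ?L" by (auto intro!: image_eqI[of _ _ "\<ominus>\<^bsub>obj X n\<^esub> _"])
  qed
  then show 2: "coboundaries (shift X) n = coboundaries X (n + 1)"
    by (simp add: coboundaries_def shift_def)
  show "cohomology (shift X) n = cohomology X (n + 1)"
    unfolding cohomology_def 1 2 by (simp add: shift_def)
qed

section \<open>The mapping cone and its exact cohomology sequence\<close>

lemma cone_obj: "obj (cone X Y f) n = pair_module (obj X (n + 1)) (obj Y n)"
  by (simp add: cone_def relabel_complex_def)

lemma cone_diff:
  "x \<in> carrier (obj X (n + 1)) \<Longrightarrow> y \<in> carrier (obj Y n) \<Longrightarrow>
    diff (cone X Y f) n (upair (x, y)) =
    upair (\<ominus>\<^bsub>obj X (n + 1 + 1)\<^esub> diff X (n + 1) x, f (n + 1) x \<oplus>\<^bsub>obj Y (n + 1)\<^esub> diff Y n y)"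
  by (simp add: cone_def relabel_complex_def direct_sum_def inv_upair)

lemma cone_complex:
  assumes f: "cochain_map R X Y f"
  shows "is_complex R (cone X Y f)"
proof -
  note X = cochain_map_complex(1)[OF f] and Y = cochain_map_complex(2)[OF f]
  have "diff (cone X Y f) n \<in> module_hom R (obj (cone X Y f) n) (obj (cone X Y f) (n + 1))" for n
  proof -
    interpret d: mod_hom R "obj X (n + 1)" "obj X (n + 1 + 1)" "diff X (n + 1)" by (rule complex_diff[OF X])
    interpret e: mod_hom R "obj Y n" "obj Y (n + 1)" "diff Y n" by (rule complex_diff[OF Y])
    interpret f: mod_hom R "obj X (n + 1)" "obj Y (n + 1)" "f (n + 1)" by (rule cochain_map_mod_hom[OF f])
    show ?thesis
      unfolding cone_obj
      by (rule module_homI)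
         (auto elim!: pair_moduleE simp: cone_diff d.N.M.minus_add d.N.smult_r_minus e.N.smult_r_distr e.N.M.a_ac)
  qed
  moreover have "diff (cone X Y f) (n + 1) (diff (cone X Y f) n z) = \<zero>\<^bsub>obj (cone X Y f) (n + 1 + 1)\<^esub>"
    if z: "z \<in> carrier (obj (cone X Y f) n)" for n z
  proof -
    obtain x y where xy: "z = upair (x, y)" "x \<in> carrier (obj X (n + 1))" "y \<in> carrier (obj Y n)"
      using z unfolding cone_obj by (rule pair_moduleE)
    interpret d: mod_hom R "obj X (n + 1)" "obj X (n + 1 + 1)" "diff X (n + 1)" by (rule complex_diff[OF X])
    interpret d': mod_hom R "obj X (n + 1 + 1)" "obj X (n + 1 + 1 + 1)" "diff X (n + 1 + 1)" by (rule complex_diff[OF X])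
    interpret e: mod_hom R "obj Y n" "obj Y (n + 1)" "diff Y n" by (rule complex_diff[OF Y])
    interpret e': mod_hom R "obj Y (n + 1)" "obj Y (n + 1 + 1)" "diff Y (n + 1)" by (rule complex_diff[OF Y])
    interpret f: mod_hom R "obj X (n + 1)" "obj Y (n + 1)" "f (n + 1)" by (rule cochain_map_mod_hom[OF f])
    interpret f': mod_hom R "obj X (n + 1 + 1)" "obj Y (n + 1 + 1)" "f (n + 1 + 1)" by (rule cochain_map_mod_hom[OF f])
    have "diff X (n + 1 + 1) (diff X (n + 1) x) = \<zero>\<^bsub>obj X (n + 1 + 1 + 1)\<^esub>"
      "diff Y (n + 1) (diff Y n y) = \<zero>\<^bsub>obj Y (n + 1 + 1)\<^esub>"
      using X Y xy unfolding is_complex_def by blast+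
    moreover have "diff Y (n + 1) (f (n + 1) x) = f (n + 1 + 1) (diff X (n + 1) x)"
      by (rule cochain_map_commute[OF f xy(2)])
    ultimately show ?thesis
      using xy(2,3) unfolding xy(1) cone_obj
      by (simp del: add.assoc add: cone_diff e'.N.M.l_neg)
  qed
  ultimately show ?thesis
    unfolding is_complex_def using complex_module[OF X] complex_module[OF Y]
    by (auto simp: cone_obj intro: pair_module_module)
qed

lemma cone_in_cochain:
  assumes f: "cochain_map R X Y f"
  shows "cochain_map R Y (cone X Y f) (cone_in X Y)"
proof -
  note X = cochain_map_complex(1)[OF f] and Y = cochain_map_complex(2)[OF f]
  have "cone_in X Y n \<in> hom_set R (obj Y n) (obj (cone X Y f) n)" for n
  proof -
    interpret X: module R "obj X (n + 1)" by (rule complex_module[OF X])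
    interpret Y: module R "obj Y n" by (rule complex_module[OF Y])
    show ?thesis unfolding cone_in_def cone_obj
      by (rule hom_set_restrict[OF Y.module_axioms]) simp_all
  qed
  moreover have "diff (cone X Y f) n (cone_in X Y n y) = cone_in X Y (n + 1) (diff Y n y)"
    if y: "y \<in> carrier (obj Y n)" for n y
  proof -
    interpret d: mod_hom R "obj X (n + 1)" "obj X (n + 1 + 1)" "diff X (n + 1)" by (rule complex_diff[OF X])
    interpret e: mod_hom R "obj Y n" "obj Y (n + 1)" "diff Y n" by (rule complex_diff[OF Y])
    interpret f: mod_hom R "obj X (n + 1)" "obj Y (n + 1)" "f (n + 1)" by (rule cochain_map_mod_hom[OF f])
    show ?thesis using y by (simp add: cone_in_def cone_diff)
  qed
  ultimately show ?thesis using Y cone_complex[OF f] by (simp add: cochain_map_def)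
qed

lemma cone_out_upair:
  "x \<in> carrier (obj X (n + 1)) \<Longrightarrow> y \<in> carrier (obj Y n) \<Longrightarrow> cone_out X Y f n (upair (x, y)) = x"
  by (simp add: cone_out_def cone_obj inv_upair)

lemma cone_out_cochain:
  assumes f: "cochain_map R X Y f"
  shows "cochain_map R (cone X Y f) (shift X) (cone_out X Y f)"
proof -
  note X = cochain_map_complex(1)[OF f] and Y = cochain_map_complex(2)[OF f]
  note C = cone_complex[OF f]
  have "cone_out X Y f n \<in> hom_set R (obj (cone X Y f) n) (obj (shift X) n)" for n
  proof -
    interpret X: module R "obj X (n + 1)" by (rule complex_module[OF X])
    interpret Y: module R "obj Y n" by (rule complex_module[OF Y])
    show ?thesis unfolding cone_out_def
      by (rule hom_set_restrict[OF complex_module[OF C]])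
         (auto simp: cone_obj shift_def inv_upair elim!: pair_moduleE)
  qed
  moreover have "diff (shift X) n (cone_out X Y f n z) = cone_out X Y f (n + 1) (diff (cone X Y f) n z)"
    if z: "z \<in> carrier (obj (cone X Y f) n)" for n z
  proof -
    obtain x y where xy: "z = upair (x, y)" "x \<in> carrier (obj X (n + 1))" "y \<in> carrier (obj Y n)"
      using z unfolding cone_obj by (rule pair_moduleE)
    interpret d: mod_hom R "obj X (n + 1)" "obj X (n + 1 + 1)" "diff X (n + 1)" by (rule complex_diff[OF X])
    interpret e: mod_hom R "obj Y n" "obj Y (n + 1)" "diff Y n" by (rule complex_diff[OF Y])
    interpret f: mod_hom R "obj X (n + 1)" "obj Y (n + 1)" "f (n + 1)" by (rule cochain_map_mod_hom[OF f])
    show ?thesis using xy by (simp add: cone_diff cone_out_upair shift_def)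
  qed
  ultimately show ?thesis using C shift_complex[OF X] by (simp add: cochain_map_def)
qed

text \<open>The first component of the cone differential is that of \<open>shift X\<close>, so its
  sign is absorbed by the comparison of cocycles with the shift.\<close>

lemma cone_cocycles_iff:
  assumes f: "cochain_map R X Y f" and xy: "x \<in> carrier (obj X (n + 1))" "y \<in> carrier (obj Y n)"
  shows "upair (x, y) \<in> cocycles (cone X Y f) n \<longleftrightarrow>
    x \<in> cocycles X (n + 1) \<and> f (n + 1) x \<oplus>\<^bsub>obj Y (n + 1)\<^esub> diff Y n y = \<zero>\<^bsub>obj Y (n + 1)\<^esub>"
proof -
  note X = cochain_map_complex(1)[OF f]
  interpret d: mod_hom R "obj X (n + 1)" "obj X (n + 1 + 1)" "diff X (n + 1)" by (rule complex_diff[OF X])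
  have "x \<in> cocycles X (n + 1) \<longleftrightarrow> x \<in> cocycles (shift X) n" using cohomology_shift(1)[OF X] by simp
  then show ?thesis
    using xy by (simp add: cocycles_iff[of _ "cone X Y f"] cocycles_iff[of _ "shift X"] cone_obj cone_diff)
      (simp add: shift_def)
qed

text \<open>The incoming differential starts in degree \<open>n - 1\<close>, whose first summand is
  \<open>X\<close> in degree \<open>n\<close>.\<close>

lemma cone_coboundaries:
  "coboundaries (cone X Y f) n =
    (\<lambda>(x, y). upair (\<ominus>\<^bsub>obj X (n + 1)\<^esub> diff X n x, f n x \<oplus>\<^bsub>obj Y n\<^esub> diff Y (n - 1) y)) `
      (carrier (obj X n) \<times> carrier (obj Y (n - 1)))"
  using cone_diff[of _ X "n - 1" _ Y f]
  by (auto simp: coboundaries_def cone_obj carrier_pair_module image_image intro!: image_cong)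

lemma upair_in_cone_coboundaries:
  "upair (a, b) \<in> coboundaries (cone X Y f) n \<longleftrightarrow>
    (\<exists>x\<in>carrier (obj X n). \<exists>y\<in>carrier (obj Y (n - 1)).
      a = \<ominus>\<^bsub>obj X (n + 1)\<^esub> diff X n x \<and> b = f n x \<oplus>\<^bsub>obj Y n\<^esub> diff Y (n - 1) y)"
  by (auto simp: cone_coboundaries image_iff)

lemma cone_exact_Y:
  assumes f: "cochain_map R X Y f"
  shows "a_kernel (cohomology Y n) (cohomology (cone X Y f) n) (cohomology_map (cone X Y f) (cone_in X Y) n) =
    cohomology_map Y f n ` carrier (cohomology X n)"
  unfolding cohomology_def cohomology_map_alt
proof (rule subquotient_exact[OF cochain_map_subquotient[OF f] cochain_map_subquotient[OF cone_in_cochain[OF f]]])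
  note X = cochain_map_complex(1)[OF f] and Y = cochain_map_complex(2)[OF f]
  interpret d: mod_hom R "obj X n" "obj X (n + 1)" "diff X n" by (rule complex_diff[OF X])
  interpret e: mod_hom R "obj Y (n - 1)" "obj Y n" "diff Y (n - 1)" by (rule complex_diff'[OF Y])
  interpret f: mod_hom R "obj X n" "obj Y n" "f n" by (rule cochain_map_mod_hom[OF f])
  {
    fix x assume x: "x \<in> cocycles X n"
    \<comment> \<open>For a cocycle \<open>x\<close>, the pair (0, f x) is the coboundary of (x,
      0).\<close>
    then show "cone_in X Y n (f n x) \<in> coboundaries (cone X Y f) n"
      unfolding cone_coboundaries
      by (intro image_eqI[of _ _ "(x, \<zero>\<^bsub>obj Y (n - 1)\<^esub>)"]) (simp_all add: cone_in_def cocycles_iff)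
  next
    fix y assume y: "y \<in> cocycles Y n" "cone_in X Y n y \<in> coboundaries (cone X Y f) n"
    then have "upair (\<zero>\<^bsub>obj X (n + 1)\<^esub>, y) \<in> coboundaries (cone X Y f) n"
      by (simp add: cone_in_def cocycles_iff)
    then obtain x y' where xy: "x \<in> carrier (obj X n)" "y' \<in> carrier (obj Y (n - 1))"
      "\<zero>\<^bsub>obj X (n + 1)\<^esub> = \<ominus>\<^bsub>obj X (n + 1)\<^esub> diff X n x" "y = f n x \<oplus>\<^bsub>obj Y n\<^esub> diff Y (n - 1) y'"
      unfolding upair_in_cone_coboundaries by (elim bexE conjE) (rule that)
    \<comment> \<open>Comparing first components, (0, y) being the coboundary of (x, y') forces
      \<open>x\<close> to be a cocycle; the second component then gives the required decomposition
      of \<open>y\<close>.\<close>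
    have "diff X n x = \<zero>\<^bsub>obj X (n + 1)\<^esub>"
      using neg_eq_zero_iff[OF d.N.module_axioms d.f_im[OF xy(1)]] xy(3)[symmetric] by (rule iffD1)
    then show "\<exists>x\<in>cocycles X n. \<exists>b\<in>coboundaries Y n. y = f n x \<oplus>\<^bsub>obj Y n\<^esub> b"
      using xy(1,2,4) by (auto simp: cocycles_iff coboundaries_def)
  }
qed

lemma cone_exact_cone:
  assumes f: "cochain_map R X Y f"
  shows "a_kernel (cohomology (cone X Y f) n) (cohomology (shift X) n) (cohomology_map (shift X) (cone_out X Y f) n) =
    cohomology_map (cone X Y f) (cone_in X Y) n ` carrier (cohomology Y n)"
  unfolding cohomology_def cohomology_map_alt
proof (rule subquotient_exact[OF cochain_map_subquotient[OF cone_in_cochain[OF f]] cochain_map_subquotient[OF cone_out_cochain[OF f]]])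
  note X = cochain_map_complex(1)[OF f] and Y = cochain_map_complex(2)[OF f]
  interpret d: mod_hom R "obj X n" "obj X (n + 1)" "diff X n" by (rule complex_diff[OF X])
  interpret e: mod_hom R "obj Y (n - 1)" "obj Y n" "diff Y (n - 1)" by (rule complex_diff'[OF Y])
  interpret e': mod_hom R "obj Y n" "obj Y (n + 1)" "diff Y n" by (rule complex_diff[OF Y])
  interpret f: mod_hom R "obj X n" "obj Y n" "f n" by (rule cochain_map_mod_hom[OF f])
  interpret f': mod_hom R "obj X (n + 1)" "obj Y (n + 1)" "f (n + 1)" by (rule cochain_map_mod_hom[OF f])
  {
    fix y assume y: "y \<in> cocycles Y n"
    then have "cone_out X Y f n (cone_in X Y n y) = \<zero>\<^bsub>obj X (n + 1)\<^esub>"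
      by (simp add: cone_in_def cone_out_upair cocycles_iff)
    then show "cone_out X Y f n (cone_in X Y n y) \<in> coboundaries (shift X) n"
      using submodule.zero_closed[OF subquotientD(2)[OF complex_subquotient[OF X]]]
      by (simp add: cohomology_shift(2)[OF X])
  next
    fix z assume z: "z \<in> cocycles (cone X Y f) n" and oz: "cone_out X Y f n z \<in> coboundaries (shift X) n"
    then obtain x y where xy: "z = upair (x, y)" "x \<in> carrier (obj X (n + 1))" "y \<in> carrier (obj Y n)"
      by (auto simp: cocycles_iff cone_obj elim: pair_moduleE)
    obtain x' where x': "x' \<in> carrier (obj X n)" "x = \<ominus>\<^bsub>obj X (n + 1)\<^esub> diff X n x'"
      using oz unfolding xy(1) cone_out_upair[OF xy(2,3)] by (auto simp: coboundaries_def shift_def)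
    have fx: "f (n + 1) x \<oplus>\<^bsub>obj Y (n + 1)\<^esub> diff Y n y = \<zero>\<^bsub>obj Y (n + 1)\<^esub>"
      using z xy by (simp add: cone_cocycles_iff[OF f])
    \<comment> \<open>Subtracting from (x, y) the coboundary of (x', 0), which is (x, f x'), kills
      the first component and leaves (0, y - f x').\<close>
    let ?y = "y \<ominus>\<^bsub>obj Y n\<^esub> f n x'"
    have "diff Y n ?y = diff Y n y \<ominus>\<^bsub>obj Y (n + 1)\<^esub> f (n + 1) (diff X n x')"
      using xy(3) x'(1) by (simp add: cochain_map_commute[OF f x'(1)])
    also have "\<dots> = f (n + 1) x \<oplus>\<^bsub>obj Y (n + 1)\<^esub> diff Y n y"
      using xy(3) x' by (simp add: a_minus_def e'.N.M.a_comm)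
    finally have "?y \<in> cocycles Y n" using xy(3) x'(1) by (simp add: cocycles_iff fx)
    moreover have "upair (x, f n x') \<in> coboundaries (cone X Y f) n"
      unfolding cone_coboundaries using x'
      by (intro image_eqI[of _ _ "(x', \<zero>\<^bsub>obj Y (n - 1)\<^esub>)"]) simp_all
    moreover have "z = cone_in X Y n ?y \<oplus>\<^bsub>obj (cone X Y f) n\<^esub> upair (x, f n x')"
      using xy x'(1) by (simp add: cone_in_def cone_obj a_minus_def e.N.M.a_assoc e.N.M.l_neg)
    ultimately show "\<exists>y\<in>cocycles Y n. \<exists>b\<in>coboundaries (cone X Y f) n.
        z = cone_in X Y n y \<oplus>\<^bsub>obj (cone X Y f) n\<^esub> b"
      by blast
  }
qed

text \<open>A pair (x, y) with \<open>x\<close> a cocycle is itself a cocycle exactly when f x = d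
  (-y), so the classes killed by \<open>f\<close> are the first components of cocycles of the
  cone.\<close>

lemma cone_exact_X:
  assumes f: "cochain_map R X Y f"
  shows "a_kernel (cohomology X (n + 1)) (cohomology Y (n + 1)) (cohomology_map Y f (n + 1)) =
    cohomology_map (shift X) (cone_out X Y f) n ` carrier (cohomology (cone X Y f) n)"
proof -
  note X = cochain_map_complex(1)[OF f] and Y = cochain_map_complex(2)[OF f]
  have so: "obj (shift X) n = obj X (n + 1)" by (simp add: shift_def)
  interpret d: mod_hom R "obj X (n + 1)" "obj X (n + 1 + 1)" "diff X (n + 1)" by (rule complex_diff[OF X])
  interpret e: mod_hom R "obj Y n" "obj Y (n + 1)" "diff Y n" by (rule complex_diff[OF Y])
  interpret f: mod_hom R "obj X (n + 1)" "obj Y (n + 1)" "f (n + 1)" by (rule cochain_map_mod_hom[OF f])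
  note out = cochain_map_subquotient[OF cone_out_cochain[OF f], of n, unfolded so cohomology_shift(1,2)[OF X]]
  have cX: "x \<in> carrier (obj X (n + 1))" if "x \<in> cocycles X (n + 1)" for x using that by (simp add: cocycles_iff)
  show ?thesis
    unfolding cohomology_def cohomology_map_alt so cohomology_shift(2)[OF X]
  proof (rule subquotient_exact[OF out cochain_map_subquotient[OF f]])
    fix z assume z: "z \<in> cocycles (cone X Y f) n"
    then obtain x y where xy: "z = upair (x, y)" "x \<in> carrier (obj X (n + 1))" "y \<in> carrier (obj Y n)"
      by (auto simp: cocycles_iff cone_obj elim: pair_moduleE)
    have "f (n + 1) x \<oplus>\<^bsub>obj Y (n + 1)\<^esub> diff Y n y = \<zero>\<^bsub>obj Y (n + 1)\<^esub>"
      using z xy by (simp add: cone_cocycles_iff[OF f])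
    then have "f (n + 1) x = diff Y n (\<ominus>\<^bsub>obj Y n\<^esub> y)"
      using xy e.N.M.minus_equality[of "f (n + 1) x" "diff Y n y"] by simp
    then show "f (n + 1) (cone_out X Y f n z) \<in> coboundaries Y (n + 1)"
      using xy unfolding coboundaries_def xy(1)
      by (intro image_eqI[of _ _ "\<ominus>\<^bsub>obj Y n\<^esub> y"]) (simp_all add: cone_out_upair)
  next
    fix x assume x: "x \<in> cocycles X (n + 1)" "f (n + 1) x \<in> coboundaries Y (n + 1)"
    then obtain y where y: "y \<in> carrier (obj Y n)" "f (n + 1) x = diff Y n y"
      by (auto simp: coboundaries_def)
    \<comment> \<open>The minus sign makes the two terms f x and d (-y) of the cone differential
      cancel.\<close>
    let ?z = "upair (x, \<ominus>\<^bsub>obj Y n\<^esub> y)"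
    have "?z \<in> cocycles (cone X Y f) n"
      using x y cX[OF x(1)] by (simp add: cone_cocycles_iff[OF f] e.N.M.r_neg)
    moreover have "x = cone_out X Y f n ?z \<oplus>\<^bsub>obj X (n + 1)\<^esub> \<zero>\<^bsub>obj X (n + 1)\<^esub>"
      using cX[OF x(1)] y(1) by (simp add: cone_out_upair)
    moreover have "\<zero>\<^bsub>obj X (n + 1)\<^esub> \<in> coboundaries X (n + 1)"
      by (rule submodule.zero_closed[OF subquotientD(2)[OF complex_subquotient[OF X]]])
    ultimately show "\<exists>z\<in>cocycles (cone X Y f) n. \<exists>b\<in>coboundaries X (n + 1).
        x = cone_out X Y f n z \<oplus>\<^bsub>obj X (n + 1)\<^esub> b"
      by blast
  qed
qed

section \<open>Direct sums of complexes\<close>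

lemma sum_obj: "obj (sum_complex X W) n = pair_module (obj X n) (obj W n)"
  by (simp add: sum_complex_def relabel_complex_def)

lemma sum_diff:
  "x \<in> carrier (obj X n) \<Longrightarrow> w \<in> carrier (obj W n) \<Longrightarrow>
    diff (sum_complex X W) n (upair (x, w)) = upair (diff X n x, diff W n w)"
  by (simp add: sum_complex_def relabel_complex_def direct_sum_def inv_upair)

lemma upair_in_sum_cocycles:
  "upair (x, w) \<in> cocycles (sum_complex X W) n \<longleftrightarrow> x \<in> cocycles X n \<and> w \<in> cocycles W n"
  by (auto simp: cocycles_iff sum_obj sum_diff)

lemma upair_in_sum_coboundaries:
  "upair (a, b) \<in> coboundaries (sum_complex X W) n \<longleftrightarrow> a \<in> coboundaries X n \<and> b \<in> coboundaries W n"
proof -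
  have "coboundaries (sum_complex X W) n = (\<lambda>(x, w). upair (diff X (n - 1) x, diff W (n - 1) w)) `
      (carrier (obj X (n - 1)) \<times> carrier (obj W (n - 1)))"
    by (auto simp: coboundaries_def sum_obj sum_diff carrier_pair_module image_image intro!: image_cong)
  then show ?thesis by (auto simp: coboundaries_def image_iff)
qed

text \<open>The projection to \<open>W\<close> is followed by the inclusion: as an endomorphism of
  the sum it has source and target known to be cofinite, whereas nothing is assumed about the
  cohomology of \<open>W\<close>.\<close>

definition sum_proj ::
  "('a, 'm::infinite) cochain_complex \<Rightarrow> ('a, 'm) cochain_complex \<Rightarrow> int \<Rightarrow> 'm \<Rightarrow> 'm" where
  "sum_proj X W n = (\<lambda>z\<in>carrier (obj (sum_complex X W) n). upair (\<zero>\<^bsub>obj X n\<^esub>, snd (inv_into UNIV upair z)))"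

definition sum_in ::
  "('a, 'm::infinite) cochain_complex \<Rightarrow> ('a, 'm) cochain_complex \<Rightarrow> int \<Rightarrow> 'm \<Rightarrow> 'm" where
  "sum_in X W n = (\<lambda>x\<in>carrier (obj X n). upair (x, \<zero>\<^bsub>obj W n\<^esub>))"

lemma sum_proj_upair:
  "x \<in> carrier (obj X n) \<Longrightarrow> w \<in> carrier (obj W n) \<Longrightarrow> sum_proj X W n (upair (x, w)) = upair (\<zero>\<^bsub>obj X n\<^esub>, w)"
  by (simp add: sum_proj_def sum_obj inv_upair)

lemma sum_complex_complex:
  assumes X: "is_complex R X" and W: "is_complex R W"
  shows "is_complex R (sum_complex X W)"
proof -
  have "diff (sum_complex X W) n \<in> module_hom R (obj (sum_complex X W) n) (obj (sum_complex X W) (n + 1))" for n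
  proof -
    interpret d: mod_hom R "obj X n" "obj X (n + 1)" "diff X n" by (rule complex_diff[OF X])
    interpret e: mod_hom R "obj W n" "obj W (n + 1)" "diff W n" by (rule complex_diff[OF W])
    show ?thesis unfolding sum_obj
      by (rule module_homI) (auto elim!: pair_moduleE simp: sum_diff)
  qed
  moreover have "diff (sum_complex X W) (n + 1) (diff (sum_complex X W) n z) = \<zero>\<^bsub>obj (sum_complex X W) (n + 1 + 1)\<^esub>"
    if z: "z \<in> carrier (obj (sum_complex X W) n)" for n z
  proof -
    obtain x w where xw: "z = upair (x, w)" "x \<in> carrier (obj X n)" "w \<in> carrier (obj W n)"
      using z unfolding sum_obj by (rule pair_moduleE)
    have "diff X (n + 1) (diff X n x) = \<zero>\<^bsub>obj X (n + 1 + 1)\<^esub>" "diff W (n + 1) (diff W n w) = \<zero>\<^bsub>obj W (n + 1 + 1)\<^esub>"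
      using X W xw unfolding is_complex_def by blast+
    with xw mod_hom.f_im[OF complex_diff[OF X] xw(2)] mod_hom.f_im[OF complex_diff[OF W] xw(3)]
    show ?thesis by (simp add: sum_diff sum_obj)
  qed
  ultimately show ?thesis
    unfolding is_complex_def using complex_module[OF X] complex_module[OF W]
    by (auto simp: sum_obj intro: pair_module_module)
qed

lemma sum_in_cochain:
  assumes X: "is_complex R X" and W: "is_complex R W"
  shows "cochain_map R X (sum_complex X W) (sum_in X W)"
proof -
  have "sum_in X W n \<in> hom_set R (obj X n) (obj (sum_complex X W) n)" for n
  proof -
    interpret X: module R "obj X n" by (rule complex_module[OF X])
    interpret W: module R "obj W n" by (rule complex_module[OF W])
    show ?thesis unfolding sum_in_def sum_obj
      by (rule hom_set_restrict[OF X.module_axioms]) simp_all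
  qed
  moreover have "diff (sum_complex X W) n (sum_in X W n x) = sum_in X W (n + 1) (diff X n x)"
    if x: "x \<in> carrier (obj X n)" for n x
  proof -
    interpret d: mod_hom R "obj X n" "obj X (n + 1)" "diff X n" by (rule complex_diff[OF X])
    interpret e: mod_hom R "obj W n" "obj W (n + 1)" "diff W n" by (rule complex_diff[OF W])
    show ?thesis using x by (simp add: sum_in_def sum_diff)
  qed
  ultimately show ?thesis using X sum_complex_complex[OF X W] by (simp add: cochain_map_def)
qed

lemma sum_proj_cochain:
  assumes X: "is_complex R X" and W: "is_complex R W"
  shows "cochain_map R (sum_complex X W) (sum_complex X W) (sum_proj X W)"
proof -
  note S = sum_complex_complex[OF X W]
  have "sum_proj X W n \<in> hom_set R (obj (sum_complex X W) n) (obj (sum_complex X W) n)" for n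
  proof -
    interpret X: module R "obj X n" by (rule complex_module[OF X])
    interpret W: module R "obj W n" by (rule complex_module[OF W])
    show ?thesis unfolding sum_proj_def
      by (rule hom_set_restrict[OF complex_module[OF S]])
         (auto simp: sum_obj inv_upair elim!: pair_moduleE)
  qed
  moreover have "diff (sum_complex X W) n (sum_proj X W n z) = sum_proj X W (n + 1) (diff (sum_complex X W) n z)"
    if z: "z \<in> carrier (obj (sum_complex X W) n)" for n z
  proof -
    obtain x w where xw: "z = upair (x, w)" "x \<in> carrier (obj X n)" "w \<in> carrier (obj W n)"
      using z unfolding sum_obj by (rule pair_moduleE)
    interpret d: mod_hom R "obj X n" "obj X (n + 1)" "diff X n" by (rule complex_diff[OF X])
    interpret e: mod_hom R "obj W n" "obj W (n + 1)" "diff W n" by (rule complex_diff[OF W])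
    show ?thesis using xw by (simp add: sum_proj_upair sum_diff)
  qed
  ultimately show ?thesis using S by (simp add: cochain_map_def)
qed

text \<open>If (0, w) is a coboundary, then (x, w) = (x, 0) + (0, w) is cohomologous to the image of
  \<open>x\<close>.\<close>

lemma cohomology_sum_exact:
  assumes X: "is_complex R X" and W: "is_complex R W"
  shows "a_kernel (cohomology (sum_complex X W) n) (cohomology (sum_complex X W) n)
      (cohomology_map (sum_complex X W) (sum_proj X W) n) =
    cohomology_map (sum_complex X W) (sum_in X W) n ` carrier (cohomology X n)"
  unfolding cohomology_def cohomology_map_alt
proof (rule subquotient_exact[OF cochain_map_subquotient[OF sum_in_cochain[OF X W]] cochain_map_subquotient[OF sum_proj_cochain[OF X W]]])
  interpret X: module R "obj X n" by (rule complex_module[OF X])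
  interpret W: module R "obj W n" by (rule complex_module[OF W])
  note 0 = submodule.zero_closed[OF subquotientD(2)[OF complex_subquotient[OF X]]]
    submodule.zero_closed[OF subquotientD(2)[OF complex_subquotient[OF W]]]
  {
    fix x assume "x \<in> cocycles X n"
    then show "sum_proj X W n (sum_in X W n x) \<in> coboundaries (sum_complex X W) n"
      using 0 by (simp add: cocycles_iff sum_in_def sum_proj_upair upair_in_sum_coboundaries)
  next
    fix z assume z: "z \<in> cocycles (sum_complex X W) n" "sum_proj X W n z \<in> coboundaries (sum_complex X W) n"
    then obtain x w where xw: "z = upair (x, w)" "x \<in> carrier (obj X n)" "w \<in> carrier (obj W n)"
      by (auto simp: cocycles_iff sum_obj elim: pair_moduleE)
    have "x \<in> cocycles X n" using z(1) by (simp add: xw(1) upair_in_sum_cocycles)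
    moreover have "upair (\<zero>\<^bsub>obj X n\<^esub>, w) \<in> coboundaries (sum_complex X W) n"
      using z(2) xw by (simp add: sum_proj_upair)
    moreover have "z = sum_in X W n x \<oplus>\<^bsub>obj (sum_complex X W) n\<^esub> upair (\<zero>\<^bsub>obj X n\<^esub>, w)"
      using xw by (simp add: sum_in_def sum_obj)
    ultimately show "\<exists>x\<in>cocycles X n. \<exists>b\<in>coboundaries (sum_complex X W) n.
        z = sum_in X W n x \<oplus>\<^bsub>obj (sum_complex X W) n\<^esub> b"
      by blast
  }
qed

lemma cohomology_sum_inj:
  assumes X: "is_complex R X" and W: "is_complex R W"
  shows "inj_on (cohomology_map (sum_complex X W) (sum_in X W) n) (carrier (cohomology X n))"
  unfolding cohomology_def cohomology_map_alt
  by (rule subquotient_map_inj[OF cochain_map_subquotient[OF sum_in_cochain[OF X W]]])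
     (simp add: sum_in_def cocycles_iff upair_in_sum_coboundaries)

section \<open>Thickness from abelianness\<close>

lemma small_cohomology:
  assumes "is_complex A (X :: ('a, 'm) cochain_complex)"
  shows "\<exists>K :: ('a, 'm) module. module A K \<and> module_iso A (cohomology X n) K"
  unfolding cohomology_def
  by (rule quot_module_representatives[OF subquotientD(4)[OF complex_subquotient[OF assms]]])

context abelian_cofinite
begin

lemma cohomology_small: "is_complex A (X :: ('a, 'm) cochain_complex) \<Longrightarrow> small (cohomology X n)"
  unfolding small_def by (rule small_cohomology)

lemma D0cofD:
  fixes X :: "('a, 'm) cochain_complex"
  assumes "X \<in> D0cof A \<aa>"
  shows "small (cohomology X n)" "cohomology X n \<in> M0cof A \<aa>"
  using assms cohomology_small by (auto simp: D0cof_def)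

lemma D0cof_summand:
  fixes X W :: "('a, 'm) cochain_complex"
  assumes X: "is_complex A X" and W: "is_complex A W" and S: "sum_complex X W \<in> D0cof A \<aa>"
  shows "X \<in> D0cof A \<aa>"
proof -
  have "cohomology X n \<in> M0cof A \<aa>" for n
    by (rule M0cof_kernel[OF D0cofD[OF S] D0cofD[OF S] cohomology_map_hom[OF sum_proj_cochain[OF X W]]
      cohomology_map_hom[OF sum_in_cochain[OF X W]] cohomology_sum_inj[OF X W] cohomology_sum_exact[OF X W]])
  with X show ?thesis by (simp add: D0cof_def)
qed

lemma D0cof_cone:
  fixes X Y :: "('a, 'm) cochain_complex"
  assumes f: "cochain_map A X Y f"
  shows "X \<in> D0cof A \<aa> \<Longrightarrow> Y \<in> D0cof A \<aa> \<Longrightarrow> cone X Y f \<in> D0cof A \<aa>"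
    and "X \<in> D0cof A \<aa> \<Longrightarrow> cone X Y f \<in> D0cof A \<aa> \<Longrightarrow> Y \<in> D0cof A \<aa>"
    and "Y \<in> D0cof A \<aa> \<Longrightarrow> cone X Y f \<in> D0cof A \<aa> \<Longrightarrow> X \<in> D0cof A \<aa>"
proof -
  let ?C = "cone X Y f"
  note X = cochain_map_complex(1)[OF f] and Y = cochain_map_complex(2)[OF f] and C = cone_complex[OF f]
  note hf = cohomology_map_hom[OF f] and hin = cohomology_map_hom[OF cone_in_cochain[OF f]]
    and hout = cohomology_map_hom[OF cone_out_cochain[OF f], unfolded cohomology_shift(3)[OF X]]
  note exY = cone_exact_Y[OF f] and exC = cone_exact_cone[OF f, unfolded cohomology_shift(3)[OF X]]
    and exX = cone_exact_X[OF f]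
  \<comment> \<open>The same maps and exact sequences one degree lower, with
    \<open>n - 1 + 1\<close> simplified, for the cases in which \<open>X\<close> or \<open>Y\<close>
    is the middle term.\<close>
  have hout': "mod_hom A (cohomology ?C (n - 1)) (cohomology X n) (cohomology_map (shift X) (cone_out X Y f) (n - 1))" for n
    using hout[of "n - 1"] by simp
  have exC': "a_kernel (cohomology ?C (n - 1)) (cohomology X n) (cohomology_map (shift X) (cone_out X Y f) (n - 1)) =
      cohomology_map ?C (cone_in X Y) (n - 1) ` carrier (cohomology Y (n - 1))" for n
    using exC[of "n - 1"] by simp
  have exX': "a_kernel (cohomology X n) (cohomology Y n) (cohomology_map Y f n) =
      cohomology_map (shift X) (cone_out X Y f) (n - 1) ` carrier (cohomology ?C (n - 1))" for n
    using exX[of "n - 1"] by simp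
  show "?C \<in> D0cof A \<aa>" if "X \<in> D0cof A \<aa>" "Y \<in> D0cof A \<aa>"
  proof -
    note dX = D0cofD[OF that(1)] and dY = D0cofD[OF that(2)]
    \<comment> \<open>Five consecutive terms: H^n(X), H^n(Y), H^n(C), H^(n+1)(X),
      H^(n+1)(Y).\<close>
    have "cohomology ?C n \<in> M0cof A \<aa>" for n
      by (rule M0cof_five[OF dX dY dX dY hf hin hout hf exY exC exX])
    with C show ?thesis by (simp add: D0cof_def)
  qed
  show "Y \<in> D0cof A \<aa>" if "X \<in> D0cof A \<aa>" "?C \<in> D0cof A \<aa>"
  proof -
    note dX = D0cofD[OF that(1)] and dC = D0cofD[OF that(2)]
    \<comment> \<open>Five consecutive terms: H^(n-1)(C), H^n(X), H^n(Y), H^n(C),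
      H^(n+1)(X).\<close>
    have "cohomology Y n \<in> M0cof A \<aa>" for n
      by (rule M0cof_five[OF dC dX dC dX hout' hf hin hout exX' exY exC])
    with Y show ?thesis by (simp add: D0cof_def)
  qed
  show "X \<in> D0cof A \<aa>" if "Y \<in> D0cof A \<aa>" "?C \<in> D0cof A \<aa>"
  proof -
    note dY = D0cofD[OF that(1)] and dC = D0cofD[OF that(2)]
    \<comment> \<open>Five consecutive terms: H^(n-1)(Y), H^(n-1)(C), H^n(X), H^n(Y),
      H^n(C).\<close>
    have "cohomology X n \<in> M0cof A \<aa>" for n
      by (rule M0cof_five[OF dY dC dY dC hin hout' hf hin exC' exX' exY])
    with X show ?thesis by (simp add: D0cof_def)
  qed
qed

lemma D0cof_thick: "thick_subcategory A (D0cof A \<aa> :: ('a, 'm) cochain_complex set)"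
  unfolding thick_subcategory_def
proof (intro conjI allI impI)
  show "(D0cof A \<aa> :: ('a, 'm) cochain_complex set) \<subseteq> {X. is_complex A X}"
    by (auto simp: D0cof_def)
next
  fix X W Z :: "('a, 'm) cochain_complex" and t
  assume *: "is_complex A X \<and> is_complex A W \<and> Z \<in> D0cof A \<aa> \<and> diso A Z (sum_complex X W) t"
  then show "X \<in> D0cof A \<aa>"
    using D0cof_diso[of Z "sum_complex X W" t] D0cof_summand[of X W] by simp
next
  fix X Y Z :: "('a, 'm) cochain_complex" and u v w
  assume "exact_triangle A X Y Z u v w"
  then obtain X' Y' f a b c where f: "cochain_map A X' Y' f" and d: "diso A X X' a" "diso A Y Y' b"
    "diso A Z (cone X' Y' f) c"
    unfolding exact_triangle_def by (elim conjE exE) (rule that)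
  \<comment> \<open>Membership is invariant under isomorphism in D(A), so each vertex of the
    triangle may be replaced by the matching vertex of a cone triangle.\<close>
  have iff: "X \<in> D0cof A \<aa> \<longleftrightarrow> X' \<in> D0cof A \<aa>" "Y \<in> D0cof A \<aa> \<longleftrightarrow> Y' \<in> D0cof A \<aa>"
    "Z \<in> D0cof A \<aa> \<longleftrightarrow> cone X' Y' f \<in> D0cof A \<aa>"
    using D0cof_diso[OF d(1)] D0cof_diso'[OF d(1)] D0cof_diso[OF d(2)] D0cof_diso'[OF d(2)]
      D0cof_diso[OF d(3)] D0cof_diso'[OF d(3)] by (intro iffI; assumption?; simp)+
  show "X \<in> D0cof A \<aa> \<and> Y \<in> D0cof A \<aa> \<Longrightarrow> Z \<in> D0cof A \<aa>"
    "X \<in> D0cof A \<aa> \<and> Z \<in> D0cof A \<aa> \<Longrightarrow> Y \<in> D0cof A \<aa>"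
    "Y \<in> D0cof A \<aa> \<and> Z \<in> D0cof A \<aa> \<Longrightarrow> X \<in> D0cof A \<aa>"
    unfolding iff using D0cof_cone[OF f] by simp_all
qed

end

section \<open>Abelianness from thickness\<close>

lemma diso_did: "is_complex R X \<Longrightarrow> diso R X X (did X)"
  unfolding diso_def using dmor_did[of R X] deq.id_left[OF dmor_did[of R X]] by blast

text \<open>With this the third square of a cone triangle compared with itself has an identity on
  both sides.\<close>

lemma dshift_did: "dshift (did X) = did (shift X)"
  by (simp add: id_map_def fun_eq_iff shift_def)

text \<open>The cone triangle is compared with itself along three identities, so every square
  reduces to the two unit laws.\<close>

lemma cone_exact_triangle:
  assumes f: "cochain_map R X Y f"
  shows "exact_triangle R X Y (cone X Y f) (Fwd X Y f) (Fwd Y (cone X Y f) (cone_in X Y))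
    (Fwd (cone X Y f) (shift X) (cone_out X Y f))"
proof -
  let ?C = "cone X Y f"
  note m = dmor.Fwd[OF f] dmor.Fwd[OF cone_in_cochain[OF f]] dmor.Fwd[OF cone_out_cochain[OF f]]
  note c = cochain_map_complex[OF f] cone_complex[OF f]
  have sq: "deq R V W (Cmp (did W) t) (Cmp t (did V))" if "dmor R V W t" for V W t
    using deq.trans[OF deq.id_left[OF that] deq.sym[OF deq.id_right[OF that]]] .
  show ?thesis
    unfolding exact_triangle_def
    by (intro conjI m exI[of _ X] exI[of _ Y] exI[of _ f] exI[of _ "did X"] exI[of _ "did Y"]
        exI[of _ "did ?C"] f diso_did c) (simp_all only: dshift_did sq m)
qed

text \<open>The zero module in the other degrees is cut out of \<open>M\<close>, so that zero,
  addition and scalar multiplication are those of \<open>M\<close> in every degree.\<close>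

definition single :: "('a, 'm) module \<Rightarrow> ('a, 'm) cochain_complex" where
  "single M = \<lparr>obj = (\<lambda>n. if n = 0 then M else M\<lparr>carrier := {\<zero>\<^bsub>M\<^esub>}\<rparr>), diff = (\<lambda>n x. \<zero>\<^bsub>M\<^esub>)\<rparr>"

definition single_map :: "('a, 'm) module \<Rightarrow> ('a, 'm) module \<Rightarrow> ('m \<Rightarrow> 'm) \<Rightarrow> int \<Rightarrow> 'm \<Rightarrow> 'm" where
  "single_map M N f n = (if n = 0 then f else (\<lambda>x\<in>{\<zero>\<^bsub>M\<^esub>}. \<zero>\<^bsub>N\<^esub>))"

lemma single_zero [simp]: "\<zero>\<^bsub>obj (single M) n\<^esub> = \<zero>\<^bsub>M\<^esub>"
  and single_add [simp]: "x \<oplus>\<^bsub>obj (single M) n\<^esub> y = x \<oplus>\<^bsub>M\<^esub> y"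
  and single_smult [simp]: "r \<odot>\<^bsub>obj (single M) n\<^esub> x = r \<odot>\<^bsub>M\<^esub> x"
  and single_diff [simp]: "diff (single M) n x = \<zero>\<^bsub>M\<^esub>"
  and single_carrier: "carrier (obj (single M) n) = (if n = 0 then carrier M else {\<zero>\<^bsub>M\<^esub>})"
  by (simp_all add: single_def)

lemma single_module: "module R M \<Longrightarrow> module R (obj (single M) n)"
  by (simp add: single_def md_module zero_submodule)

lemma single_complex:
  assumes M: "module R M" shows "is_complex R (single M)"
proof -
  interpret module R M by fact
  show ?thesis
    unfolding is_complex_def
    by (intro conjI allI single_module M module_homI) (auto simp: single_carrier)
qed

lemma single_cocycles: "cocycles (single M) n = carrier (obj (single M) n)"
  by (auto simp: cocycles_iff)

lemma single_coboundaries: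
  assumes M: "module R M" shows "coboundaries (single M) n = {\<zero>\<^bsub>M\<^esub>}"
proof -
  interpret module R M by fact
  show ?thesis by (auto simp: coboundaries_def single_carrier image_iff)
qed

lemma single_cochain:
  assumes M: "module R M" and N: "module R N" and f: "f \<in> hom_set R M N"
  shows "cochain_map R (single M) (single N) (single_map M N f)"
proof -
  interpret f: mod_hom R M N f by (rule hom_set_mod_hom[OF M N f])
  have "(\<lambda>x\<in>{\<zero>\<^bsub>M\<^esub>}. \<zero>\<^bsub>N\<^esub>) \<in> hom_set R (M\<lparr>carrier := {\<zero>\<^bsub>M\<^esub>}\<rparr>) (N\<lparr>carrier := {\<zero>\<^bsub>N\<^esub>}\<rparr>)"
    using hom_set_restrict[of R "M\<lparr>carrier := {\<zero>\<^bsub>M\<^esub>}\<rparr>" "\<lambda>x. \<zero>\<^bsub>N\<^esub>" "N\<lparr>carrier := {\<zero>\<^bsub>N\<^esub>}\<rparr>"]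
    by (simp add: md_module zero_submodule M)
  then have "single_map M N f n \<in> hom_set R (obj (single M) n) (obj (single N) n)" for n
    using f by (simp add: single_map_def single_def)
  moreover have "single_map M N f n \<zero>\<^bsub>M\<^esub> = \<zero>\<^bsub>N\<^esub>" for n
    by (simp add: single_map_def)
  ultimately show ?thesis
    using single_complex[OF M] single_complex[OF N] by (simp add: cochain_map_def)
qed

text \<open>All differentials vanish, so cohomology is isomorphic to the object in the same degree,
  which is \<open>M\<close> or a zero module.\<close>

lemma (in noetherian_ideal) single_D0cof:
  assumes M: "M \<in> M0cof A \<aa>"
  shows "single M \<in> D0cof A \<aa>"
proof -
  note mM = M0cof_module[OF M]
  note X = single_complex[OF mM]
  have "cohomology (single M) n \<in> M0cof A \<aa>" for n
  proof -
    let ?O = "obj (single M) n"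
    have O: "?O \<in> M0cof A \<aa>"
      using M M0cof_zero[OF single_module[OF mM], of n] by (cases "n = 0") (simp_all add: single_def)
    interpret O: module A ?O by (rule single_module[OF mM])
    have eq: "?O\<lparr>carrier := cocycles (single M) n\<rparr> = ?O" unfolding single_cocycles by simp
    have id: "mod_hom A (?O\<lparr>carrier := cocycles (single M) n\<rparr>) ?O (\<lambda>x. x)"
      unfolding eq by (intro mod_homI O.module_axioms module_homI) simp_all
    have "module_iso A (cohomology (single M) n) ?O"
      unfolding cohomology_def
      by (rule subquotient_iso[OF complex_subquotient[OF X] id])
         (simp_all add: single_cocycles single_coboundaries[OF mM])
    from M0cof_iso[OF O cohomology_module[OF X] module_iso_sym[OF cohomology_module[OF X] O.module_axioms this]]
    show ?thesis .
  qed
  with X show ?thesis by (simp add: D0cof_def)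
qed

text \<open>The shift in the cone puts \<open>M\<close> in degree -1 next to a zero module, and the
  differential there is (x, 0) to (0, f x). Nothing nonzero arrives from degree -2.\<close>

lemma single_cone_kernel:
  fixes M N :: "('a, 'm::infinite) module"
  assumes M: "module R M" and N: "module R N" and f: "f \<in> hom_set R M N"
  shows "module_iso R (cohomology (cone (single M) (single N) (single_map M N f)) (-1))
    (M\<lparr>carrier := a_kernel M N f\<rparr>)"
proof -
  let ?X = "single M" and ?Y = "single N" and ?f = "single_map M N f"
  let ?C = "cone ?X ?Y ?f"
  interpret f: mod_hom R M N f by (rule hom_set_mod_hom[OF M N f])
  note g = single_cochain[OF M N f]
  note C = cone_complex[OF g]
  have K: "submodule R (a_kernel M N f) M" by (rule ker_submodule[OF f.mod_hom_axioms])
  have obj: "obj ?C (-1) = pair_module M (N\<lparr>carrier := {\<zero>\<^bsub>N\<^esub>}\<rparr>)"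
    by (simp add: cone_obj single_def)
  have Z: "cocycles ?C (-1) = (\<lambda>x. upair (x, \<zero>\<^bsub>N\<^esub>)) ` a_kernel M N f"
  proof (intro equalityI subsetI)
    fix z assume z: "z \<in> cocycles ?C (-1)"
    then have "z \<in> carrier (pair_module M (N\<lparr>carrier := {\<zero>\<^bsub>N\<^esub>}\<rparr>))" by (simp add: cocycles_iff obj)
    then obtain x y where "z = upair (x, y)" "x \<in> carrier M" "y \<in> carrier (N\<lparr>carrier := {\<zero>\<^bsub>N\<^esub>}\<rparr>)"
      by (rule pair_moduleE)
    with z show "z \<in> (\<lambda>x. upair (x, \<zero>\<^bsub>N\<^esub>)) ` a_kernel M N f"
      using cone_cocycles_iff[OF g, of x "-1" y] by (simp add: single_carrier single_map_def a_kernel_iff)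
  next
    fix z assume "z \<in> (\<lambda>x. upair (x, \<zero>\<^bsub>N\<^esub>)) ` a_kernel M N f"
    then obtain x where "z = upair (x, \<zero>\<^bsub>N\<^esub>)" "x \<in> carrier M" "f x = \<zero>\<^bsub>N\<^esub>" by (auto simp: a_kernel_iff)
    then show "z \<in> cocycles ?C (-1)"
      using cone_cocycles_iff[OF g, of x "-1" "\<zero>\<^bsub>N\<^esub>"] by (simp add: single_carrier single_map_def single_cocycles)
  qed
  \<comment> \<open>Inverses depend on the carrier, so even the negative of zero has to be computed
    in each degree of \<open>single M\<close> separately.\<close>
  have neg: "\<ominus>\<^bsub>obj ?X n\<^esub> \<zero>\<^bsub>M\<^esub> = \<zero>\<^bsub>M\<^esub>" for n
    using module.neg_zero[OF single_module[OF M], of n] by simp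
  have B: "upair (x, \<zero>\<^bsub>N\<^esub>) \<in> coboundaries ?C (-1) \<longleftrightarrow> x = \<zero>\<^bsub>M\<^esub>" for x
    by (auto simp: upair_in_cone_coboundaries single_carrier single_map_def neg)
  let ?p = "\<lambda>z. fst (inv_into UNIV upair z)"
  have "mod_hom R (obj ?C (-1)) M ?p"
    unfolding obj
    by (intro mod_homI M pair_module_module md_module zero_submodule N module_homI)
       (auto elim!: pair_moduleE simp: inv_upair)
  then have p: "mod_hom R ((obj ?C (-1))\<lparr>carrier := cocycles ?C (-1)\<rparr>) (M\<lparr>carrier := a_kernel M N f\<rparr>) ?p"
    by (rule mod_hom_md[OF _ subquotientD(1)[OF complex_subquotient[OF C]] K]) (auto simp: Z inv_upair)
  show ?thesis
    unfolding cohomology_def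
  proof (rule subquotient_iso[OF complex_subquotient[OF C] p])
    show "?p ` cocycles ?C (-1) = carrier (M\<lparr>carrier := a_kernel M N f\<rparr>)"
      by (simp add: Z image_image inv_upair)
  qed (auto simp: Z B inv_upair)
qed

text \<open>In degree 0 the cone is a zero module next to \<open>N\<close>, where everything is a
  cocycle; the coboundaries arriving from \<open>M\<close> in degree -1 are the pairs (0, f
  x).\<close>

lemma single_cone_cokernel:
  fixes M N :: "('a, 'm::infinite) module"
  assumes M: "module R M" and N: "module R N" and f: "f \<in> hom_set R M N"
  shows "module_iso R (cohomology (cone (single M) (single N) (single_map M N f)) 0)
    (quot_module N (f ` carrier M))"
proof -
  let ?X = "single M" and ?Y = "single N" and ?f = "single_map M N f"
  let ?C = "cone ?X ?Y ?f"
  interpret f: mod_hom R M N f by (rule hom_set_mod_hom[OF M N f])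
  note g = single_cochain[OF M N f]
  note C = cone_complex[OF g]
  have I: "submodule R (f ` carrier M) N" by (rule im_submodule[OF f.mod_hom_axioms])
  have obj: "obj ?C 0 = pair_module (M\<lparr>carrier := {\<zero>\<^bsub>M\<^esub>}\<rparr>) N"
    by (simp add: cone_obj single_def)
  have Z: "cocycles ?C 0 = (\<lambda>y. upair (\<zero>\<^bsub>M\<^esub>, y)) ` carrier N"
  proof (intro equalityI subsetI)
    fix z assume z: "z \<in> cocycles ?C 0"
    then have "z \<in> carrier (pair_module (M\<lparr>carrier := {\<zero>\<^bsub>M\<^esub>}\<rparr>) N)" by (simp add: cocycles_iff obj)
    then obtain x y where "z = upair (x, y)" "x \<in> carrier (M\<lparr>carrier := {\<zero>\<^bsub>M\<^esub>}\<rparr>)" "y \<in> carrier N"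
      by (rule pair_moduleE)
    then show "z \<in> (\<lambda>y. upair (\<zero>\<^bsub>M\<^esub>, y)) ` carrier N" by simp
  next
    fix z assume "z \<in> (\<lambda>y. upair (\<zero>\<^bsub>M\<^esub>, y)) ` carrier N"
    then obtain y where "z = upair (\<zero>\<^bsub>M\<^esub>, y)" "y \<in> carrier N" by auto
    then show "z \<in> cocycles ?C 0"
      using cone_cocycles_iff[OF g, of "\<zero>\<^bsub>M\<^esub>" 0 y] by (simp add: single_carrier single_map_def single_cocycles)
  qed
  have neg: "\<ominus>\<^bsub>obj ?X n\<^esub> \<zero>\<^bsub>M\<^esub> = \<zero>\<^bsub>M\<^esub>" for n
    using module.neg_zero[OF single_module[OF M], of n] by simp
  have B: "upair (\<zero>\<^bsub>M\<^esub>, y) \<in> coboundaries ?C 0 \<longleftrightarrow> y \<in> f ` carrier M" for y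
    by (auto simp: upair_in_cone_coboundaries single_carrier single_map_def neg image_iff)
  let ?p = "\<lambda>z. f ` carrier M +>\<^bsub>N\<^esub> snd (inv_into UNIV upair z)"
  have snd: "(\<lambda>z. snd (inv_into UNIV upair z)) \<in> module_hom R (obj ?C 0) N"
    unfolding obj by (rule module_homI) (auto elim!: pair_moduleE simp: inv_upair)
  have "mod_hom R (obj ?C 0) (quot_module N (f ` carrier M)) ?p"
    by (intro mod_homI complex_module[OF C] quot_module_module I module_hom_comp[OF snd quot_proj_hom[OF I]])
  then have p: "mod_hom R ((obj ?C 0)\<lparr>carrier := cocycles ?C 0\<rparr>) (quot_module N (f ` carrier M)) ?p"
    by (rule mod_hom_md_dom[OF _ subquotientD(1)[OF complex_subquotient[OF C]]])
  show ?thesis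
    unfolding cohomology_def
  proof (rule subquotient_iso[OF complex_subquotient[OF C] p])
    show "?p ` cocycles ?C 0 = carrier (quot_module N (f ` carrier M))"
      by (simp add: Z image_image inv_upair carrier_quot_module)
    fix z assume "z \<in> cocycles ?C 0"
    then obtain y where "z = upair (\<zero>\<^bsub>M\<^esub>, y)" "y \<in> carrier N" by (auto simp: Z)
    then show "?p z = \<zero>\<^bsub>quot_module N (f ` carrier M)\<^esub> \<longleftrightarrow> z \<in> coboundaries ?C 0"
      using coset_zero_iff[OF I, of y] by (simp add: B inv_upair) (simp add: quot_module_def)
  qed
qed

lemma (in noetherian_ideal) M0cof_abelian:
  assumes thick: "thick_subcategory A (D0cof A \<aa> :: ('a, 'm::infinite) cochain_complex set)"
  shows "abelian_subcategory A (M0cof A \<aa> :: ('a, 'm) module set)"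
  unfolding abelian_subcategory_def
proof (intro conjI ballI allI impI)
  show "(M0cof A \<aa> :: ('a, 'm) module set) \<subseteq> {M. module A M}"
    by (auto dest: M0cof_module)
  fix M N :: "('a, 'm) module" and f
  assume M: "M \<in> M0cof A \<aa>" and N: "N \<in> M0cof A \<aa>" and f: "f \<in> hom_set A M N"
  note mM = M0cof_module[OF M] and mN = M0cof_module[OF N]
  let ?C = "cone (single M) (single N) (single_map M N f)"
  note g = single_cochain[OF mM mN f]
  have "?C \<in> D0cof A \<aa>"
    using thick cone_exact_triangle[OF g] single_D0cof[OF M] single_D0cof[OF N]
    unfolding thick_subcategory_def by blast
  then have C: "cohomology ?C n \<in> M0cof A \<aa>" for n by (simp add: D0cof_def)
  {
    fix K :: "('a, 'm) module"
    assume *: "module A K \<and> module_iso A (M\<lparr>carrier := a_kernel M N f\<rparr>) K"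
    show "K \<in> M0cof A \<aa>"
      by (rule M0cof_iso[OF C conjunct1[OF *] module_iso_trans[OF single_cone_kernel[OF mM mN f] conjunct2[OF *]]])
  next
    fix Q :: "('a, 'm) module"
    assume *: "module A Q \<and> module_iso A (quot_module N (f ` carrier M)) Q"
    show "Q \<in> M0cof A \<aa>"
      by (rule M0cof_iso[OF C conjunct1[OF *] module_iso_trans[OF single_cone_cokernel[OF mM mN f] conjunct2[OF *]]])
  }
qed

theorem proposition3p3:
  fixes A :: "('a, 'b) ring_scheme" and \<aa> :: "'a set"
  assumes "cring A" and "noetherian_ring A" and "ideal \<aa> A"
  shows "thick_subcategory A (D0cof A \<aa> :: ('a, 'm::infinite) cochain_complex set) \<longleftrightarrow>
         abelian_subcategory A (M0cof A \<aa> :: ('a, 'm) module set)"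
proof
  interpret noetherian_ideal A \<aa> using assms by (rule noetherian_ideal.intro)
  show "abelian_subcategory A (M0cof A \<aa> :: ('a, 'm) module set)"
    if "thick_subcategory A (D0cof A \<aa> :: ('a, 'm) cochain_complex set)"
    using that by (rule M0cof_abelian)
  show "thick_subcategory A (D0cof A \<aa> :: ('a, 'm) cochain_complex set)"
    if "abelian_subcategory A (M0cof A \<aa> :: ('a, 'm) module set)"
  proof -
    interpret abelian_cofinite A \<aa> "TYPE('m)" using that by unfold_locales
    show ?thesis by (rule D0cof_thick)
  qed
qed

end
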